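(* Let $V$ be a locally finite $\mathfrak g^\vee$-module. For any perfect bases $\mathbf B$ and $\mathbf B'$ of $V$, the normal Kashiwara crystals $\mathcal B(V,\mathbf B)$ and $\mathcal B(V,\mathbf B')$ are isomorphic.
   Context: $G$ is a split reductive group with maximal torus $T$, Dynkin vertex set $I$, simple roots $\alpha_i\in X^\star(T)$ and simple coroots $\alpha_i^\vee\in X_\star(T)$; $\mathfrak g^\vee$ is the (complex) Lie algebra of the Langlands dual group $G^\vee$, with weight lattice $X_\star(T)$, simple roots $\alpha_i^\vee$, and Chevalley generators $e_i$ (weight $\alpha_i^\vee$) and $e_{-i}$ (weight $-\alpha_i^\vee$), $i\in I$. $\langle\cdot,\cdot\rangle:X^\star(T)\times X_\star(T)\to\mathbb Z$ is the canonical pairing. A $\mathfrak g^\vee$-module $V$ is locally finite if $V=\bigoplus_{\mu\in X_\star(T)}V(\mu)$ (weight decomposition) and $U(\mathfrak g^\vee)(v)$ is finite-dimensional for every $v\in V$. For $i\in I\sqcup -I$ and $v\ne0$, $\ell_i(v)$ is the largest $\ell\ge0$ with $e_i^{\ell}(v)\ne0$, and $V_i^{<\ell}=\{v\in V:e_i^\ell(v)=0\}$. A partial bijection of a set is a bijection between two of its subsets. A basis $\mathbf B$ of $V$ consisting of weight vectors is ($\mathfrak g^\vee$-)perfect if for each $i\in I\sqcup-I$ there is a partial bijection $\tilde e_i:\mathbf B\to\mathbf B$ such that $\tilde e_i(b)$ is defined iff $e_i(b)\ne0$, and in that case $e_i(b)\in\mathbb C^\times\cdot\tilde e_i(b)+V_i^{<\ell_i(b)-1}$.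 (Then $\tilde e_{-i}=\tilde e_i^{-1}$ for $i\in I$.) $\mathcal B(V,\mathbf B)$ is the Kashiwara crystal with underlying set $\mathbf B$, weight map $\tilde\gamma:\mathbf B\to X_\star(T)$, functions $\tilde\varepsilon_i=\ell_i$, $\tilde\varphi_i=\ell_{-i}=\tilde\varepsilon_i+\langle\alpha_i,\tilde\gamma(\cdot)\rangle$, and partial bijections $\tilde e_i$ ($i\in I$). It is normal: $\tilde\varepsilon_i(b)=\max\{n\ge0:\tilde e_i^{\,n}(b)\text{ defined}\}$ and $\tilde\varphi_i(b)=\max\{n\ge0:\tilde e_i^{\,-n}(b)\text{ defined}\}$. An isomorphism of crystals is a bijection commuting with all $\tilde e_i$ and preserving $\tilde\gamma,\tilde\varphi_i,\tilde\varepsilon_i$. *)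

theory Defs
  imports Complex_Main
begin

(* The canonical action of the integers on an abelian group. *)
definition zscale :: "int \<Rightarrow> 'a::ab_group_add \<Rightarrow> 'a" where
  "zscale n x = (\<Sum>_<nat n. x) - (\<Sum>_<nat (- n). x)"

lemma zscale_diff: "zscale (int a - int b) x = (\<Sum>_<a. x) - (\<Sum>_<b. x)"
proof (cases "b \<le> a")
  case True
  then obtain k where "a = b + k" using le_Suc_ex by blast
  then show ?thesis by (induction b arbitrary: a) (simp_all add: zscale_def)
next
  case False
  then obtain k where "b = a + k" using le_Suc_ex by (metis nat_le_linear)
  then show ?thesis by (induction a arbitrary: b) (simp_all add: zscale_def)
qed

lemma sum_const_add: "(\<Sum>_<a + b. x) = (\<Sum>_<a. x) + (\<Sum>_<(b::nat). x::'a::ab_group_add)"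
  by (induction b) (simp_all add: algebra_simps)

lemma sum_const_mult: "(\<Sum>_<a * b. x) = (\<Sum>_<a. \<Sum>_<(b::nat). x::'a::ab_group_add)"
  by (induction a) (simp_all add: sum_const_add algebra_simps)

lemma zscale_add_left: "zscale (m + n) x = zscale m x + zscale n x"
proof -
  obtain a b c d where mn: "m = int a - int b" "n = int c - int d"
    by (metis int_diff_cases)
  then have "m + n = int (a + c) - int (b + d)" by simp
  then show ?thesis
    unfolding mn by (simp only: zscale_diff sum_const_add) (simp add: algebra_simps)
qed

lemma zscale_add_right: "zscale n (x + y) = zscale n x + zscale n y"
  by (simp add: zscale_def sum.distrib algebra_simps)

lemma zscale_minus_left: "zscale (- n) x = - zscale n x"
  by (simp add: zscale_def)

lemma zscale_zero_right: "zscale n 0 = 0"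
  by (simp add: zscale_def)

lemma zscale_mult: "zscale m (zscale n x) = zscale (m * n) x"
proof (induction m rule: int_induct[where k = 0])
  case base
  show ?case by (simp add: zscale_def)
next
  case (step1 i)
  have "zscale 1 y = y" for y :: 'a by (simp add: zscale_def)
  with step1 show ?case by (simp add: zscale_add_left distrib_right)
next
  case (step2 i)
  have "zscale (- 1) y = - y" for y :: 'a by (simp add: zscale_def)
  then show ?case
    using step2 zscale_add_left[of i "- 1" "zscale n x"] zscale_add_left[of "i * n" "- n" x]
    by (simp add: zscale_minus_left left_diff_distrib)
qed

interpretation zmod: module zscale
  by unfold_locales
    (simp_all add: zscale_add_left zscale_add_right zscale_mult, simp add: zscale_def)

definition free_finite_rank :: "'a::ab_group_add itself \<Rightarrow> bool" where
  "free_finite_rank _ \<longleftrightarrow>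
     (\<exists>S :: 'a set. finite S \<and> zmod.independent S \<and> zmod.span S = UNIV)"

(* The root datum (X, R, Y, R^vee) of (G, T) together with a base of R: the type 'x is the
   character lattice of T, 'y is the cocharacter lattice, and I indexes the simple roots. *)
locale based_root_datum =
  fixes pairing :: "'x::ab_group_add \<Rightarrow> 'y::ab_group_add \<Rightarrow> int"
    and R :: "'x set"
    and coroot :: "'x \<Rightarrow> 'y"
    and I :: "'i set"
    and simple :: "'i \<Rightarrow> 'x"
  assumes free_X: "free_finite_rank TYPE('x)"
    and free_Y: "free_finite_rank TYPE('y)"
    and pairing_add_left: "pairing (x + x') y = pairing x y + pairing x' y"
    and pairing_add_right: "pairing x (y + y') = pairing x y + pairing x y'"
    and pairing_perfect_left: "additive (\<phi> :: 'x \<Rightarrow> int) \<Longrightarrow> \<exists>!y. \<forall>x. \<phi> x = pairing x y"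
    and pairing_perfect_right: "additive (\<psi> :: 'y \<Rightarrow> int) \<Longrightarrow> \<exists>!x. \<forall>y. \<psi> y = pairing x y"
    and finite_roots: "finite R"
    and inj_coroot: "inj_on coroot R"
    and pairing_coroot: "\<alpha> \<in> R \<Longrightarrow> pairing \<alpha> (coroot \<alpha>) = 2"
    and reflection_root:
      "\<lbrakk>\<alpha> \<in> R; \<beta> \<in> R\<rbrakk> \<Longrightarrow> \<beta> - zscale (pairing \<beta> (coroot \<alpha>)) \<alpha> \<in> R"
    and reflection_coroot:
      "\<lbrakk>\<alpha> \<in> R; \<beta> \<in> R\<rbrakk> \<Longrightarrow>
        coroot \<beta> - zscale (pairing \<alpha> (coroot \<beta>)) (coroot \<alpha>) \<in> coroot ` R"
    and reduced:
      "\<lbrakk>\<alpha> \<in> R; \<beta> \<in> R; zscale m \<alpha> = zscale n \<beta>; m \<noteq> 0\<rbrakk> \<Longrightarrow> \<beta> = \<alpha> \<or> \<beta> = - \<alpha>"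
    and finite_I: "finite I"
    and inj_simple: "inj_on simple I"
    and simple_roots: "simple ` I \<subseteq> R"
    and independent_simple: "zmod.independent (simple ` I)"
    and positive_or_negative:
      "\<beta> \<in> R \<Longrightarrow> \<exists>c :: 'i \<Rightarrow> nat.
         \<beta> = (\<Sum>i\<in>I. zscale (int (c i)) (simple i)) \<or>
         \<beta> = - (\<Sum>i\<in>I. zscale (int (c i)) (simple i))"

locale complex_lie_algebra = vector_space scale
  for scale :: "complex \<Rightarrow> 'g::ab_group_add \<Rightarrow> 'g" +
  fixes bracket :: "'g \<Rightarrow> 'g \<Rightarrow> 'g"
  assumes linear_bracket_left: "Vector_Spaces.linear scale scale (\<lambda>x. bracket x y)"
    and linear_bracket_right: "Vector_Spaces.linear scale scale (bracket x)"
    and bracket_self: "bracket x x = 0"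
    and jacobi: "bracket x (bracket y z) + bracket y (bracket z x) + bracket z (bracket x y) = 0"

locale lie_module = complex_lie_algebra scale bracket
  for scale :: "complex \<Rightarrow> 'g::ab_group_add \<Rightarrow> 'g"
    and bracket :: "'g \<Rightarrow> 'g \<Rightarrow> 'g" +
  fixes scaleV :: "complex \<Rightarrow> 'v::ab_group_add \<Rightarrow> 'v"
    and act :: "'g \<Rightarrow> 'v \<Rightarrow> 'v"
  assumes vector_space_V: "vector_space scaleV"
    and linear_act_left: "Vector_Spaces.linear scale scaleV (\<lambda>x. act x v)"
    and linear_act_right: "Vector_Spaces.linear scaleV scaleV (act x)"
    and act_bracket: "act (bracket x y) v = act x (act y v) - act y (act x v)"

(* Below, h \<chi> is the element of the Cartan subalgebra t = X \<otimes> C attached to a character \<chi>;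
   since these elements span t, the weight \<mu> is tested on them only. *)
definition weight_space ::
  "('x \<Rightarrow> 'y \<Rightarrow> int) \<Rightarrow> ('x \<Rightarrow> 'g) \<Rightarrow> (complex \<Rightarrow> 'v \<Rightarrow> 'v) \<Rightarrow> ('g \<Rightarrow> 'v \<Rightarrow> 'v) \<Rightarrow> 'y \<Rightarrow> 'v set" where
  "weight_space pairing h scaleV act \<mu> =
     {v. \<forall>\<chi>. act (h \<chi>) v = scaleV (of_int (pairing \<chi> \<mu>)) v}"

definition direct_sum_decomposition :: "('y \<Rightarrow> 'v::ab_group_add set) \<Rightarrow> bool" where
  "direct_sum_decomposition W \<longleftrightarrow>
     (\<forall>v. \<exists>!w. (\<forall>\<mu>. w \<mu> \<in> W \<mu>) \<and> finite {\<mu>. w \<mu> \<noteq> 0} \<and> v = (\<Sum>\<mu> | w \<mu> \<noteq> 0. w \<mu>))"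

(* The Lie algebra of the complex reductive group G^vee with root datum (Y, R^vee, X, R).
   Its Cartan subalgebra is Lie(T^vee) = X \<otimes> C, so its weights lie in Y = X_*(T); its roots are
   the coroots of G, and the coroot of the root coroot \<alpha> is \<alpha>.  These conditions determine the
   Lie algebra, with its map h, up to isomorphism.
   The generator e_i is e (Inl i), and e_{-i} is e (Inr i). *)
locale langlands_dual_lie_algebra =
  based_root_datum pairing R coroot I simple + complex_lie_algebra scale bracket
  for pairing :: "'x::ab_group_add \<Rightarrow> 'y::ab_group_add \<Rightarrow> int"
    and R :: "'x set"
    and coroot :: "'x \<Rightarrow> 'y"
    and I :: "'i set"
    and simple :: "'i \<Rightarrow> 'x"
    and scale :: "complex \<Rightarrow> 'g::ab_group_add \<Rightarrow> 'g"
    and bracket :: "'g \<Rightarrow> 'g \<Rightarrow> 'g" +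
  fixes h :: "'x \<Rightarrow> 'g"
    and e :: "'i + 'i \<Rightarrow> 'g"
  assumes additive_h: "additive h"
      (* the complex-linear extension of h to X \<otimes> C is injective *)
    and h_independent: "zmod.independent S \<Longrightarrow> inj_on h S \<and> independent (h ` S)"
    and root_decomposition: "direct_sum_decomposition (weight_space pairing h scale bracket)"
    and cartan: "weight_space pairing h scale bracket 0 = span (range h)"
    and root_spaces:
      "\<alpha> \<in> R \<Longrightarrow> \<exists>x. x \<noteq> 0 \<and> weight_space pairing h scale bracket (coroot \<alpha>) = span {x}"
    and non_roots:
      "\<lbrakk>\<mu> \<noteq> 0; \<mu> \<notin> coroot ` R\<rbrakk> \<Longrightarrow> weight_space pairing h scale bracket \<mu> = {0}"
    and dual_coroots:
      "\<alpha> \<in> R \<Longrightarrow>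
        span {bracket x y | x y. x \<in> weight_space pairing h scale bracket (coroot \<alpha>) \<and>
                                 y \<in> weight_space pairing h scale bracket (- coroot \<alpha>)}
        = span {h \<alpha>}"
    and chevalley_pos:
      "i \<in> I \<Longrightarrow> e (Inl i) \<in> weight_space pairing h scale bracket (coroot (simple i))"
    and chevalley_neg:
      "i \<in> I \<Longrightarrow> e (Inr i) \<in> weight_space pairing h scale bracket (- coroot (simple i))"
    and chevalley_bracket: "i \<in> I \<Longrightarrow> bracket (e (Inl i)) (e (Inr i)) = h (simple i)"

(* U(g)(v): the enveloping algebra is spanned by the products x_1 ... x_n of elements of g. *)
definition enveloping_orbit ::
  "(complex \<Rightarrow> 'v::ab_group_add \<Rightarrow> 'v) \<Rightarrow> ('g \<Rightarrow> 'v \<Rightarrow> 'v) \<Rightarrow> 'v \<Rightarrow> 'v set" where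
  "enveloping_orbit scaleV act v = module.span scaleV (range (\<lambda>xs. foldr act xs v))"

definition locally_finite ::
  "('x \<Rightarrow> 'y \<Rightarrow> int) \<Rightarrow> ('x \<Rightarrow> 'g) \<Rightarrow> (complex \<Rightarrow> 'v::ab_group_add \<Rightarrow> 'v) \<Rightarrow> ('g \<Rightarrow> 'v \<Rightarrow> 'v) \<Rightarrow> bool" where
  "locally_finite pairing h scaleV act \<longleftrightarrow>
     direct_sum_decomposition (weight_space pairing h scaleV act) \<and>
     (\<forall>v. \<exists>S. finite S \<and> module.span scaleV S = enveloping_orbit scaleV act v)"

definition ell :: "('v \<Rightarrow> 'v) \<Rightarrow> 'v::zero \<Rightarrow> nat" where
  "ell E v = (GREATEST l. (E ^^ l) v \<noteq> 0)"

definition ker_pow :: "('v \<Rightarrow> 'v) \<Rightarrow> nat \<Rightarrow> 'v::zero set" where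
  "ker_pow E l = {v. (E ^^ l) v = 0}"

definition partial_bijection :: "'v set \<Rightarrow> ('v \<Rightarrow> 'v option) \<Rightarrow> bool" where
  "partial_bijection B f \<longleftrightarrow> dom f \<subseteq> B \<and> ran f \<subseteq> B \<and> inj_on f (dom f)"

definition perfect_operator ::
  "(complex \<Rightarrow> 'v::ab_group_add \<Rightarrow> 'v) \<Rightarrow> ('v \<Rightarrow> 'v) \<Rightarrow> 'v set \<Rightarrow> ('v \<Rightarrow> 'v option) \<Rightarrow> bool" where
  "perfect_operator scaleV E B f \<longleftrightarrow>
     partial_bijection B f \<and>
     (\<forall>b\<in>B. f b \<noteq> None \<longleftrightarrow> E b \<noteq> 0) \<and>
     (\<forall>b b'. f b = Some b' \<longrightarrow>
        (\<exists>c w. c \<noteq> 0 \<and> w \<in> ker_pow E (ell E b - 1) \<and> E b = scaleV c b' + w))"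

definition perfect_basis ::
  "('x \<Rightarrow> 'y \<Rightarrow> int) \<Rightarrow> 'i set \<Rightarrow> ('x \<Rightarrow> 'g) \<Rightarrow> ('i + 'i \<Rightarrow> 'g) \<Rightarrow>
   (complex \<Rightarrow> 'v::ab_group_add \<Rightarrow> 'v) \<Rightarrow> ('g \<Rightarrow> 'v \<Rightarrow> 'v) \<Rightarrow> 'v set \<Rightarrow> bool" where
  "perfect_basis pairing I h e scaleV act B \<longleftrightarrow>
     \<not> module.dependent scaleV B \<and> module.span scaleV B = UNIV \<and>
     (\<forall>b\<in>B. \<exists>\<mu>. b \<in> weight_space pairing h scaleV act \<mu>) \<and>
     (\<forall>i \<in> I <+> I. \<exists>f. perfect_operator scaleV (act (e i)) B f)"

(* The string functions eps and phi are integer valued; no value minus infinity is needed here. *)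
record ('b, 'i, 'y) kashiwara_crystal =
  elems :: "'b set"
  wt :: "'b \<Rightarrow> 'y"
  eps :: "'i \<Rightarrow> 'b \<Rightarrow> int"
  phi :: "'i \<Rightarrow> 'b \<Rightarrow> int"
  etilde :: "'i \<Rightarrow> 'b \<Rightarrow> 'b option"

(* For a perfect basis B of a locally finite module, the partial bijection in the definition of
   perfectness is unique: with l = ell E b, the element f^l b is the member of B proportional to
   E^l b, and f^(l - 1) maps f b to it injectively. *)
definition crystal_of ::
  "('x \<Rightarrow> 'y \<Rightarrow> int) \<Rightarrow> ('x \<Rightarrow> 'g) \<Rightarrow> ('i + 'i \<Rightarrow> 'g) \<Rightarrow>
   (complex \<Rightarrow> 'v::ab_group_add \<Rightarrow> 'v) \<Rightarrow> ('g \<Rightarrow> 'v \<Rightarrow> 'v) \<Rightarrow> 'v set \<Rightarrow> ('v, 'i, 'y) kashiwara_crystal" where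
  "crystal_of pairing h e scaleV act B =
     \<lparr>elems = B,
      wt = (\<lambda>b. THE \<mu>. b \<in> weight_space pairing h scaleV act \<mu>),
      eps = (\<lambda>i b. int (ell (act (e (Inl i))) b)),
      phi = (\<lambda>i b. int (ell (act (e (Inr i))) b)),
      etilde = (\<lambda>i. THE f. perfect_operator scaleV (act (e (Inl i))) B f)\<rparr>"

definition crystal_isomorphism ::
  "'i set \<Rightarrow> ('b, 'i, 'y) kashiwara_crystal \<Rightarrow> ('c, 'i, 'y) kashiwara_crystal \<Rightarrow> ('b \<Rightarrow> 'c) \<Rightarrow> bool" where
  "crystal_isomorphism I C D \<Phi> \<longleftrightarrow>
     bij_betw \<Phi> (elems C) (elems D) \<and>
     (\<forall>b \<in> elems C. wt D (\<Phi> b) = wt C b \<and>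
        (\<forall>i\<in>I. eps D i (\<Phi> b) = eps C i b \<and> phi D i (\<Phi> b) = phi C i b \<and>
               etilde D i (\<Phi> b) = map_option \<Phi> (etilde C i b)))"

definition crystal_isomorphic ::
  "'i set \<Rightarrow> ('b, 'i, 'y) kashiwara_crystal \<Rightarrow> ('c, 'i, 'y) kashiwara_crystal \<Rightarrow> bool" where
  "crystal_isomorphic I C D \<longleftrightarrow> (\<exists>\<Phi>. crystal_isomorphism I C D \<Phi>)"

end

theory Submission
  imports Defs
begin

text \<open>Let \<open>V\<^sup>+\<close> be the space of vectors killed by all \<open>e\<^sub>i\<close>, \<open>i \<in> I\<close>.  A perfect basis contains a basis of \<open>V\<^sup>+\<close>
  consisting of weight vectors.  By complete reducibility every weight preserving
  automorphism of \<open>V\<^sup>+\<close> extends to an automorphism of \<open>V\<close>; applying such an automorphism to \<open>B\<close>,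
  one may assume that \<open>B\<close> and \<open>B'\<close> meet \<open>V\<^sup>+\<close> in the same set.  Then \<open>b \<in> B\<close> and \<open>b' \<in> B'\<close> are
  matched if each occurs in the expansion of the other.  Matched vectors have the same \<open>\<ell>\<^sub>i\<close>,
  since \<open>\<ell>\<^sub>i(v)\<close> is the maximum of \<open>\<ell>\<^sub>i\<close> over the support of \<open>v\<close>, and the map \<open>b \<mapsto> e\<^sub>i\<^sup>\<ell> b\<close> with
  \<open>\<ell> = \<ell>\<^sub>i(b)\<close> both preserves matched pairs and reflects them when \<open>\<ell>\<^sub>i\<close> agrees.  Induction up to \<open>V\<^sup>+\<close>
  shows that the matching is a bijection commuting with the partial bijections.

  Complete reducibility is obtained from the operator \<open>\<Gamma> = \<Sum>\<gamma>>0. y\<^sub>\<gamma> x\<^sub>\<gamma>\<close> of root vectors dual under the Killing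
  form, the nilpotent part of the Casimir element: \<open>\<Gamma>\<close> vanishes on \<open>V\<^sup>+\<close>, and a lowering word takes
  \<open>V\<^sup>+\<close> to eigenvectors of \<open>\<Gamma>\<close> whose eigenvalue is positive whenever source and target weights are dominant.\<close>

text \<open>Weight spaces may be infinite-dimensional and the weights of \<open>V\<close> need not
  be bounded, so neither characters nor dimension counts can compare the two bases; the comparison
  has to go through expansions of individual vectors. The common intersection with V^+ is what
  starts it: two perfect bases can meet V^+ in unrelated bases of its weight spaces, and then
  nothing singles out a partner of a given vector. The Killing form of a reductive algebra vanishes
  on the centre, so no full Casimir element is formed from it. Opposite root spaces are nevertheless
  in duality, and this is all that \<Gamma> requires. \<Gamma> is not central, but its commutators
  with the Chevalley generators are explicit. Summed along a word from \<zeta> down to \<mu>, the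
  corrections give the usual difference (|\<zeta>+\<rho>|^2 - |\<mu>+\<rho>|^2)/2, written without
  \<rho> through the letters of the word; in that form positivity at dominant weights is visible.
  Quotient modules are avoided throughout: what would be said in V/W is said modulo a stable
  subspace \<open>W\<close>.\<close>

section \<open>Linear algebra and root data\<close>

text \<open>The sl2 computation modulo \<open>W\<close>. For \<open>x\<close> primitive of weight m
  modulo \<open>W\<close>, E F^(k+1) x is (k+1)(m-k) F^k x modulo \<open>W\<close>; if k is the last
  index with F^k x outside \<open>W\<close>, this coefficient must vanish, so m = k. The commutation
  relation is required only along the string through \<open>x\<close>.\<close>

lemma sl2_weight_nonneg:
  fixes scl :: "complex \<Rightarrow> 'v::ab_group_add \<Rightarrow> 'v" and m :: int
  assumes "vector_space scl" and W: "module.subspace scl W"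
    and E_W: "\<And>w. w \<in> W \<Longrightarrow> E w \<in> W" and F_W: "\<And>w. w \<in> W \<Longrightarrow> F w \<in> W"
    and F: "Vector_Spaces.linear scl scl F"
    and comm: "\<And>k. E (F ((F ^^ k) x)) = F (E ((F ^^ k) x)) + scl (of_int (m - 2 * int k)) ((F ^^ k) x)"
    and x: "x \<notin> W" "E x \<in> W" and n: "(F ^^ n) x \<in> W"
  shows "m \<ge> 0"
proof -
  interpret vector_space scl by fact
  interpret F: Vector_Spaces.linear scl scl F by fact
  have step: "E ((F ^^ Suc k) x) - scl (of_int ((int k + 1) * (m - int k))) ((F ^^ k) x) \<in> W" for k
  proof (induction k)
    case 0
    then show ?case using comm[of 0] F_W[OF x(2)] by simp
  next
    case (Suc k)
    define w where "w = E ((F ^^ Suc k) x) - scl (of_int ((int k + 1) * (m - int k))) ((F ^^ k) x)"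
    have "E ((F ^^ Suc k) x) = scl (of_int ((int k + 1) * (m - int k))) ((F ^^ k) x) + w"
      by (simp add: w_def)
    then have "E ((F ^^ Suc (Suc k)) x)
      = scl (of_int ((int k + 1) * (m - int k))) ((F ^^ Suc k) x) + F w
        + scl (of_int (m - 2 * int (Suc k))) ((F ^^ Suc k) x)"
      using comm[of "Suc k"] by (simp add: F.add F.scale del: of_int_mult)
    also have "\<dots> = scl (of_int ((int k + 1) * (m - int k) + (m - 2 * int (Suc k)))) ((F ^^ Suc k) x) + F w"
      by (simp only: of_int_add scale_left_distrib) (simp only: ac_simps)
    also have "(int k + 1) * (m - int k) + (m - 2 * int (Suc k)) = (int (Suc k) + 1) * (m - int (Suc k))"
      by (simp add: algebra_simps)
    finally show ?case using F_W[OF Suc.IH] by (simp add: w_def)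
  qed
  define n0 where "n0 = (LEAST n. (F ^^ n) x \<in> W)"
  have n0: "(F ^^ n0) x \<in> W" unfolding n0_def by (rule LeastI[of _ n]) (rule n)
  then obtain k where k: "n0 = Suc k" using x(1) by (cases n0) auto
  then have nk: "(F ^^ k) x \<notin> W" using not_less_Least[of k "\<lambda>n. (F ^^ n) x \<in> W"] n0_def by auto
  have "E ((F ^^ Suc k) x) \<in> W" using n0 k E_W by blast
  then have "scl (of_int ((int k + 1) * (m - int k))) ((F ^^ k) x) \<in> W"
    using subspace_diff[OF W _ step[of k], of "E ((F ^^ Suc k) x)"] by simp
  then have "of_int ((int k + 1) * (m - int k)) = (0::complex)"
    using nk subspace_scale[OF W, of _ "inverse (of_int ((int k + 1) * (m - int k)))"]
    by (metis left_inverse scale_one scale_scale)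
  then have "(int k + 1) * (m - int k) = 0" by (simp only: of_int_eq_0_iff)
  then show ?thesis by simp
qed

text \<open>Applying \<open>T - \<theta> k\<close> to the sum removes the \<open>k\<close>-th eigenvector.\<close>
lemma sum_eigenvectors_in_kernel:
  assumes T: "Vector_Spaces.linear scl scl T" and "finite K"
    and "\<And>k. k \<in> K \<Longrightarrow> T (y k) = scl (\<theta> k) (y k)" "\<And>k. k \<in> K \<Longrightarrow> \<theta> k \<noteq> 0"
    and "T (\<Sum>k\<in>K. y k) = 0"
  shows "(\<Sum>k\<in>K. y k) = 0"
  using assms(2-)
proof (induction K arbitrary: y rule: finite_induct)
  case empty
  then show ?case by simp
next
  interpret T: Vector_Spaces.linear scl scl T by fact
  case (insert k K)
  define z where "z j = scl (\<theta> j - \<theta> k) (y j)" for j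
  have "(\<Sum>j\<in>K. z j) = (\<Sum>j\<in>insert k K. scl (\<theta> j - \<theta> k) (y j))"
    using insert.hyps by (simp add: z_def)
  also have "\<dots> = T (\<Sum>j\<in>insert k K. y j) - scl (\<theta> k) (\<Sum>j\<in>insert k K. y j)"
    unfolding T.sum using insert.prems(1)
    by (simp add: T.vs1.scale_sum_right T.vs1.scale_left_diff_distrib sum_subtractf del: sum.insert)
  finally have z: "(\<Sum>j\<in>K. z j) = - scl (\<theta> k) (\<Sum>j\<in>insert k K. y j)"
    using insert.prems by simp
  have "(\<Sum>j\<in>K. z j) = 0"
  proof (rule insert.IH)
    show "T (z j) = scl (\<theta> j) (z j)" if "j \<in> K" for j
      using insert.prems(1)[of j] that by (simp add: z_def T.scale mult.commute)
    show "T (\<Sum>j\<in>K. z j) = 0"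
      unfolding z using insert.prems(3) by (simp only: T.neg T.scale) simp
  qed (use insert.prems in auto)
  with z insert.prems(2)[of k] show ?case by simp
qed

text \<open>An assignment on a spanning family that respects all finite linear relations is induced
  by a linear map. The map is built on a basis extracted from the family; for any other member, the
  relation expressing it through that basis gives the value.\<close>

lemma linear_extension_of_spanning_family:
  fixes scl :: "'k::field \<Rightarrow> 'v::ab_group_add \<Rightarrow> 'v"
  assumes "vector_space scl" and span: "module.span scl (p ` K) = UNIV"
    and rel: "\<And>T a. finite T \<Longrightarrow> T \<subseteq> K \<Longrightarrow> (\<Sum>k\<in>T. scl (a k) (p k)) = 0 \<Longrightarrow> (\<Sum>k\<in>T. scl (a k) (q k)) = 0"
  obtains A where "Vector_Spaces.linear scl scl A" "\<And>k. k \<in> K \<Longrightarrow> A (p k) = q k"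
proof -
  interpret vector_space scl by fact
  interpret vector_space_pair scl scl by unfold_locales
  obtain C where C: "C \<subseteq> p ` K" "independent C" "p ` K \<subseteq> span C"
    using maximal_independent_subset[of "p ` K"] by auto
  have spanC: "span C = UNIV"
    using span_mono[OF C(3)] span assms by (auto simp: span_span)
  define g where "g c = (SOME k. k \<in> K \<and> p k = c)" for c
  have g: "g c \<in> K" "p (g c) = c" if "c \<in> C" for c
    using someI_ex[of "\<lambda>k. k \<in> K \<and> p k = c"] that C(1) unfolding g_def by auto
  define A where "A = construct C (q \<circ> g)"
  have A: "Vector_Spaces.linear scl scl A" unfolding A_def by (rule linear_construct[OF C(2)])
  then interpret A: Vector_Spaces.linear scl scl A .
  have "A (p k) = q k" if k: "k \<in> K" for k
  proof -
    define D where "D = {c. representation C (p k) c \<noteq> 0}"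
    have D: "finite D" "D \<subseteq> C"
      using finite_representation representation_ne_zero unfolding D_def by auto
    have pk: "p k = (\<Sum>c\<in>D. scl (representation C (p k) c) c)"
      unfolding D_def using sum_nonzero_representation_eq[OF C(2), of "p k"] spanC by simp
    have Apk: "A (p k) = (\<Sum>c\<in>D. scl (representation C (p k) c) (q (g c)))"
    proof -
      have "A (p k) = (\<Sum>c\<in>D. scl (representation C (p k) c) (A c))"
        by (subst pk) (simp add: A.sum A.scale)
      also have "\<dots> = (\<Sum>c\<in>D. scl (representation C (p k) c) (q (g c)))"
        using D by (intro sum.cong) (auto simp: A_def construct_basis[OF C(2)])
      finally show ?thesis .
    qed
    have inj: "inj_on g D" by (rule inj_onI) (metis g(2) D(2) subsetD)
    \<comment> \<open>The relation that expresses \<open>p k\<close> through the chosen preimages.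
      The index \<open>k\<close> may itself be one of them, so its coefficient is the sum of both
      contributions.\<close>
    define T where "T = insert k (g ` D)"
    define a where "a j = (if j \<in> g ` D then representation C (p k) (p j) else 0) - (if j = k then 1 else 0)" for j
    have T: "finite T" "T \<subseteq> K" using D k g(1) by (auto simp: T_def)
    have expand: "(\<Sum>j\<in>T. scl (a j) (r j)) = (\<Sum>c\<in>D. scl (representation C (p k) c) (r (g c))) - r k" for r
    proof -
      have "(\<Sum>j\<in>T. scl (a j) (r j)) =
          (\<Sum>j\<in>T. if j \<in> g ` D then scl (representation C (p k) (p j)) (r j) else 0) - (\<Sum>j\<in>T. if j = k then r j else 0)"
        unfolding sum_subtractf[symmetric] a_def
        by (intro sum.cong) (auto simp: scale_left_diff_distrib)
      also have "(\<Sum>j\<in>T. if j = k then r j else 0) = r k" using T(1) by (simp add: T_def)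
      also have "(\<Sum>j\<in>T. if j \<in> g ` D then scl (representation C (p k) (p j)) (r j) else 0)
          = (\<Sum>j\<in>g ` D. scl (representation C (p k) (p j)) (r j))"
        using T(1) by (intro sum.mono_neutral_cong_right) (auto simp: T_def)
      also have "\<dots> = (\<Sum>c\<in>D. scl (representation C (p k) c) (r (g c)))"
        unfolding sum.reindex[OF inj] using D(2) g(2) by (intro sum.cong) auto
      finally show ?thesis .
    qed
    have "(\<Sum>j\<in>T. scl (a j) (p j)) = 0"
    proof -
      have "(\<Sum>c\<in>D. scl (representation C (p k) c) (p (g c))) = p k"
        using D(2) g(2) by (intro trans[OF _ pk[symmetric]] sum.cong) auto
      then show ?thesis by (simp add: expand)
    qed
    then have "(\<Sum>j\<in>T. scl (a j) (q j)) = 0" by (rule rel[OF T])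
    then show ?thesis by (simp add: expand Apk)
  qed
  with A that show thesis by blast
qed

section \<open>Positive roots and integral coordinates of coroots\<close>

context based_root_datum
begin

lemma pairing_zero_left [simp]: "pairing 0 y = 0"
  using pairing_add_left[of 0 0 y] by simp

lemma pairing_zero_right [simp]: "pairing x 0 = 0"
  using pairing_add_right[of x 0 0] by simp

lemma pairing_minus_left [simp]: "pairing (- x) y = - pairing x y"
  using pairing_add_left[of x "- x" y] by simp

lemma pairing_minus_right [simp]: "pairing x (- y) = - pairing x y"
  using pairing_add_right[of x y "- y"] by simp

lemma pairing_diff_left: "pairing (x - x') y = pairing x y - pairing x' y"
  using pairing_add_left[of x "- x'" y] by simp

lemma pairing_diff_right: "pairing x (y - y') = pairing x y - pairing x y'"
  using pairing_add_right[of x y "- y'"] by simp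

lemma pairing_sum_left: "pairing (\<Sum>a\<in>A. f a) y = (\<Sum>a\<in>A. pairing (f a) y)"
  by (induction A rule: infinite_finite_induct) (auto simp: pairing_add_left)

lemma pairing_sum_right: "pairing x (\<Sum>a\<in>A. f a) = (\<Sum>a\<in>A. pairing x (f a))"
  by (induction A rule: infinite_finite_induct) (auto simp: pairing_add_right)

lemma pairing_zscale_left: "pairing (zscale n x) y = n * pairing x y"
  by (simp add: zscale_def pairing_diff_left pairing_sum_left)

lemma pairing_zscale_right: "pairing x (zscale n y) = n * pairing x y"
  by (simp add: zscale_def pairing_diff_right pairing_sum_right)

lemma pairing_eqI: "(\<And>x. pairing x y = pairing x y') \<Longrightarrow> y = y'"
proof -
  assume eq: "\<And>x. pairing x y = pairing x y'"
  have "additive (\<lambda>x. pairing x y)" by unfold_locales (rule pairing_add_left)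
  then show "y = y'" using pairing_perfect_left[of "\<lambda>x. pairing x y"] eq by metis
qed

lemma coroot_nonzero: "\<gamma> \<in> R \<Longrightarrow> coroot \<gamma> \<noteq> 0"
  using pairing_coroot by force

lemma uminus_root: "\<gamma> \<in> R \<Longrightarrow> - \<gamma> \<in> R"
  using reflection_root[of \<gamma> \<gamma>] pairing_coroot[of \<gamma>] by (simp add: zscale_def numeral_2_eq_2)

text \<open>The character that represents pairing with \<open>y\<close> in the Weyl-invariant
  symmetric form given by the sum of \<langle>\<delta>,y\<rangle>\<langle>\<delta>,y'\<rangle> over
  all roots; \<open>coroot_norm\<close> is the squared length of a coroot in it.\<close>

definition coroot_form :: "'y \<Rightarrow> 'x" where
  "coroot_form y = (\<Sum>\<delta>\<in>R. zscale (pairing \<delta> y) \<delta>)"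

definition coroot_norm :: "'x \<Rightarrow> int" where
  "coroot_norm \<gamma> = (\<Sum>\<delta>\<in>R. (pairing \<delta> (coroot \<gamma>))\<^sup>2)"

lemma coroot_norm_pos: "\<gamma> \<in> R \<Longrightarrow> coroot_norm \<gamma> > 0"
  unfolding coroot_norm_def using pairing_coroot[of \<gamma>]
  by (intro sum_pos2[OF finite_roots, of \<gamma>]) auto

text \<open>The form \<open>\<Sum>\<delta>. \<langle>\<delta>, y\<rangle> \<langle>\<delta>, y'\<rangle>\<close> is invariant under the reflections, so it identifies each
  coroot with a positive multiple of its root.\<close>
lemma coroot_form_coroot:
  assumes \<gamma>: "\<gamma> \<in> R"
  shows "zscale 2 (coroot_form (coroot \<gamma>)) = zscale (coroot_norm \<gamma>) \<gamma>"
proof -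
  define s where "s \<delta> = \<delta> - zscale (pairing \<delta> (coroot \<gamma>)) \<gamma>" for \<delta>
  have ps: "pairing (s \<delta>) (coroot \<gamma>) = - pairing \<delta> (coroot \<gamma>)" for \<delta>
    using pairing_coroot[OF \<gamma>] by (simp add: s_def pairing_diff_left pairing_zscale_left)
  have ss: "s (s \<delta>) = \<delta>" for \<delta>
    by (subst s_def, subst ps) (simp add: s_def zscale_minus_left)
  have bij: "bij_betw s R R"
    using reflection_root[OF \<gamma>] ss by (intro bij_betw_byWitness[where f' = s]) (auto simp: s_def)
  \<comment> \<open>Reindexing by the reflection turns the sum into \<open>coroot_norm\<close> times
    the root minus the sum itself, whence the factor 2.\<close>
  have "coroot_form (coroot \<gamma>) = (\<Sum>\<delta>\<in>R. zscale (pairing (s \<delta>) (coroot \<gamma>)) (s \<delta>))"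
    unfolding coroot_form_def by (rule sum.reindex_bij_betw[OF bij, symmetric])
  also have "\<dots> = (\<Sum>\<delta>\<in>R. zscale ((pairing \<delta> (coroot \<gamma>))\<^sup>2) \<gamma> - zscale (pairing \<delta> (coroot \<gamma>)) \<delta>)"
    by (intro sum.cong)
      (auto simp: ps, simp add: s_def zmod.scale_right_diff_distrib zscale_minus_left power2_eq_square zscale_mult)
  also have "\<dots> = zscale (coroot_norm \<gamma>) \<gamma> - coroot_form (coroot \<gamma>)"
    by (simp add: sum_subtractf coroot_form_def coroot_norm_def zmod.scale_sum_left)
  finally show ?thesis
    using zscale_add_left[of 1 1 "coroot_form (coroot \<gamma>)"] by (metis diff_add_cancel one_add_one zmod.scale_one)
qed

lemma coroot_form_add: "coroot_form (y + y') = coroot_form y + coroot_form y'"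
  by (simp add: coroot_form_def pairing_add_right zscale_add_left sum.distrib)

lemma root_in_span: "\<gamma> \<in> R \<Longrightarrow> \<gamma> \<in> zmod.span (simple ` I)"
  using positive_or_negative[of \<gamma>]
  by (auto intro!: zmod.span_neg zmod.span_sum zmod.span_scale intro: zmod.span_base)

lemma coroot_form_in_span: "coroot_form y \<in> zmod.span (simple ` I)"
  unfolding coroot_form_def by (intro zmod.span_sum zmod.span_scale root_in_span)

definition root_coord :: "'i \<Rightarrow> 'x \<Rightarrow> int" where
  "root_coord i x = zmod.representation (simple ` I) x (simple i)"

text \<open>The passage from a root to its coroot is not additive, so sums of coroots cannot be
  compared through root coordinates directly. This functional is additive on all cocharacters and
  takes a coroot to a positive multiple of the coordinate of its root; the factor 2 keeps it
  integral.\<close>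

definition coroot_coord :: "'i \<Rightarrow> 'y \<Rightarrow> int" where
  "coroot_coord i y = root_coord i (zscale 2 (coroot_form y))"

lemma root_coord_scale: "x \<in> zmod.span (simple ` I) \<Longrightarrow> root_coord i (zscale n x) = n * root_coord i x"
  unfolding root_coord_def using zmod.representation_scale[OF independent_simple] by simp

lemma root_coord_minus: "x \<in> zmod.span (simple ` I) \<Longrightarrow> root_coord i (- x) = - root_coord i x"
  unfolding root_coord_def using zmod.representation_neg[OF independent_simple] by simp

lemma root_coord_simple: "i \<in> I \<Longrightarrow> j \<in> I \<Longrightarrow> root_coord i (simple j) = (if i = j then 1 else 0)"
  unfolding root_coord_def
  using zmod.representation_basis[OF independent_simple, of "simple j"] inj_simple
  by (auto simp: inj_on_def)

lemma root_coord_sum: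
  assumes "i \<in> I"
  shows "root_coord i (\<Sum>j\<in>I. zscale (c j) (simple j)) = c i"
proof -
  have "root_coord i (\<Sum>j\<in>I. zscale (c j) (simple j)) = (\<Sum>j\<in>I. root_coord i (zscale (c j) (simple j)))"
    unfolding root_coord_def
    by (subst zmod.representation_sum[OF independent_simple])
      (auto intro!: zmod.span_scale intro: zmod.span_base)
  also have "\<dots> = (\<Sum>j\<in>I. if j = i then c j else 0)"
    using assms by (intro sum.cong) (auto simp: root_coord_scale zmod.span_base root_coord_simple)
  finally show ?thesis using assms finite_I by simp
qed

lemma root_expansion:
  assumes "\<gamma> \<in> R"
  shows "\<gamma> = (\<Sum>i\<in>I. zscale (root_coord i \<gamma>) (simple i))"
proof -
  obtain d :: "'i \<Rightarrow> nat" where "\<gamma> = (\<Sum>i\<in>I. zscale (int (d i)) (simple i)) \<or>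
      \<gamma> = (\<Sum>i\<in>I. zscale (- int (d i)) (simple i))"
    using positive_or_negative[OF assms] by (auto simp: sum_negf zscale_minus_left)
  then obtain c where c: "\<gamma> = (\<Sum>i\<in>I. zscale (c i) (simple i))"
    using that[of "\<lambda>i. int (d i)"] that[of "\<lambda>i. - int (d i)"] by blast
  have "root_coord i \<gamma> = c i" if "i \<in> I" for i unfolding c using that by (rule root_coord_sum)
  then have "(\<Sum>i\<in>I. zscale (root_coord i \<gamma>) (simple i)) = (\<Sum>i\<in>I. zscale (c i) (simple i))"
    by (intro sum.cong) auto
  then show ?thesis using c by simp
qed

definition Rpos :: "'x set" where "Rpos = {\<gamma> \<in> R. \<forall>i\<in>I. root_coord i \<gamma> \<ge> 0}"

lemma Rpos_subset: "Rpos \<subseteq> R" and Rpos_root: "\<gamma> \<in> Rpos \<Longrightarrow> \<gamma> \<in> R"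
  by (auto simp: Rpos_def)

lemma finite_Rpos: "finite Rpos"
  using finite_roots Rpos_subset by (rule finite_subset[rotated])

lemma Rpos_or_neg: "\<gamma> \<in> R \<Longrightarrow> \<gamma> \<in> Rpos \<or> - \<gamma> \<in> Rpos"
  using positive_or_negative[of \<gamma>] uminus_root[of \<gamma>] unfolding Rpos_def
  by (auto simp: root_coord_sum)

lemma simple_Rpos: "i \<in> I \<Longrightarrow> simple i \<in> Rpos"
  using simple_roots by (auto simp: Rpos_def root_coord_simple)

lemma simple_root: "i \<in> I \<Longrightarrow> simple i \<in> R"
  using simple_roots by auto

lemma pairing_simple: "i \<in> I \<Longrightarrow> pairing (simple i) (coroot (simple i)) = 2"
  using pairing_coroot simple_root by auto

lemma coroot_coord_add: "coroot_coord i (y + y') = coroot_coord i y + coroot_coord i y'"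
  unfolding coroot_coord_def root_coord_def
  by (simp add: coroot_form_add zscale_add_right
      zmod.representation_add[OF independent_simple] zmod.span_scale coroot_form_in_span)

lemma coroot_coord_zero [simp]: "coroot_coord i 0 = 0"
  using coroot_coord_add[of i 0 0] by simp

lemma coroot_coord_minus [simp]: "coroot_coord i (- y) = - coroot_coord i y"
  using coroot_coord_add[of i y "- y"] by simp

lemma coroot_coord_diff: "coroot_coord i (y - y') = coroot_coord i y - coroot_coord i y'"
  using coroot_coord_add[of i y "- y'"] by simp

lemma coroot_coord_coroot: "\<gamma> \<in> R \<Longrightarrow> coroot_coord i (coroot \<gamma>) = coroot_norm \<gamma> * root_coord i \<gamma>"
  by (simp add: coroot_coord_def coroot_form_coroot root_coord_scale root_in_span)

lemma coroot_coord_nonneg: "\<gamma> \<in> Rpos \<Longrightarrow> i \<in> I \<Longrightarrow> coroot_coord i (coroot \<gamma>) \<ge> 0"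
  using coroot_norm_pos[of \<gamma>] by (auto simp: Rpos_def coroot_coord_coroot)

lemma coroot_coord_simple:
  "i \<in> I \<Longrightarrow> j \<in> I \<Longrightarrow> coroot_coord i (coroot (simple j)) = (if i = j then coroot_norm (simple j) else 0)"
  by (simp add: coroot_coord_coroot simple_root root_coord_simple)

lemma root_coord_nonzero: "\<gamma> \<in> R \<Longrightarrow> \<exists>i\<in>I. root_coord i \<gamma> \<noteq> 0"
proof (rule ccontr)
  assume \<gamma>: "\<gamma> \<in> R" and "\<not> (\<exists>i\<in>I. root_coord i \<gamma> \<noteq> 0)"
  then have "\<gamma> = (\<Sum>i\<in>I. zscale 0 (simple i))"
    by (subst root_expansion[OF \<gamma>]) (intro sum.cong, auto)
  then show False using pairing_coroot[OF \<gamma>] by (simp add: zscale_def)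
qed

text \<open>A weighted height: additive, integral and positive on positive coroots. It replaces the
  ordinary height as induction measure and as a bound for lengths of words.\<close>

definition level :: "'y \<Rightarrow> int" where "level y = (\<Sum>i\<in>I. coroot_coord i y)"

lemma level_add: "level (y + y') = level y + level y'"
  and level_minus: "level (- y) = - level y"
  and level_diff: "level (y - y') = level y - level y'"
  and level_zero [simp]: "level 0 = 0"
  by (simp_all add: level_def coroot_coord_add coroot_coord_diff sum.distrib sum_negf sum_subtractf)

lemma level_pos: "\<gamma> \<in> Rpos \<Longrightarrow> level (coroot \<gamma>) > 0"
proof -
  assume \<gamma>: "\<gamma> \<in> Rpos"
  then obtain i where i: "i \<in> I" "root_coord i \<gamma> \<noteq> 0" using root_coord_nonzero Rpos_root by blast
  then have "root_coord i \<gamma> > 0" using \<gamma> by (auto simp: Rpos_def less_le)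
  then have "coroot_coord i (coroot \<gamma>) > 0"
    using coroot_norm_pos[of \<gamma>] \<gamma> by (simp add: coroot_coord_coroot Rpos_root)
  then show ?thesis unfolding level_def
    using i \<gamma> coroot_coord_nonneg by (intro sum_pos2[OF finite_I, of i]) auto
qed

text \<open>The hypothesis makes \<gamma> a multiple of one simple root; reducedness leaves only the
  two signs, and positivity decides between them.\<close>

lemma Rpos_eq_simple:
  assumes "\<gamma> \<in> Rpos" "i \<in> I" "\<And>j. j \<in> I \<Longrightarrow> j \<noteq> i \<Longrightarrow> coroot_coord j (coroot \<gamma>) = 0"
  shows "\<gamma> = simple i"
proof -
  have R: "\<gamma> \<in> R" using assms Rpos_root by auto
  have "root_coord j \<gamma> = 0" if "j \<in> I" "j \<noteq> i" for j
    using assms(3)[OF that] coroot_norm_pos[OF R] by (simp add: coroot_coord_coroot R)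
  then have "(\<Sum>j\<in>I. zscale (root_coord j \<gamma>) (simple j))
      = (\<Sum>j\<in>I. if j = i then zscale (root_coord i \<gamma>) (simple i) else 0)"
    by (intro sum.cong) auto
  also have "\<dots> = zscale (root_coord i \<gamma>) (simple i)" using assms(2) finite_I by simp
  finally have eq: "\<gamma> = zscale (root_coord i \<gamma>) (simple i)" using root_expansion[OF R] by simp
  then have "zscale 1 \<gamma> = zscale (root_coord i \<gamma>) (simple i)" by (metis zmod.scale_one)
  then have "simple i = \<gamma> \<or> simple i = - \<gamma>" by (intro reduced[of \<gamma> "simple i" 1 "root_coord i \<gamma>"])
      (use R assms simple_root in auto)
  moreover have "simple i \<noteq> - \<gamma>"
  proof
    assume "simple i = - \<gamma>"
    then have "root_coord i (simple i) = - root_coord i \<gamma>" by (simp add: root_coord_minus root_in_span R)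
    then show False using assms by (auto simp: root_coord_simple Rpos_def)
  qed
  ultimately show ?thesis by simp
qed

text \<open>The reflection axiom only says that the negative of a coroot is the coroot of some root
  \<beta>. The invariant form makes \<beta> proportional to \<gamma>, and reducedness then forces
  \<beta> = -\<gamma>.\<close>

lemma coroot_uminus:
  assumes \<gamma>: "\<gamma> \<in> R" shows "coroot (- \<gamma>) = - coroot \<gamma>"
proof -
  have "- coroot \<gamma> \<in> coroot ` R"
    using reflection_coroot[OF \<gamma> \<gamma>] pairing_coroot[OF \<gamma>] by (simp add: zscale_def numeral_2_eq_2)
  then obtain \<beta> where \<beta>: "\<beta> \<in> R" "coroot \<beta> = - coroot \<gamma>" by force
  have "zscale (coroot_norm \<beta>) \<beta> = zscale 2 (coroot_form (coroot \<beta>))"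
    using coroot_form_coroot[OF \<beta>(1)] by simp
  also have "\<dots> = - zscale 2 (coroot_form (coroot \<gamma>))"
    by (simp add: \<beta>(2) coroot_form_def zscale_minus_left sum_negf)
  also have "\<dots> = zscale (- coroot_norm \<gamma>) \<gamma>"
    using coroot_form_coroot[OF \<gamma>] by (simp add: zscale_minus_left)
  finally have "zscale (- coroot_norm \<gamma>) \<gamma> = zscale (coroot_norm \<beta>) \<beta>" by simp
  from reduced[OF \<gamma> \<beta>(1) this] have "\<beta> = \<gamma> \<or> \<beta> = - \<gamma>" using coroot_norm_pos[OF \<gamma>] by simp
  moreover have "\<beta> \<noteq> \<gamma>"
  proof
    assume "\<beta> = \<gamma>"
    then have "pairing \<gamma> (coroot \<gamma>) = - pairing \<gamma> (coroot \<gamma>)"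
      using \<beta>(2) by (metis pairing_minus_right)
    then show False using pairing_coroot[OF \<gamma>] by simp
  qed
  ultimately show ?thesis using \<beta> by simp
qed

lemma coroot_image: "coroot ` R = coroot ` Rpos \<union> uminus ` coroot ` Rpos"
proof -
  have "coroot \<gamma> \<in> coroot ` Rpos \<union> uminus ` coroot ` Rpos" if "\<gamma> \<in> R" for \<gamma>
    using Rpos_or_neg[OF that] coroot_uminus[OF that] by (auto simp: image_iff) (metis minus_minus)
  moreover have "- coroot \<gamma> \<in> coroot ` R" if "\<gamma> \<in> Rpos" for \<gamma>
    using coroot_uminus uminus_root that Rpos_root by (metis image_eqI)
  ultimately show ?thesis using Rpos_subset by auto
qed

text \<open>Coordinates of positive coroots are nonnegative, so both summands have zero coordinates
  away from \<open>i\<close> and hence both roots equal \<open>simple i\<close>. The simple coroot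
  would then equal its own double.\<close>

lemma coroot_add_not_simple:
  assumes "\<gamma> \<in> Rpos" "\<delta> \<in> Rpos" "i \<in> I"
  shows "coroot \<gamma> + coroot \<delta> \<noteq> coroot (simple i)"
proof
  assume eq: "coroot \<gamma> + coroot \<delta> = coroot (simple i)"
  have sum: "coroot_coord j (coroot \<gamma>) + coroot_coord j (coroot \<delta>) = 0" if "j \<in> I" "j \<noteq> i" for j
    using coroot_coord_add[of j "coroot \<gamma>" "coroot \<delta>"] that assms(3) by (simp add: eq coroot_coord_simple)
  have "\<gamma> = simple i" "\<delta> = simple i"
    using sum coroot_coord_nonneg assms
    by (intro Rpos_eq_simple; force simp: add_nonneg_eq_0_iff)+
  with eq coroot_nonzero[OF simple_root[OF assms(3)]] show False by simp
qed

text \<open>If the difference were a negative coroot, the simple coroot would be a sum of two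
  positive ones.\<close>

lemma coroot_diff_simple:
  assumes "\<gamma> \<in> Rpos" "i \<in> I" "coroot \<gamma> - coroot (simple i) \<in> coroot ` R"
  obtains \<delta> where "\<delta> \<in> Rpos" "coroot \<gamma> - coroot (simple i) = coroot \<delta>"
  using assms coroot_add_not_simple[of \<gamma> _ i] unfolding coroot_image
  by (auto simp: algebra_simps)

lemma coroot_add_positive:
  assumes "\<gamma> \<in> Rpos" "\<delta> \<in> Rpos" "coroot \<gamma> + coroot \<delta> \<in> coroot ` R"
  obtains \<epsilon> where "\<epsilon> \<in> Rpos" "coroot \<gamma> + coroot \<delta> = coroot \<epsilon>"
proof -
  have "coroot \<gamma> + coroot \<delta> \<noteq> - coroot \<epsilon>" if "\<epsilon> \<in> Rpos" for \<epsilon>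
  proof
    assume "coroot \<gamma> + coroot \<delta> = - coroot \<epsilon>"
    then have "level (coroot \<gamma>) + level (coroot \<delta>) = - level (coroot \<epsilon>)"
      by (metis level_add level_minus)
    then show False using level_pos[OF assms(1)] level_pos[OF assms(2)] level_pos[OF that] by linarith
  qed
  then show thesis using assms that unfolding coroot_image by auto
qed

end

section \<open>The Killing form\<close>

sublocale lie_module \<subseteq> V: vector_space scaleV
  by (rule vector_space_V)

context lie_module
begin

lemma act_add_left: "act (x + y) v = act x v + act y v"
proof -
  interpret l: Vector_Spaces.linear scale scaleV "\<lambda>x. act x v" by (rule linear_act_left)
  show ?thesis by (rule l.add)
qed

lemma act_scale_left: "act (scale c x) v = scaleV c (act x v)"
proof -
  interpret l: Vector_Spaces.linear scale scaleV "\<lambda>x. act x v" by (rule linear_act_left)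
  show ?thesis by (rule l.scale)
qed

lemma act_add_right: "act x (v + w) = act x v + act x w"
proof -
  interpret l: Vector_Spaces.linear scaleV scaleV "act x" by (rule linear_act_right)
  show ?thesis by (rule l.add)
qed

lemma act_scale_right: "act x (scaleV c v) = scaleV c (act x v)"
proof -
  interpret l: Vector_Spaces.linear scaleV scaleV "act x" by (rule linear_act_right)
  show ?thesis by (rule l.scale)
qed

lemma act_zero_left [simp]: "act 0 v = 0"
  using act_scale_left[of 0 0 v] by simp

lemma act_zero_right [simp]: "act x 0 = 0"
  using act_scale_right[of x 0 0] by simp

lemma act_minus_left: "act (- x) v = - act x v"
  using act_scale_left[of "- 1" x v] by simp

lemma act_minus_right: "act x (- v) = - act x v"
  using act_scale_right[of x "- 1" v] by simp

lemma act_diff_right: "act x (v - w) = act x v - act x w"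
  using act_add_right[of x v "- w"] by (simp add: act_minus_right)

lemma act_sum_left: "act (\<Sum>a\<in>A. f a) v = (\<Sum>a\<in>A. act (f a) v)"
  by (induction A rule: infinite_finite_induct) (auto simp: act_add_left)

lemma act_sum_right: "act x (\<Sum>a\<in>A. f a) = (\<Sum>a\<in>A. act x (f a))"
  by (induction A rule: infinite_finite_induct) (auto simp: act_add_right)

end

locale langlands_dual_module =
  langlands_dual_lie_algebra pairing R coroot I simple scale bracket h e +
  lie_module scale bracket scaleV act
  for pairing :: "'x::ab_group_add \<Rightarrow> 'y::ab_group_add \<Rightarrow> int"
    and R :: "'x set"
    and coroot :: "'x \<Rightarrow> 'y"
    and I :: "'i set"
    and simple :: "'i \<Rightarrow> 'x"
    and scale :: "complex \<Rightarrow> 'g::ab_group_add \<Rightarrow> 'g"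
    and bracket :: "'g \<Rightarrow> 'g \<Rightarrow> 'g"
    and h :: "'x \<Rightarrow> 'g"
    and e :: "'i + 'i \<Rightarrow> 'g"
    and scaleV :: "complex \<Rightarrow> 'v::ab_group_add \<Rightarrow> 'v"
    and act :: "'g \<Rightarrow> 'v \<Rightarrow> 'v"

section \<open>Signed Chevalley generators and the adjoint module\<close>

context langlands_dual_lie_algebra
begin

abbreviation gw :: "'y \<Rightarrow> 'g set" where
  "gw \<equiv> weight_space pairing h scale bracket"

text \<open>The sign \<open>\<sigma>\<close> selects the positive or the negative half of the root system.\<close>
definition chev :: "bool \<Rightarrow> 'i \<Rightarrow> 'g" where
  "chev \<sigma> i = e (if \<sigma> then Inl i else Inr i)"

definition signed :: "bool \<Rightarrow> 'a::ab_group_add \<Rightarrow> 'a" where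
  "signed \<sigma> y = (if \<sigma> then y else - y)"

lemma chev_weight: "i \<in> I \<Longrightarrow> chev \<sigma> i \<in> gw (signed \<sigma> (coroot (simple i)))"
  by (auto simp: chev_def signed_def chevalley_pos chevalley_neg)

lemma signed_not: "signed (\<not> \<sigma>) y = - signed \<sigma> y" and signed_signed [simp]: "signed \<sigma> (signed \<sigma> y) = y"
  and signed_eq_0 [simp]: "signed \<sigma> y = 0 \<longleftrightarrow> y = 0"
  and signed_add: "signed \<sigma> (y + y') = signed \<sigma> y + signed \<sigma> y'"
  and signed_diff: "signed \<sigma> (y - y') = signed \<sigma> y - signed \<sigma> y'"
  and signed_minus: "signed \<sigma> (- y) = - signed \<sigma> y"
  and signed_eq_iff: "signed \<sigma> y = signed \<sigma> y' \<longleftrightarrow> y = y'"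
  by (auto simp: signed_def)

lemma pairing_signed: "pairing x (signed \<sigma> y) = signed \<sigma> (pairing x y)"
  by (simp add: signed_def)

lemma bracket_add_left: "bracket (x + x') y = bracket x y + bracket x' y"
proof -
  interpret l: Vector_Spaces.linear scale scale "\<lambda>x. bracket x y" by (rule linear_bracket_left)
  show ?thesis by (rule l.add)
qed

lemma bracket_add_right: "bracket y (x + x') = bracket y x + bracket y x'"
proof -
  interpret l: Vector_Spaces.linear scale scale "bracket y" by (rule linear_bracket_right)
  show ?thesis by (rule l.add)
qed

lemma bracket_minus_right: "bracket y (- x) = - bracket y x"
proof -
  interpret l: Vector_Spaces.linear scale scale "bracket y" by (rule linear_bracket_right)
  show ?thesis by (rule l.neg)
qed

lemma bracket_skew: "bracket x y = - bracket y x"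
proof -
  have "bracket (x + y) (x + y) = bracket x y + bracket y x"
    by (simp only: bracket_add_left bracket_add_right) (simp add: bracket_self)
  then show ?thesis by (simp add: bracket_self eq_neg_iff_add_eq_0)
qed

lemma chev_bracket: "i \<in> I \<Longrightarrow> bracket (chev \<sigma> i) (chev (\<not> \<sigma>) i) = signed \<sigma> (h (simple i))"
  using chevalley_bracket[of i] bracket_skew[of "e (Inr i)" "e (Inl i)"] by (auto simp: chev_def signed_def)

text \<open>Makes every lemma about weights in modules available for the algebra itself, under the
  prefix \<open>ad\<close>.\<close>

lemma adjoint_module: "langlands_dual_module pairing R coroot I simple scale bracket h e scale bracket"
proof (intro langlands_dual_module.intro langlands_dual_lie_algebra_axioms lie_module.intro
    complex_lie_algebra_axioms lie_module_axioms.intro vector_space_axioms linear_bracket_left linear_bracket_right)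
  show "bracket (bracket x y) v = bracket x (bracket y v) - bracket y (bracket x v)" for x y v
    using jacobi[of x y v] bracket_skew[of "bracket x y" v] bracket_skew[of v x]
    by (simp add: bracket_minus_right algebra_simps add_eq_0_iff)
qed

end

sublocale langlands_dual_lie_algebra \<subseteq>
  ad: langlands_dual_module pairing R coroot I simple scale bracket h e scale bracket
  by (rule adjoint_module)

context langlands_dual_module
begin

abbreviation Vw :: "'y \<Rightarrow> 'v set" where
  "Vw \<equiv> weight_space pairing h scaleV act"

lemma Vw_subspace: "V.subspace (Vw \<mu>)"
  by (rule V.subspaceI)
    (auto simp: weight_space_def act_add_right act_scale_right V.scale_right_distrib mult.commute)

lemma act_h: "v \<in> Vw \<mu> \<Longrightarrow> act (h \<chi>) v = scaleV (of_int (pairing \<chi> \<mu>)) v"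
  by (simp add: weight_space_def)

lemma act_weight:
  assumes "x \<in> gw \<mu>" "v \<in> Vw \<nu>"
  shows "act x v \<in> Vw (\<mu> + \<nu>)"
proof -
  have "act (h \<chi>) (act x v) = act (bracket (h \<chi>) x) v + act x (act (h \<chi>) v)" for \<chi>
    by (simp add: act_bracket)
  then show ?thesis
    using assms by (auto simp: weight_space_def act_scale_left act_scale_right pairing_add_right V.scale_left_distrib)
qed

lemma Vw_unique:
  assumes "v \<in> Vw \<mu>" "v \<in> Vw \<nu>" "v \<noteq> 0" shows "\<mu> = \<nu>"
proof (rule pairing_eqI)
  fix \<chi>
  have "scaleV (of_int (pairing \<chi> \<mu>)) v = scaleV (of_int (pairing \<chi> \<nu>)) v"
    using assms act_h by metis
  then show "pairing \<chi> \<mu> = pairing \<chi> \<nu>" using assms(3) by simp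
qed

lemma act_linear: "Vector_Spaces.linear scaleV scaleV (act x)"
  by (rule linear_act_right)

lemma chev_power_weight:
  assumes "i \<in> I" "v \<in> Vw \<mu>"
  shows "(act (chev \<sigma> i) ^^ k) v \<in> Vw (\<mu> + signed \<sigma> (zscale (int k) (coroot (simple i))))"
proof (induction k)
  case 0
  then show ?case using assms by (simp add: signed_def)
next
  case (Suc k)
  have "act (chev \<sigma> i) ((act (chev \<sigma> i) ^^ k) v)
      \<in> Vw (signed \<sigma> (coroot (simple i)) + (\<mu> + signed \<sigma> (zscale (int k) (coroot (simple i)))))"
    using chev_weight[OF assms(1)] Suc by (rule act_weight)
  also have "signed \<sigma> (coroot (simple i)) + (\<mu> + signed \<sigma> (zscale (int k) (coroot (simple i))))
     = \<mu> + signed \<sigma> (zscale (int (Suc k)) (coroot (simple i)))"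
    using zscale_add_left[of "int k" 1] by (simp add: signed_add[symmetric] algebra_simps flip: signed_add)
  finally show ?case by simp
qed

text \<open>With \<open>W\<close> the zero space this concerns genuine extremal vectors; with a
  proper submodule it concerns vectors that are extremal only in the quotient. The sign treats
  highest and lowest vectors together.\<close>

lemma weight_nonneg:
  assumes i: "i \<in> I" and v: "v \<in> Vw \<mu>" "v \<notin> W" "act (chev \<sigma> i) v \<in> W"
    and n: "(act (chev (\<not> \<sigma>) i) ^^ n) v \<in> W"
    and W: "V.subspace W" "\<And>\<tau> w. w \<in> W \<Longrightarrow> act (chev \<tau> i) w \<in> W"
  shows "signed \<sigma> (pairing (simple i) \<mu>) \<ge> 0"
proof (rule sl2_weight_nonneg[where E = "act (chev \<sigma> i)" and F = "act (chev (\<not> \<sigma>) i)",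
      OF V.vector_space_axioms W(1) _ _ act_linear _ v(2,3) n])
  let ?F = "act (chev (\<not> \<sigma>) i)" and ?E = "act (chev \<sigma> i)"
  fix k
  have "?E (?F ((?F ^^ k) v)) = act (bracket (chev \<sigma> i) (chev (\<not> \<sigma>) i)) ((?F ^^ k) v) + ?F (?E ((?F ^^ k) v))"
    by (simp add: act_bracket)
  also have "act (bracket (chev \<sigma> i) (chev (\<not> \<sigma>) i)) ((?F ^^ k) v)
      = scaleV (of_int (signed \<sigma> (pairing (simple i) (\<mu> + signed (\<not> \<sigma>) (zscale (int k) (coroot (simple i))))))) ((?F ^^ k) v)"
    using act_h[OF chev_power_weight[OF i v(1), of k "\<not> \<sigma>"], of "simple i"]
    using chev_bracket[OF i, of \<sigma>] by (cases \<sigma>) (simp_all add: signed_def act_minus_left)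
  also have "signed \<sigma> (pairing (simple i) (\<mu> + signed (\<not> \<sigma>) (zscale (int k) (coroot (simple i)))))
      = signed \<sigma> (pairing (simple i) \<mu>) - 2 * int k"
    by (simp add: pairing_add_right pairing_diff_right pairing_signed signed_add signed_diff signed_not signed_minus pairing_zscale_right pairing_simple[OF i])
  finally show "?E (?F ((?F ^^ k) v))
      = ?F (?E ((?F ^^ k) v)) + scaleV (of_int (signed \<sigma> (pairing (simple i) \<mu>) - 2 * int k)) ((?F ^^ k) v)"
    by (simp add: add.commute)
qed (use W in auto)

end

section \<open>Traces with respect to a finite basis\<close>

context complex_lie_algebra
begin

definition trace_on :: "'g set \<Rightarrow> ('g \<Rightarrow> 'g) \<Rightarrow> complex" where
  "trace_on B f = (\<Sum>b\<in>B. representation B (f b) b)"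

lemma trace_on_comm:
  assumes B: "finite B" "independent B" "span B = UNIV"
    and f: "Vector_Spaces.linear scale scale f" and g: "Vector_Spaces.linear scale scale g"
  shows "trace_on B (\<lambda>v. f (g v)) = trace_on B (\<lambda>v. g (f v))"
proof -
  have expand: "representation B (f (g b)) b = (\<Sum>c\<in>B. representation B (g b) c * representation B (f c) b)"
    if "Vector_Spaces.linear scale scale f" for f g :: "'g \<Rightarrow> 'g" and b
  proof -
    interpret f: Vector_Spaces.linear scale scale f by fact
    have "g b = (\<Sum>c\<in>B. scale (representation B (g b) c) c)"
      using sum_representation_eq[OF B(2), of "g b" B] B by simp
    then have "f (g b) = (\<Sum>c\<in>B. scale (representation B (g b) c) (f c))"
      by (metis (no_types, lifting) f.sum f.scale sum.cong)
    then show ?thesis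
      by (simp add: representation_sum[OF B(2)] representation_scale[OF B(2)] B(3))
  qed
  have "trace_on B (\<lambda>v. f (g v)) = (\<Sum>b\<in>B. \<Sum>c\<in>B. representation B (g b) c * representation B (f c) b)"
    unfolding trace_on_def using expand[OF f] by simp
  also have "\<dots> = (\<Sum>c\<in>B. \<Sum>b\<in>B. representation B (f c) b * representation B (g b) c)"
    by (subst sum.swap) (simp add: mult.commute)
  also have "\<dots> = trace_on B (\<lambda>v. g (f v))"
    unfolding trace_on_def using expand[OF g] by simp
  finally show ?thesis .
qed

lemma trace_on_diff: "independent B \<Longrightarrow> span B = UNIV \<Longrightarrow>
    trace_on B (\<lambda>v. f v - g v) = trace_on B f - trace_on B g"
  by (simp add: trace_on_def representation_diff sum_subtractf)

lemma trace_on_scale: "independent B \<Longrightarrow> span B = UNIV \<Longrightarrow>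
    trace_on B (\<lambda>v. scale c (f v)) = c * trace_on B f"
  by (simp add: trace_on_def representation_scale sum_distrib_left)

end


context langlands_dual_lie_algebra
begin

lemma h_sum: "h (\<Sum>a\<in>A. f a) = (\<Sum>a\<in>A. h (f a))"
  using additive.sum[OF additive_h] by blast

lemma h_zscale: "h (zscale n x) = scale (of_int n) (h x)"
proof -
  have nat: "(\<Sum>_<n. y) = scale (of_nat n) y" for n and y :: 'g
    by (induction n) (simp_all add: scale_left_distrib)
  have "h (zscale n x) = scale (of_nat (nat n)) (h x) - scale (of_nat (nat (- n))) (h x)"
    by (simp add: zscale_def additive.diff[OF additive_h] h_sum nat)
  then show ?thesis by (cases "n \<ge> 0") (simp_all add: of_nat_nat)
qed

lemma h_nonzero: "\<gamma> \<in> R \<Longrightarrow> h \<gamma> \<noteq> 0"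
proof -
  assume \<gamma>: "\<gamma> \<in> R"
  have "zmod.independent {\<gamma>}"
  proof
    assume "zmod.dependent {\<gamma>}"
    then obtain u where u: "u \<noteq> 0" "zscale u \<gamma> = 0"
      unfolding zmod.dependent_explicit by (auto simp: subset_singleton_iff)
    then show False using pairing_zscale_left[of u \<gamma> "coroot \<gamma>"] pairing_coroot[OF \<gamma>] by simp
  qed
  then have "independent {h \<gamma>}" using h_independent by fastforce
  then show "h \<gamma> \<noteq> 0" using dependent_zero[of "{h \<gamma>}"] by auto
qed

lemma h_weight: "h \<chi> \<in> gw 0"
  unfolding cartan by (rule span_base) simp

text \<open>The algebra is finite-dimensional because the character lattice is finitely generated,
  there are finitely many roots, and every root space is a line. A basis of weight vectors makes
  each ad h diagonal, which is how the Killing form is evaluated on the Cartan subalgebra.\<close>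

lemma finite_homogeneous_basis:
  "\<exists>B. finite B \<and> independent B \<and> span B = UNIV \<and> (\<forall>b\<in>B. \<exists>\<mu>. b \<in> gw \<mu>)"
proof -
  obtain S :: "'x set" where S: "finite S" "zmod.span S = UNIV"
    using free_X unfolding free_finite_rank_def by blast
  define r where "r \<gamma> = (SOME x. gw (coroot \<gamma>) = span {x})" for \<gamma>
  have r: "gw (coroot \<gamma>) = span {r \<gamma>}" if "\<gamma> \<in> R" for \<gamma>
    unfolding r_def using root_spaces[OF that] by (metis (mono_tags, lifting) someI_ex)
  define C where "C = h ` S \<union> r ` R"
  have C: "finite C" using S finite_roots by (simp add: C_def)
  have homog: "\<exists>\<mu>. c \<in> gw \<mu>" if "c \<in> C" for c
    using that h_weight r span_base unfolding C_def by blast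
  have hC: "h \<chi> \<in> span C" for \<chi>
  proof -
    have "\<chi> \<in> zmod.span S" using S by simp
    then show ?thesis
    proof (induction rule: zmod.span_induct_alt)
      case base
      then show ?case using additive.zero[OF additive_h] span_zero by simp
    next
      case (step c x y)
      then show ?case using additive.add[OF additive_h]
        by (auto simp: h_zscale C_def intro!: span_add span_scale intro: span_base)
    qed
  qed
  have gwC: "gw \<mu> \<subseteq> span C" for \<mu>
  proof (cases "\<mu> = 0")
    case True
    then show ?thesis using cartan hC span_minimal[of "range h" "span C"] by auto
  next
    case False
    show ?thesis
    proof (cases "\<mu> \<in> coroot ` R")
      case True
      then obtain \<gamma> where "\<gamma> \<in> R" "\<mu> = coroot \<gamma>" by auto
      then show ?thesis using r[of \<gamma>] span_mono[of "{r \<gamma>}" C] by (auto simp: C_def)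
    next
      case False
      with \<open>\<mu> \<noteq> 0\<close> show ?thesis using non_roots[of \<mu>] span_zero by auto
    qed
  qed
  have span: "span C = UNIV"
  proof -
    have "v \<in> span C" for v
    proof -
      obtain w where "\<forall>\<mu>. w \<mu> \<in> gw \<mu>" "v = (\<Sum>\<mu> | w \<mu> \<noteq> 0. w \<mu>)"
        using root_decomposition unfolding direct_sum_decomposition_def by metis
      then show ?thesis using gwC by (auto intro!: span_sum)
    qed
    then show ?thesis by auto
  qed
  obtain B where B: "B \<subseteq> C" "independent B" "C \<subseteq> span B"
    using maximal_independent_subset[of C] by auto
  have "span B = UNIV" using span_mono[OF B(3)] span by (auto simp: span_span)
  moreover have "finite B" using B(1) C by (rule finite_subset)
  moreover have "\<forall>b\<in>B. \<exists>\<mu>. b \<in> gw \<mu>" using B(1) homog by auto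
  ultimately show ?thesis using B(2) by (intro exI[of _ B] conjI)
qed

definition gbasis :: "'g set" where
  "gbasis = (SOME B. finite B \<and> independent B \<and> span B = UNIV \<and> (\<forall>b\<in>B. \<exists>\<mu>. b \<in> gw \<mu>))"

lemma gbasis: "finite gbasis" "independent gbasis" "span gbasis = UNIV" "b \<in> gbasis \<Longrightarrow> \<exists>\<mu>. b \<in> gw \<mu>"
  using someI_ex[OF finite_homogeneous_basis] unfolding gbasis_def[symmetric] by blast+

definition killing :: "'g \<Rightarrow> 'g \<Rightarrow> complex" where
  "killing x y = trace_on gbasis (\<lambda>z. bracket x (bracket y z))"

lemma killing_commute: "killing x y = killing y x"
  unfolding killing_def by (rule trace_on_comm[OF gbasis(1-3) linear_bracket_right linear_bracket_right])

lemma killing_scale_left: "killing (scale c x) y = c * killing x y"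
  unfolding killing_def by (simp add: ad.act_scale_left trace_on_scale gbasis)

lemma killing_zero_left [simp]: "killing 0 y = 0"
  using killing_scale_left[of 0 0 y] by simp

lemma killing_scale_right: "killing x (scale c y) = c * killing x y"
  using killing_scale_left[of c y x] by (simp only: killing_commute[of x])

lemma killing_zero_right [simp]: "killing x 0 = 0"
  using killing_scale_right[of x 0 0] by simp

lemma killing_minus_left: "killing (- x) y = - killing x y"
  using killing_scale_left[of "- 1" x y] by simp

lemma killing_minus_right: "killing x (- y) = - killing x y"
  using killing_scale_right[of x "- 1" y] by simp

text \<open>Both sides are tr(xyz) - tr(yxz) in the adjoint representation, up to cyclicity of the
  trace.\<close>

lemma killing_invariant: "killing (bracket x y) z = killing x (bracket y z)"
proof -
  let ?tr = "trace_on gbasis"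
  have lin: "Vector_Spaces.linear scale scale (\<lambda>v. bracket a (bracket b v))" for a b
    using Vector_Spaces.linear_compose[OF linear_bracket_right[of b] linear_bracket_right[of a]]
    by (simp add: o_def)
  have "killing (bracket x y) z = ?tr (\<lambda>v. bracket x (bracket y (bracket z v))) - ?tr (\<lambda>v. bracket y (bracket x (bracket z v)))"
    unfolding killing_def ad.act_bracket by (rule trace_on_diff[OF gbasis(2,3)])
  also have "?tr (\<lambda>v. bracket y (bracket x (bracket z v))) = ?tr (\<lambda>v. bracket x (bracket z (bracket y v)))"
    by (rule trace_on_comm[OF gbasis(1-3) linear_bracket_right lin])
  also have "?tr (\<lambda>v. bracket x (bracket y (bracket z v))) - ?tr (\<lambda>v. bracket x (bracket z (bracket y v)))
      = killing x (bracket y z)"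
    unfolding killing_def ad.act_bracket ad.act_diff_right by (rule trace_on_diff[OF gbasis(2,3), symmetric])
  finally show ?thesis .
qed

text \<open>Choose \<chi> with nonzero value on \<mu>+\<nu>; invariance under ad of
  \<open>h \<chi>\<close> multiplies the pairing by this value and gives zero.\<close>

lemma killing_orthogonal:
  assumes x: "x \<in> gw \<mu>" and y: "y \<in> gw \<nu>" and ne: "\<mu> + \<nu> \<noteq> 0"
  shows "killing x y = 0"
proof -
  obtain \<chi> where \<chi>: "pairing \<chi> (\<mu> + \<nu>) \<noteq> 0" using ne pairing_eqI[of "\<mu> + \<nu>" 0] by auto
  have "of_int (pairing \<chi> \<mu>) * killing x y = killing (bracket (h \<chi>) x) y"
    using ad.act_h[OF x] by (simp add: killing_scale_left)
  also have "\<dots> = - killing x (bracket (h \<chi>) y)"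
    by (subst bracket_skew) (simp add: killing_minus_left killing_invariant)
  also have "\<dots> = - of_int (pairing \<chi> \<nu>) * killing x y"
    using ad.act_h[OF y] by (simp add: killing_scale_right)
  finally have "of_int (pairing \<chi> (\<mu> + \<nu>)) * killing x y = 0"
    by (simp add: pairing_add_right distrib_right)
  with \<chi> show ?thesis by simp
qed

text \<open>The trace of the square of a diagonal operator with integer entries is a sum of squares.
  It cannot vanish, since \<open>h \<gamma>\<close> acts by 2 on a nonzero root vector.\<close>

lemma killing_coroot_pos:
  assumes \<gamma>: "\<gamma> \<in> R"
  shows "\<exists>k::int. k > 0 \<and> killing (h \<gamma>) (h \<gamma>) = of_int k"
proof -
  define wtb where "wtb b = (SOME \<mu>. b \<in> gw \<mu>)" for b
  have wtb: "b \<in> gw (wtb b)" if "b \<in> gbasis" for b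
    unfolding wtb_def using gbasis(4)[OF that] by (rule someI_ex)
  define k where "k = (\<Sum>b\<in>gbasis. (pairing \<gamma> (wtb b))\<^sup>2)"
  have act: "bracket (h \<gamma>) b = scale (of_int (pairing \<gamma> (wtb b))) b" if "b \<in> gbasis" for b
    using ad.act_h[OF wtb[OF that]] .
  have "killing (h \<gamma>) (h \<gamma>) = (\<Sum>b\<in>gbasis. (of_int (pairing \<gamma> (wtb b)))\<^sup>2)"
    unfolding killing_def trace_on_def using gbasis
    by (intro sum.cong)
      (auto simp: act ad.act_scale_right representation_scale representation_basis power2_eq_square)
  then have K: "killing (h \<gamma>) (h \<gamma>) = of_int k" by (simp add: k_def)
  moreover have "k > 0"
  proof (rule ccontr)
    assume "\<not> k > 0"
    moreover have "k \<ge> 0" unfolding k_def by (intro sum_nonneg) auto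
    ultimately have "k = 0" by simp
    then have zero: "pairing \<gamma> (wtb b) = 0" if "b \<in> gbasis" for b
      using that gbasis(1) unfolding k_def by (subst (asm) sum_nonneg_eq_0_iff) auto
    have h0: "bracket (h \<gamma>) z = 0" for z
    proof -
      have "z \<in> span gbasis" using gbasis by simp
      then show ?thesis
        by (induction rule: span_induct_alt)
          (auto simp: bracket_add_right ad.act_scale_right act zero)
    qed
    obtain x where x: "x \<noteq> 0" "gw (coroot \<gamma>) = span {x}" using root_spaces[OF \<gamma>] by auto
    then have "x \<in> gw (coroot \<gamma>)" using span_base by auto
    then have "bracket (h \<gamma>) x = scale 2 x" using ad.act_h pairing_coroot[OF \<gamma>] by fastforce
    with h0 x show False by simp
  qed
  ultimately show ?thesis by blast
qed

text \<open>By \<open>dual_coroots\<close> some bracket of opposite root vectors is t h with t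
  nonzero and h = \<open>h \<gamma>\<close>. Invariance then gives 2 killing(x,y) = t killing(h,h),
  which is nonzero, and \<open>x\<close> can be rescaled.\<close>

lemma exists_root_vectors:
  assumes \<gamma>: "\<gamma> \<in> R"
  shows "\<exists>x y. x \<in> gw (coroot \<gamma>) \<and> y \<in> gw (- coroot \<gamma>) \<and> killing x y = 1"
proof -
  have "\<exists>x y. x \<in> gw (coroot \<gamma>) \<and> y \<in> gw (- coroot \<gamma>) \<and> bracket x y \<noteq> 0"
  proof (rule ccontr)
    assume "\<not> ?thesis"
    then have "{bracket x y | x y. x \<in> gw (coroot \<gamma>) \<and> y \<in> gw (- coroot \<gamma>)} \<subseteq> {0}" by auto
    from span_mono[OF this] have "span {h \<gamma>} \<subseteq> span {0}"
      by (simp only: dual_coroots[OF \<gamma>])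
    then show False using h_nonzero[OF \<gamma>] span_base[of "h \<gamma>" "{h \<gamma>}"] by auto
  qed
  then obtain x y where xy: "x \<in> gw (coroot \<gamma>)" "y \<in> gw (- coroot \<gamma>)" "bracket x y \<noteq> 0" by blast
  have "bracket x y \<in> span {bracket x y | x y. x \<in> gw (coroot \<gamma>) \<and> y \<in> gw (- coroot \<gamma>)}"
    using xy by (intro span_base) auto
  then have "bracket x y \<in> span {h \<gamma>}" using dual_coroots[OF \<gamma>] by simp
  then obtain t where t: "bracket x y = scale t (h \<gamma>)" by (auto simp: span_singleton)
  with xy have "t \<noteq> 0" by auto
  obtain k :: int where k: "k > 0" "killing (h \<gamma>) (h \<gamma>) = of_int k" using killing_coroot_pos[OF \<gamma>] by blast
  have "2 * killing x y = killing (bracket (h \<gamma>) x) y"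
    using ad.act_h[OF xy(1), of \<gamma>] pairing_coroot[OF \<gamma>] by (simp add: killing_scale_left)
  also have "\<dots> = t * of_int k" by (simp add: killing_invariant t killing_scale_right k)
  finally have ne: "killing x y \<noteq> 0" using \<open>t \<noteq> 0\<close> k by auto
  have "scale (inverse (killing x y)) x \<in> gw (coroot \<gamma>)"
    using ad.Vw_subspace xy(1) by (rule subspace_scale)
  then show ?thesis using xy ne by (intro exI[of _ "scale (inverse (killing x y)) x"] exI[of _ y])
      (auto simp: killing_scale_left)
qed

definition root_vectors :: "'x \<Rightarrow> 'g \<times> 'g" where
  "root_vectors \<gamma> = (SOME (x, y). x \<in> gw (coroot \<gamma>) \<and> y \<in> gw (- coroot \<gamma>) \<and> killing x y = 1)"

definition rvec :: "bool \<Rightarrow> 'x \<Rightarrow> 'g" where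
  "rvec \<sigma> \<gamma> = (if \<sigma> then fst (root_vectors \<gamma>) else snd (root_vectors \<gamma>))"

lemma rvec:
  assumes "\<gamma> \<in> R"
  shows rvec_weight: "rvec \<sigma> \<gamma> \<in> gw (signed \<sigma> (coroot \<gamma>))"
    and killing_rvec: "killing (rvec \<sigma> \<gamma>) (rvec (\<not> \<sigma>) \<gamma>) = 1"
proof -
  have "\<exists>p. case p of (x, y) \<Rightarrow> x \<in> gw (coroot \<gamma>) \<and> y \<in> gw (- coroot \<gamma>) \<and> killing x y = 1"
    using exists_root_vectors[OF assms] by auto
  from someI_ex[OF this]
  have "case root_vectors \<gamma> of (x, y) \<Rightarrow> x \<in> gw (coroot \<gamma>) \<and> y \<in> gw (- coroot \<gamma>) \<and> killing x y = 1"
    by (simp only: root_vectors_def)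
  then have *: "fst (root_vectors \<gamma>) \<in> gw (coroot \<gamma>)" "snd (root_vectors \<gamma>) \<in> gw (- coroot \<gamma>)"
    "killing (fst (root_vectors \<gamma>)) (snd (root_vectors \<gamma>)) = 1"
    by (simp_all add: split_def)
  then show "rvec \<sigma> \<gamma> \<in> gw (signed \<sigma> (coroot \<gamma>))" "killing (rvec \<sigma> \<gamma>) (rvec (\<not> \<sigma>) \<gamma>) = 1"
    using killing_commute[of "snd (root_vectors \<gamma>)"] by (simp_all add: rvec_def signed_def)
qed

lemma gw_root:
  assumes "\<gamma> \<in> R" "z \<in> gw (signed \<sigma> (coroot \<gamma>))"
  shows "z = scale (killing z (rvec (\<not> \<sigma>) \<gamma>)) (rvec \<sigma> \<gamma>)"
proof -
  have "\<exists>\<delta>\<in>R. signed \<sigma> (coroot \<gamma>) = coroot \<delta>"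
  proof (cases \<sigma>)
    case True
    then show ?thesis using assms(1) by (intro bexI[of _ \<gamma>]) (simp_all only: signed_def if_True)
  next
    case False
    then show ?thesis using assms(1)
      by (intro bexI[of _ "- \<gamma>"]) (simp_all only: signed_def if_False coroot_uminus uminus_root)
  qed
  then obtain x where x: "gw (signed \<sigma> (coroot \<gamma>)) = span {x}" using root_spaces by metis
  obtain a b where a: "rvec \<sigma> \<gamma> = scale a x" and b: "z = scale b x"
    using assms(2) rvec_weight[OF assms(1), of \<sigma>] unfolding x by (auto simp: span_singleton)
  have 1: "a * killing x (rvec (\<not> \<sigma>) \<gamma>) = 1"
    using killing_rvec[OF assms(1), of \<sigma>] by (simp add: a killing_scale_left)
  have "scale (killing z (rvec (\<not> \<sigma>) \<gamma>)) (rvec \<sigma> \<gamma>) = scale (b * (a * killing x (rvec (\<not> \<sigma>) \<gamma>))) x"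
    by (simp add: a b killing_scale_left mult_ac)
  then show ?thesis by (simp add: 1 b)
qed

lemma rvec_nonzero: "\<gamma> \<in> R \<Longrightarrow> rvec \<sigma> \<gamma> \<noteq> 0"
  by (metis killing_rvec killing_zero_left zero_neq_one)

text \<open>At most one term is nonzero. Summing over all positive roots keeps the index set fixed,
  so that the double sums in the Casimir commutators can be exchanged.\<close>

lemma rvec_expansion:
  assumes z: "z \<in> gw (signed \<sigma> \<mu>)" and \<mu>: "z = 0 \<or> \<mu> \<in> coroot ` Rpos"
  shows "z = (\<Sum>\<gamma>\<in>Rpos. scale (killing z (rvec (\<not> \<sigma>) \<gamma>)) (rvec \<sigma> \<gamma>))"
proof (cases "z = 0")
  case False
  then obtain \<delta> where \<delta>: "\<delta> \<in> Rpos" "\<mu> = coroot \<delta>" using \<mu> by auto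
  have "killing z (rvec (\<not> \<sigma>) \<gamma>) = 0" if "\<gamma> \<in> Rpos" "\<gamma> \<noteq> \<delta>" for \<gamma>
  proof (rule killing_orthogonal[OF z rvec_weight])
    show "\<gamma> \<in> R" using that Rpos_root by auto
    show "signed \<sigma> \<mu> + signed (\<not> \<sigma>) (coroot \<gamma>) \<noteq> 0"
      using that \<delta> inj_coroot Rpos_root by (auto simp: signed_not signed_eq_iff inj_on_def)
  qed
  then have "(\<Sum>\<gamma>\<in>Rpos. scale (killing z (rvec (\<not> \<sigma>) \<gamma>)) (rvec \<sigma> \<gamma>))
      = (\<Sum>\<gamma>\<in>Rpos. if \<gamma> = \<delta> then scale (killing z (rvec (\<not> \<sigma>) \<delta>)) (rvec \<sigma> \<delta>) else 0)"
    by (intro sum.cong) auto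
  also have "\<dots> = z" using \<delta> gw_root[of \<delta> z \<sigma>] z Rpos_root finite_Rpos by simp
  finally show ?thesis by simp
qed auto

end

section \<open>The Casimir operator\<close>

context langlands_dual_lie_algebra
begin

lemma gw_nonzero_root:
  assumes "z \<in> gw (signed \<sigma> \<mu>)" "z \<noteq> 0" "\<mu> \<noteq> 0" shows "\<mu> \<in> coroot ` R"
proof -
  have "signed \<sigma> \<mu> \<in> coroot ` R"
    using non_roots[of "signed \<sigma> \<mu>"] assms by auto
  then obtain \<gamma> where \<gamma>: "\<gamma> \<in> R" "signed \<sigma> \<mu> = coroot \<gamma>" by auto
  then have "\<mu> = coroot (signed \<sigma> \<gamma>)"
    using coroot_uminus[OF \<gamma>(1)] by (auto simp: signed_def minus_equation_iff[of \<mu>] split: if_splits)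
  then show ?thesis using \<gamma>(1) uminus_root[OF \<gamma>(1)] by (auto simp: signed_def)
qed

text \<open>For the excluded root the bracket falls into the Cartan subalgebra; that one exception
  produces the correction terms in \<open>casimir_lower\<close> and
  \<open>casimir_raise\<close>.\<close>

lemma bracket_rvec_chev_lower:
  assumes \<gamma>: "\<gamma> \<in> Rpos" "\<gamma> \<noteq> simple i" and i: "i \<in> I"
  shows "bracket (rvec \<sigma> \<gamma>) (chev (\<not> \<sigma>) i) \<in> gw (signed \<sigma> (coroot \<gamma> - coroot (simple i)))"
    and "bracket (rvec \<sigma> \<gamma>) (chev (\<not> \<sigma>) i) = 0 \<or> coroot \<gamma> - coroot (simple i) \<in> coroot ` Rpos"
proof -
  show *: "bracket (rvec \<sigma> \<gamma>) (chev (\<not> \<sigma>) i) \<in> gw (signed \<sigma> (coroot \<gamma> - coroot (simple i)))"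
    using ad.act_weight[OF rvec_weight[of \<gamma> \<sigma>] chev_weight[OF i, of "\<not> \<sigma>"]] \<gamma> Rpos_root
    by (simp add: signed_diff signed_not)
  have "coroot \<gamma> \<noteq> coroot (simple i)"
    using \<gamma> inj_coroot Rpos_root simple_root[OF i] by (auto simp: inj_on_def)
  then show "bracket (rvec \<sigma> \<gamma>) (chev (\<not> \<sigma>) i) = 0 \<or> coroot \<gamma> - coroot (simple i) \<in> coroot ` Rpos"
    using gw_nonzero_root[OF *] coroot_diff_simple[OF \<gamma>(1) i] by (metis image_eqI right_minus_eq)
qed

lemma bracket_rvec_chev_raise:
  assumes \<gamma>: "\<gamma> \<in> Rpos" and i: "i \<in> I"
  shows "bracket (rvec \<sigma> \<gamma>) (chev \<sigma> i) \<in> gw (signed \<sigma> (coroot \<gamma> + coroot (simple i)))"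
    and "bracket (rvec \<sigma> \<gamma>) (chev \<sigma> i) = 0 \<or> coroot \<gamma> + coroot (simple i) \<in> coroot ` Rpos"
proof -
  show *: "bracket (rvec \<sigma> \<gamma>) (chev \<sigma> i) \<in> gw (signed \<sigma> (coroot \<gamma> + coroot (simple i)))"
    using ad.act_weight[OF rvec_weight[of \<gamma> \<sigma>] chev_weight[OF i, of \<sigma>]] \<gamma> Rpos_root
    by (simp add: signed_add)
  have "level (coroot \<gamma> + coroot (simple i)) > 0"
    using level_pos[OF \<gamma>] level_pos[OF simple_Rpos[OF i]] by (simp add: level_add)
  then have "coroot \<gamma> + coroot (simple i) \<noteq> 0" by auto
  then show "bracket (rvec \<sigma> \<gamma>) (chev \<sigma> i) = 0 \<or> coroot \<gamma> + coroot (simple i) \<in> coroot ` Rpos"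
    using gw_nonzero_root[OF *] coroot_add_positive[OF \<gamma> simple_Rpos[OF i]] by (metis image_eqI)
qed

text \<open>Half the squared length of the simple root \<open>coroot (simple i)\<close> of the dual
  algebra, in the form on weights induced by the Killing form. It is also the inverse of the pairing
  of e_i with e_(-i), by 2 killing(e_i, e_(-i)) = killing(h_i, h_i). Taking \<open>Re\<close> loses
  nothing, as the value is a positive integer.\<close>

definition chev_const :: "'i \<Rightarrow> real" where
  "chev_const i = 2 / Re (killing (h (simple i)) (h (simple i)))"

lemma chev_const:
  assumes i: "i \<in> I"
  shows chev_const_pos: "chev_const i > 0"
    and killing_chev: "of_real (chev_const i) * killing (chev \<sigma> i) (chev (\<not> \<sigma>) i) = 1"
proof -
  obtain k :: int where k: "k > 0" "killing (h (simple i)) (h (simple i)) = of_int k"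
    using killing_coroot_pos[OF simple_root[OF i]] by auto
  then have const_eq: "chev_const i = 2 / of_int k" by (simp add: chev_const_def)
  then show "chev_const i > 0" using k by simp
  have "bracket (h (simple i)) (chev True i) = scale 2 (chev True i)"
    using ad.act_h[OF chev_weight[OF i, of True], of "simple i"] pairing_simple[OF i]
    by (simp add: signed_def)
  then have "2 * killing (chev True i) (chev False i) = killing (h (simple i)) (bracket (chev True i) (chev False i))"
    by (simp add: killing_invariant[symmetric] killing_scale_left)
  also have "\<dots> = of_int k" using chev_bracket[OF i, of True] k by (simp add: signed_def)
  finally have "of_real (chev_const i) * killing (chev True i) (chev False i) = 1"
    using k by (simp add: const_eq field_simps)
  then show "of_real (chev_const i) * killing (chev \<sigma> i) (chev (\<not> \<sigma>) i) = 1"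
    using killing_commute[of "chev False i"] by (cases \<sigma>) simp_all
qed

text \<open>These constants symmetrize the Cartan matrix: both sides equal
  \<open>chev_const i\<close> times \<open>chev_const j\<close> times the symmetric pairing of h_i
  and h_j.\<close>

lemma chev_const_symmetric:
  assumes i: "i \<in> I" and j: "j \<in> I"
  shows "chev_const i * pairing (simple i) (coroot (simple j)) = chev_const j * pairing (simple j) (coroot (simple i))"
proof -
  have *: "of_real (chev_const j) * killing (h (simple i)) (h (simple j)) = of_int (pairing (simple i) (coroot (simple j)))"
    if "i \<in> I" "j \<in> I" for i j
  proof -
    have "killing (h (simple i)) (h (simple j)) = killing (bracket (h (simple i)) (chev True j)) (chev False j)"
      using chev_bracket[OF that(2), of True] by (simp add: signed_def killing_invariant)
    also have "\<dots> = of_int (pairing (simple i) (coroot (simple j))) * killing (chev True j) (chev False j)"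
      using ad.act_h[OF chev_weight[OF that(2), of True], of "simple i"]
      by (simp add: signed_def killing_scale_left)
    finally show ?thesis using killing_chev[OF that(2), of True] by (simp add: mult_ac)
  qed
  have "complex_of_real (chev_const i * pairing (simple i) (coroot (simple j)))
      = of_real (chev_const i) * (of_real (chev_const j) * killing (h (simple i)) (h (simple j)))"
    using *[OF i j] by simp
  also have "\<dots> = of_real (chev_const j) * (of_real (chev_const i) * killing (h (simple j)) (h (simple i)))"
    by (subst killing_commute) (simp add: mult_ac)
  also have "\<dots> = complex_of_real (chev_const j * pairing (simple j) (coroot (simple i)))"
    using *[OF j i] by simp
  finally show ?thesis by (simp only: of_real_eq_iff)
qed

text \<open>If no \<open>chev \<sigma> i\<close> moved the opposite root vector, that vector would be extremal of weight
  \<open>- coroot \<gamma>\<close>, which is impossible because \<open>\<langle>\<gamma>, - coroot \<gamma>\<rangle> < 0\<close>.\<close>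
lemma exists_chev_nonzero:
  assumes \<gamma>: "\<gamma> \<in> Rpos"
  shows "\<exists>i\<in>I. bracket (chev \<sigma> i) (rvec (\<not> \<sigma>) \<gamma>) \<noteq> 0"
proof (rule ccontr)
  assume "\<not> ?thesis"
  then have zero: "bracket (chev \<sigma> i) (rvec (\<not> \<sigma>) \<gamma>) = 0" if "i \<in> I" for i using that by auto
  have R: "\<gamma> \<in> R" using \<gamma> Rpos_root by auto
  have neg: "pairing (simple i) (coroot \<gamma>) \<le> 0" if i: "i \<in> I" for i
  proof -
    \<comment> \<open>The root string stops after finitely many steps: its weights are pairwise
      distinct, and only finitely many weights have nonzero weight space.\<close>
    let ?w = "\<lambda>n. signed (\<not> \<sigma>) (coroot \<gamma>) + signed (\<not> \<sigma>) (zscale (int n) (coroot (simple i)))"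
    have wt: "(bracket (chev (\<not> \<sigma>) i) ^^ n) (rvec (\<not> \<sigma>) \<gamma>) \<in> gw (?w n)" for n
      by (rule ad.chev_power_weight[OF i rvec_weight[OF R]])
    have inj: "inj ?w"
    proof (rule injI)
      fix m n assume "?w m = ?w n"
      then have "zscale (int m) (coroot (simple i)) = zscale (int n) (coroot (simple i))"
        by (simp add: signed_eq_iff)
      then have "int m * 2 = int n * 2" using pairing_zscale_right[of "simple i"] pairing_simple[OF i] by metis
      then show "m = n" by simp
    qed
    have "\<exists>n. (bracket (chev (\<not> \<sigma>) i) ^^ n) (rvec (\<not> \<sigma>) \<gamma>) = 0"
    proof (rule ccontr)
      assume "\<not> ?thesis"
      then have "?w n \<in> insert 0 (coroot ` R)" for n using wt[of n] non_roots[of "?w n"] by auto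
      then have "range ?w \<subseteq> insert 0 (coroot ` R)" by auto
      then have "finite (range ?w)" by (rule finite_subset) (simp add: finite_roots)
      then show False using finite_imageD[OF _ inj] by simp
    qed
    then obtain n where n: "(bracket (chev (\<not> \<sigma>) i) ^^ n) (rvec (\<not> \<sigma>) \<gamma>) = 0" by blast
    have "signed \<sigma> (pairing (simple i) (signed (\<not> \<sigma>) (coroot \<gamma>))) \<ge> 0"
      by (rule ad.weight_nonneg[OF i rvec_weight[OF R], where W = "{0}" and n = n])
        (use n zero[OF i] rvec_nonzero[OF R] in \<open>auto simp: subspace_single_0\<close>)
    then show ?thesis by (simp add: signed_not signed_minus pairing_signed)
  qed
  have "pairing \<gamma> (coroot \<gamma>) = (\<Sum>i\<in>I. root_coord i \<gamma> * pairing (simple i) (coroot \<gamma>))"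
    by (subst (1) root_expansion[OF R]) (simp add: pairing_sum_left pairing_zscale_left)
  also have "\<dots> \<le> 0" using \<gamma> neg by (intro sum_nonpos mult_nonneg_nonpos) (auto simp: Rpos_def)
  finally show False using pairing_coroot[OF R] by simp
qed

text \<open>An induction principle for root vectors, used with \<open>M\<close> the set of algebra
  elements that act in a desired way. For nonsimple \<gamma>, some e_i moves the opposite vector of
  \<gamma> to a nonzero multiple of the opposite vector of a lower root \<delta>. Invariance of the
  Killing form turns this into a nonzero bracket of e_i with the vector of \<delta>, which spans the
  root line of \<gamma>.\<close>

lemma root_vectors_generated:
  assumes M: "subspace M" "\<And>i x. i \<in> I \<Longrightarrow> x \<in> M \<Longrightarrow> bracket (chev \<sigma> i) x \<in> M"
      "\<And>i. i \<in> I \<Longrightarrow> chev \<sigma> i \<in> M"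
    and "\<gamma> \<in> Rpos"
  shows "rvec \<sigma> \<gamma> \<in> M"
  using \<open>\<gamma> \<in> Rpos\<close>
proof (induction "nat (level (coroot \<gamma>))" arbitrary: \<gamma> rule: less_induct)
  case less
  have R: "\<gamma> \<in> R" using less.prems Rpos_root by auto
  have line: "rvec \<sigma> \<gamma> \<in> M" if z: "z \<in> gw (signed \<sigma> (coroot \<gamma>))" "z \<noteq> 0" "z \<in> M" for z
  proof -
    define k where "k = killing z (rvec (\<not> \<sigma>) \<gamma>)"
    have zk: "z = scale k (rvec \<sigma> \<gamma>)" unfolding k_def by (rule gw_root[OF R z(1)])
    then have "k \<noteq> 0" using z(2) by auto
    then have "rvec \<sigma> \<gamma> = scale (inverse k) z" by (simp add: zk)
    then show ?thesis using subspace_scale[OF M(1) z(3)] by simp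
  qed
  show ?case
  proof (cases "\<exists>i\<in>I. \<gamma> = simple i")
    case True
    then obtain i where i: "i \<in> I" "\<gamma> = simple i" by auto
    have "chev \<sigma> i \<noteq> 0" using killing_chev[OF i(1), of \<sigma>] by auto
    then show ?thesis using line[of "chev \<sigma> i"] chev_weight[OF i(1)] M(3)[OF i(1)] i by auto
  next
    case False
    obtain i where i: "i \<in> I" "bracket (chev \<sigma> i) (rvec (\<not> \<sigma>) \<gamma>) \<noteq> 0"
      using exists_chev_nonzero[OF less.prems] by blast
    then have ne: "bracket (rvec (\<not> \<sigma>) \<gamma>) (chev \<sigma> i) \<noteq> 0" using bracket_skew[of "chev \<sigma> i"] by auto
    have "\<gamma> \<noteq> simple i" using False i by auto
    from bracket_rvec_chev_lower[OF less.prems this i(1), of "\<not> \<sigma>"] ne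
    have wt: "bracket (rvec (\<not> \<sigma>) \<gamma>) (chev \<sigma> i) \<in> gw (signed (\<not> \<sigma>) (coroot \<gamma> - coroot (simple i)))"
      and "coroot \<gamma> - coroot (simple i) \<in> coroot ` Rpos" by simp_all
    then obtain \<delta> where \<delta>: "\<delta> \<in> Rpos" "coroot \<gamma> - coroot (simple i) = coroot \<delta>" by auto
    have \<gamma>\<delta>: "coroot \<gamma> = coroot \<delta> + coroot (simple i)" using \<delta>(2) by (simp add: algebra_simps)
    have "level (coroot \<delta>) < level (coroot \<gamma>)"
      using level_pos[OF simple_Rpos[OF i(1)]] by (simp add: \<gamma>\<delta> level_add)
    then have IH: "rvec \<sigma> \<delta> \<in> M" using level_pos[OF \<delta>(1)] \<delta>(1) by (intro less.hyps) auto
    define t where "t = killing (bracket (rvec (\<not> \<sigma>) \<gamma>) (chev \<sigma> i)) (rvec \<sigma> \<delta>)"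
    have "bracket (rvec (\<not> \<sigma>) \<gamma>) (chev \<sigma> i) = scale t (rvec (\<not> \<sigma>) \<delta>)"
      using gw_root[OF Rpos_root[OF \<delta>(1)], of _ "\<not> \<sigma>"] wt \<delta>(2) by (simp add: t_def)
    with ne have "t \<noteq> 0" by auto
    moreover have "t = killing (rvec (\<not> \<sigma>) \<gamma>) (bracket (chev \<sigma> i) (rvec \<sigma> \<delta>))"
      by (simp add: t_def killing_invariant)
    ultimately have "bracket (chev \<sigma> i) (rvec \<sigma> \<delta>) \<noteq> 0" by auto
    moreover have "bracket (chev \<sigma> i) (rvec \<sigma> \<delta>) \<in> gw (signed \<sigma> (coroot \<gamma>))"
      using ad.act_weight[OF chev_weight[OF i(1), of \<sigma>] rvec_weight[OF Rpos_root[OF \<delta>(1)], of \<sigma>]]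
      by (simp add: \<gamma>\<delta> signed_add add.commute)
    ultimately show ?thesis using line M(2)[OF i(1) IH] by blast
  qed
qed

text \<open>If the generators are a x and b y for the dual pair x, y, then
  \<open>chev_const i\<close> times ab is 1; this converts between the two normalizations.\<close>

lemma chev_rvec:
  assumes i: "i \<in> I"
  shows "scale (of_real (chev_const i) * killing (chev \<sigma> i) (rvec (\<not> \<sigma>) (simple i))) (chev (\<not> \<sigma>) i) = rvec (\<not> \<sigma>) (simple i)"
proof -
  let ?a = "killing (chev \<sigma> i) (rvec (\<not> \<sigma>) (simple i))"
  have e: "chev \<sigma> i = scale ?a (rvec \<sigma> (simple i))"
    by (rule gw_root[OF simple_root[OF i] chev_weight[OF i]])
  define b where "b = killing (chev (\<not> \<sigma>) i) (rvec \<sigma> (simple i))"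
  have f: "chev (\<not> \<sigma>) i = scale b (rvec (\<not> \<sigma>) (simple i))"
    using gw_root[OF simple_root[OF i] chev_weight[OF i, of "\<not> \<sigma>"]] by (simp add: b_def)
  have "killing (chev \<sigma> i) (chev (\<not> \<sigma>) i) = ?a * b"
    by (subst f) (simp add: killing_scale_right)
  then have "of_real (chev_const i) * (?a * b) = 1" using killing_chev[OF i, of \<sigma>] by simp
  moreover have "scale (of_real (chev_const i) * ?a) (chev (\<not> \<sigma>) i) = scale (of_real (chev_const i) * (?a * b)) (rvec (\<not> \<sigma>) (simple i))"
    by (subst f) (simp add: mult_ac)
  ultimately show ?thesis by simp
qed

text \<open>The bracket has weight a difference of two distinct simple coroots. Were that a coroot,
  it would be positive, and a simple coroot would be a sum of two positive ones.\<close>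

lemma bracket_chev_distinct:
  assumes "i \<in> I" "j \<in> I" "i \<noteq> j"
  shows "bracket (chev True i) (chev False j) = 0"
proof (rule ccontr)
  assume ne: "bracket (chev True i) (chev False j) \<noteq> 0"
  have wt: "bracket (chev True i) (chev False j) \<in> gw (signed True (coroot (simple i) - coroot (simple j)))"
    using ad.act_weight[OF chev_weight[OF assms(1), of True] chev_weight[OF assms(2), of False]]
    by (simp add: signed_def)
  have "simple i \<noteq> simple j" using inj_simple assms by (auto simp: inj_on_def)
  then have "coroot (simple i) - coroot (simple j) \<noteq> 0"
    using inj_coroot simple_root assms by (auto simp: inj_on_def)
  from gw_nonzero_root[OF wt ne this] obtain \<delta> where "\<delta> \<in> Rpos" "coroot (simple i) - coroot (simple j) = coroot \<delta>"
    using coroot_diff_simple[OF simple_Rpos[OF assms(1)] assms(2)] by metis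
  then show False using coroot_add_not_simple[of \<delta> "simple j" i] simple_Rpos assms by (simp add: algebra_simps)
qed

end

context langlands_dual_module
begin

definition casimir :: "'v \<Rightarrow> 'v" where
  "casimir v = (\<Sum>\<gamma>\<in>Rpos. act (rvec False \<gamma>) (act (rvec True \<gamma>) v))"

lemma casimir_linear: "Vector_Spaces.linear scaleV scaleV casimir"
  by (simp add: Vector_Spaces.linear_def V.vector_space_axioms module_hom_iff V.module_axioms casimir_def act_add_right act_scale_right sum.distrib V.scale_sum_right)

lemma casimir_weight: "v \<in> Vw \<mu> \<Longrightarrow> casimir v \<in> Vw \<mu>"
  unfolding casimir_def
proof (intro V.subspace_sum[OF Vw_subspace])
  fix \<gamma> assume "v \<in> Vw \<mu>" "\<gamma> \<in> Rpos"
  then show "act (rvec False \<gamma>) (act (rvec True \<gamma>) v) \<in> Vw \<mu>"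
    using act_weight[OF rvec_weight[of \<gamma> False] act_weight[OF rvec_weight[of \<gamma> True]], of v \<mu>] Rpos_root
    by (simp add: signed_def)
qed

lemma act_act: "act x (act y v) = act (bracket x y) v + act y (act x v)"
  by (simp add: act_bracket)

lemma casimir_commutator:
  "casimir (act z v) = act z (casimir v) +
    ((\<Sum>\<gamma>\<in>Rpos. act (rvec False \<gamma>) (act (bracket (rvec True \<gamma>) z) v)) +
     (\<Sum>\<gamma>\<in>Rpos. act (bracket (rvec False \<gamma>) z) (act (rvec True \<gamma>) v)))"
proof -
  have "act (rvec False \<gamma>) (act (rvec True \<gamma>) (act z v)) =
      act z (act (rvec False \<gamma>) (act (rvec True \<gamma>) v)) +
      (act (rvec False \<gamma>) (act (bracket (rvec True \<gamma>) z) v) + act (bracket (rvec False \<gamma>) z) (act (rvec True \<gamma>) v))" for \<gamma>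
    by (simp add: act_bracket act_diff_right)
  then show ?thesis unfolding casimir_def act_sum_right by (simp add: sum.distrib)
qed

text \<open>Expand the brackets of f with the x_\<gamma> and with the y_\<gamma> in root vectors
  again. By invariance the two coefficient matrices are negative transposes, so the double sums
  cancel. What survives is the bracket of f with the simple root vector x, which is a multiple of
  h.\<close>

lemma casimir_lower:
  assumes i: "i \<in> I"
  shows "casimir (act (chev False i) v)
    = act (chev False i) (casimir v) + scaleV (of_real (chev_const i)) (act (chev False i) (act (h (simple i)) v))"
proof -
  let ?f = "chev False i" and ?x = "rvec True" and ?y = "rvec False" and ?\<alpha> = "simple i"
  have \<alpha>: "?\<alpha> \<in> Rpos" "?\<alpha> \<in> R" using simple_Rpos simple_root i by auto
  \<comment> \<open>The part of the bracket that lies in the positive root spaces: the whole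
    bracket, except at the simple root, where it is zero.\<close>
  define T where "T \<gamma> = (\<Sum>\<delta>\<in>Rpos. scale (killing (bracket (?x \<gamma>) ?f) (?y \<delta>)) (?x \<delta>))" for \<gamma>
  have T: "T \<gamma> = bracket (?x \<gamma>) ?f" if "\<gamma> \<in> Rpos" "\<gamma> \<noteq> ?\<alpha>" for \<gamma>
    unfolding T_def using rvec_expansion[of _ True] bracket_rvec_chev_lower[OF that i, of True] by simp
  have T\<alpha>: "T ?\<alpha> = 0"
  proof -
    have "killing (bracket (?x ?\<alpha>) ?f) (?y \<delta>) = 0" if "\<delta> \<in> Rpos" for \<delta>
    proof (rule killing_orthogonal)
      show "bracket (?x ?\<alpha>) ?f \<in> gw (signed True (coroot ?\<alpha>) + signed False (coroot ?\<alpha>))"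
        using rvec_weight[OF \<alpha>(2)] chev_weight[OF i] by (rule ad.act_weight)
      show "?y \<delta> \<in> gw (signed False (coroot \<delta>))" using that Rpos_root by (intro rvec_weight) auto
      show "signed True (coroot ?\<alpha>) + signed False (coroot ?\<alpha>) + signed False (coroot \<delta>) \<noteq> 0"
        using that Rpos_root coroot_nonzero by (auto simp: signed_def)
    qed
    then show ?thesis by (simp add: T_def)
  qed
  have y: "bracket (?y \<gamma>) ?f = (\<Sum>\<delta>\<in>Rpos. scale (killing (bracket (?y \<gamma>) ?f) (?x \<delta>)) (?y \<delta>))" if "\<gamma> \<in> Rpos" for \<gamma>
    using rvec_expansion[of _ False] bracket_rvec_chev_raise[OF that i, of False] by simp
  have K: "killing (bracket (?y \<gamma>) ?f) (?x \<delta>) = - killing (bracket (?x \<delta>) ?f) (?y \<gamma>)" for \<gamma> \<delta>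
  proof -
    have "killing (bracket (?y \<gamma>) ?f) (?x \<delta>) = killing (?y \<gamma>) (bracket ?f (?x \<delta>))" by (rule killing_invariant)
    also have "\<dots> = - killing (bracket (?x \<delta>) ?f) (?y \<gamma>)"
      by (subst bracket_skew) (simp add: killing_minus_right killing_commute[of "?y \<gamma>"])
    finally show ?thesis .
  qed
  have "(\<Sum>\<gamma>\<in>Rpos. act (bracket (?y \<gamma>) ?f) (act (?x \<gamma>) v))
      = (\<Sum>\<gamma>\<in>Rpos. \<Sum>\<delta>\<in>Rpos. - scaleV (killing (bracket (?x \<delta>) ?f) (?y \<gamma>)) (act (?y \<delta>) (act (?x \<gamma>) v)))"
    by (intro sum.cong refl, subst y) (auto simp: act_sum_left act_scale_left act_minus_left K)
  also have "\<dots> = - (\<Sum>\<delta>\<in>Rpos. act (?y \<delta>) (act (T \<delta>) v))"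
    by (subst sum.swap)
      (simp add: sum_negf T_def act_sum_left act_sum_right act_scale_left act_scale_right)
  finally have "(\<Sum>\<gamma>\<in>Rpos. act (?y \<gamma>) (act (bracket (?x \<gamma>) ?f) v)) + (\<Sum>\<gamma>\<in>Rpos. act (bracket (?y \<gamma>) ?f) (act (?x \<gamma>) v))
      = (\<Sum>\<gamma>\<in>Rpos. act (?y \<gamma>) (act (bracket (?x \<gamma>) ?f) v) - act (?y \<gamma>) (act (T \<gamma>) v))"
    by (simp add: sum_subtractf)
  also have "\<dots> = (\<Sum>\<gamma>\<in>Rpos. if \<gamma> = ?\<alpha> then act (?y ?\<alpha>) (act (bracket (?x ?\<alpha>) ?f) v) else 0)"
    by (intro sum.cong) (auto simp: T T\<alpha>)
  also have "\<dots> = act (?y ?\<alpha>) (act (bracket (?x ?\<alpha>) ?f) v)" using \<alpha> finite_Rpos by simp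
  also have "\<dots> = scaleV (of_real (chev_const i)) (act ?f (act (h ?\<alpha>) v))"
  proof -
    \<comment> \<open>With e_i = a x one has h = a[x,f], while y is \<open>chev_const i\<close>
      times a f. The unknown factor a is absorbed into h and only \<open>chev_const i\<close>
      remains.\<close>
    let ?a = "killing (chev True i) (?y ?\<alpha>)"
    have "chev True i = scale ?a (?x ?\<alpha>)" using gw_root[OF \<alpha>(2) chev_weight[OF i, of True]] by simp
    then have "bracket (chev True i) ?f = scale ?a (bracket (?x ?\<alpha>) ?f)" by (metis ad.act_scale_left)
    then have hb: "h ?\<alpha> = scale ?a (bracket (?x ?\<alpha>) ?f)" using chev_bracket[OF i, of True] by (simp add: signed_def)
    have "?y ?\<alpha> = scale (of_real (chev_const i) * ?a) ?f" using chev_rvec[OF i, of True] by simp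
    then have "act (?y ?\<alpha>) w = scaleV (of_real (chev_const i) * ?a) (act ?f w)" for w by (metis act_scale_left)
    then have "act (?y ?\<alpha>) (act (bracket (?x ?\<alpha>) ?f) v)
      = scaleV (of_real (chev_const i)) (act ?f (act (scale ?a (bracket (?x ?\<alpha>) ?f)) v))"
      by (simp add: act_scale_left act_scale_right)
    then show ?thesis by (simp only: hb[symmetric])
  qed
  finally show ?thesis unfolding casimir_commutator[of ?f v] by simp
qed

text \<open>The cancellation of \<open>casimir_lower\<close>, with the surviving bracket now on the
  outer factor y. Hence h stands to the left of e_i, and its eigenvalue is taken at the raised
  weight.\<close>

lemma casimir_raise:
  assumes i: "i \<in> I"
  shows "casimir (act (chev True i) v)
    = act (chev True i) (casimir v) - scaleV (of_real (chev_const i)) (act (h (simple i)) (act (chev True i) v))"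
proof -
  let ?e = "chev True i" and ?x = "rvec True" and ?y = "rvec False" and ?\<alpha> = "simple i"
  have \<alpha>: "?\<alpha> \<in> Rpos" "?\<alpha> \<in> R" using simple_Rpos simple_root i by auto
  define T where "T \<gamma> = (\<Sum>\<delta>\<in>Rpos. scale (killing (bracket (?y \<gamma>) ?e) (?x \<delta>)) (?y \<delta>))" for \<gamma>
  have T: "T \<gamma> = bracket (?y \<gamma>) ?e" if "\<gamma> \<in> Rpos" "\<gamma> \<noteq> ?\<alpha>" for \<gamma>
    unfolding T_def using rvec_expansion[of _ False] bracket_rvec_chev_lower[OF that i, of False] by simp
  have T\<alpha>: "T ?\<alpha> = 0"
  proof -
    have "killing (bracket (?y ?\<alpha>) ?e) (?x \<delta>) = 0" if "\<delta> \<in> Rpos" for \<delta>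
    proof (rule killing_orthogonal)
      show "bracket (?y ?\<alpha>) ?e \<in> gw (signed False (coroot ?\<alpha>) + signed True (coroot ?\<alpha>))"
        using rvec_weight[OF \<alpha>(2)] chev_weight[OF i] by (rule ad.act_weight)
      show "?x \<delta> \<in> gw (signed True (coroot \<delta>))" using that Rpos_root by (intro rvec_weight) auto
      show "signed False (coroot ?\<alpha>) + signed True (coroot ?\<alpha>) + signed True (coroot \<delta>) \<noteq> 0"
        using that Rpos_root coroot_nonzero by (auto simp: signed_def)
    qed
    then show ?thesis by (simp add: T_def)
  qed
  have x: "bracket (?x \<gamma>) ?e = (\<Sum>\<delta>\<in>Rpos. scale (killing (bracket (?x \<gamma>) ?e) (?y \<delta>)) (?x \<delta>))" if "\<gamma> \<in> Rpos" for \<gamma>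
    using rvec_expansion[of _ True] bracket_rvec_chev_raise[OF that i, of True] by simp
  have K: "killing (bracket (?x \<gamma>) ?e) (?y \<delta>) = - killing (bracket (?y \<delta>) ?e) (?x \<gamma>)" for \<gamma> \<delta>
  proof -
    have "killing (bracket (?x \<gamma>) ?e) (?y \<delta>) = killing (?x \<gamma>) (bracket ?e (?y \<delta>))" by (rule killing_invariant)
    also have "\<dots> = - killing (bracket (?y \<delta>) ?e) (?x \<gamma>)"
      by (subst bracket_skew) (simp add: killing_minus_right killing_commute[of "?x \<gamma>"])
    finally show ?thesis .
  qed
  have "(\<Sum>\<gamma>\<in>Rpos. act (?y \<gamma>) (act (bracket (?x \<gamma>) ?e) v))
      = (\<Sum>\<gamma>\<in>Rpos. \<Sum>\<delta>\<in>Rpos. - scaleV (killing (bracket (?y \<delta>) ?e) (?x \<gamma>)) (act (?y \<gamma>) (act (?x \<delta>) v)))"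
    by (intro sum.cong refl, subst x)
      (auto simp: act_sum_left act_sum_right act_scale_left act_scale_right act_minus_left act_minus_right K)
  also have "\<dots> = - (\<Sum>\<delta>\<in>Rpos. act (T \<delta>) (act (?x \<delta>) v))"
    by (subst sum.swap)
      (simp add: sum_negf T_def act_sum_left act_sum_right act_scale_left act_scale_right)
  finally have "(\<Sum>\<gamma>\<in>Rpos. act (?y \<gamma>) (act (bracket (?x \<gamma>) ?e) v)) + (\<Sum>\<gamma>\<in>Rpos. act (bracket (?y \<gamma>) ?e) (act (?x \<gamma>) v))
      = (\<Sum>\<gamma>\<in>Rpos. act (bracket (?y \<gamma>) ?e) (act (?x \<gamma>) v) - act (T \<gamma>) (act (?x \<gamma>) v))"
    by (simp add: sum_subtractf)
  also have "\<dots> = (\<Sum>\<gamma>\<in>Rpos. if \<gamma> = ?\<alpha> then act (bracket (?y ?\<alpha>) ?e) (act (?x ?\<alpha>) v) else 0)"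
    by (intro sum.cong) (auto simp: T T\<alpha>)
  also have "\<dots> = act (bracket (?y ?\<alpha>) ?e) (act (?x ?\<alpha>) v)" using \<alpha> finite_Rpos by simp
  also have "\<dots> = - scaleV (of_real (chev_const i)) (act (h ?\<alpha>) (act ?e v))"
  proof -
    let ?b = "killing (chev False i) (?x ?\<alpha>)"
    have "chev False i = scale ?b (?y ?\<alpha>)" using gw_root[OF \<alpha>(2) chev_weight[OF i, of False]] by simp
    then have "bracket (chev False i) ?e = scale ?b (bracket (?y ?\<alpha>) ?e)" by (metis ad.act_scale_left)
    then have hb: "- h ?\<alpha> = scale ?b (bracket (?y ?\<alpha>) ?e)" using chev_bracket[OF i, of False] by (simp add: signed_def)
    have "?x ?\<alpha> = scale (of_real (chev_const i) * ?b) ?e" using chev_rvec[OF i, of False] by simp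
    then have "act (?x ?\<alpha>) w = scaleV (of_real (chev_const i) * ?b) (act ?e w)" for w by (metis act_scale_left)
    then have "act (bracket (?y ?\<alpha>) ?e) (act (?x ?\<alpha>) v)
      = scaleV (of_real (chev_const i)) (act (scale ?b (bracket (?y ?\<alpha>) ?e)) (act ?e v))"
      by (simp add: act_scale_left act_scale_right)
    then show ?thesis by (simp only: hb[symmetric]) (simp add: act_minus_left)
  qed
  finally show ?thesis unfolding casimir_commutator[of ?e v] by simp
qed

end

section \<open>Complete reducibility\<close>

locale locally_finite_dual_module =
  langlands_dual_module pairing R coroot I simple scale bracket h e scaleV act
  for pairing :: "'x::ab_group_add \<Rightarrow> 'y::ab_group_add \<Rightarrow> int"
    and R :: "'x set"
    and coroot :: "'x \<Rightarrow> 'y"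
    and I :: "'i set"
    and simple :: "'i \<Rightarrow> 'x"
    and scale :: "complex \<Rightarrow> 'g::ab_group_add \<Rightarrow> 'g"
    and bracket :: "'g \<Rightarrow> 'g \<Rightarrow> 'g"
    and h :: "'x \<Rightarrow> 'g"
    and e :: "'i + 'i \<Rightarrow> 'g"
    and scaleV :: "complex \<Rightarrow> 'v::ab_group_add \<Rightarrow> 'v"
    and act :: "'g \<Rightarrow> 'v \<Rightarrow> 'v" +
  assumes locally_finite: "locally_finite pairing h scaleV act"
begin

section \<open>Weight components and words in the generators\<close>

definition wcomp :: "'v \<Rightarrow> 'y \<Rightarrow> 'v" where
  "wcomp v = (THE w. (\<forall>\<mu>. w \<mu> \<in> Vw \<mu>) \<and> finite {\<mu>. w \<mu> \<noteq> 0} \<and> v = (\<Sum>\<mu> | w \<mu> \<noteq> 0. w \<mu>))"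

lemma ex1_wcomp: "\<exists>!w. (\<forall>\<mu>. w \<mu> \<in> Vw \<mu>) \<and> finite {\<mu>. w \<mu> \<noteq> 0} \<and> v = (\<Sum>\<mu> | w \<mu> \<noteq> 0. w \<mu>)"
  using locally_finite unfolding locally_finite_def direct_sum_decomposition_def by blast

lemma wcomp: "wcomp v \<mu> \<in> Vw \<mu>" "finite {\<mu>. wcomp v \<mu> \<noteq> 0}" "(\<Sum>\<mu> | wcomp v \<mu> \<noteq> 0. wcomp v \<mu>) = v"
proof -
  have *: "(\<forall>\<mu>. wcomp v \<mu> \<in> Vw \<mu>) \<and> finite {\<mu>. wcomp v \<mu> \<noteq> 0} \<and> v = (\<Sum>\<mu> | wcomp v \<mu> \<noteq> 0. wcomp v \<mu>)"
    unfolding wcomp_def by (rule theI'[OF ex1_wcomp])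
  then show "wcomp v \<mu> \<in> Vw \<mu>" "finite {\<mu>. wcomp v \<mu> \<noteq> 0}" by blast+
  show "(\<Sum>\<mu> | wcomp v \<mu> \<noteq> 0. wcomp v \<mu>) = v" by (rule sym) (use * in blast)
qed

lemma wcomp_eqI:
  assumes "\<And>\<mu>. w \<mu> \<in> Vw \<mu>" "finite F" "\<And>\<mu>. \<mu> \<notin> F \<Longrightarrow> w \<mu> = 0" "v = (\<Sum>\<mu>\<in>F. w \<mu>)"
  shows "wcomp v = w"
proof -
  have "{\<mu>. w \<mu> \<noteq> 0} \<subseteq> F" using assms(3) by auto
  then have "finite {\<mu>. w \<mu> \<noteq> 0}" "v = (\<Sum>\<mu> | w \<mu> \<noteq> 0. w \<mu>)"
    using assms(2,4) finite_subset by (auto intro!: sum.mono_neutral_right)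
  then show ?thesis unfolding wcomp_def using assms(1) by (intro the1_equality[OF ex1_wcomp]) auto
qed

lemma sum_wcomp: "finite F \<Longrightarrow> {\<mu>. wcomp v \<mu> \<noteq> 0} \<subseteq> F \<Longrightarrow> (\<Sum>\<mu>\<in>F. wcomp v \<mu>) = v"
  by (rule trans[OF _ wcomp(3)[of v]], rule sum.mono_neutral_right) auto

lemma wcomp_add: "wcomp (v + w) \<mu> = wcomp v \<mu> + wcomp w \<mu>"
proof -
  define F where "F = {\<mu>. wcomp v \<mu> \<noteq> 0} \<union> {\<mu>. wcomp w \<mu> \<noteq> 0}"
  have F: "finite F" using wcomp(2) by (simp add: F_def)
  have "wcomp (v + w) = (\<lambda>\<mu>. wcomp v \<mu> + wcomp w \<mu>)"
    by (rule wcomp_eqI[OF _ F])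
      (use F in \<open>auto simp: F_def sum.distrib sum_wcomp intro: V.subspace_add[OF Vw_subspace] wcomp\<close>)
  then show ?thesis by simp
qed

lemma wcomp_scale: "wcomp (scaleV c v) \<mu> = scaleV c (wcomp v \<mu>)"
proof -
  have "wcomp (scaleV c v) = (\<lambda>\<mu>. scaleV c (wcomp v \<mu>))"
  proof (rule wcomp_eqI[OF _ wcomp(2)[of v]])
    show "scaleV c v = (\<Sum>\<mu> | wcomp v \<mu> \<noteq> 0. scaleV c (wcomp v \<mu>))"
      by (simp only: V.scale_sum_right[symmetric] wcomp(3))
  qed (simp_all add: V.subspace_scale[OF Vw_subspace wcomp(1)])
  then show ?thesis by simp
qed

lemma wcomp_weight: "v \<in> Vw \<mu> \<Longrightarrow> wcomp v = (\<lambda>\<nu>. if \<nu> = \<mu> then v else 0)"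
  by (rule wcomp_eqI[of _ "{\<mu>}"]) (auto simp: V.subspace_0[OF Vw_subspace])

lemma wcomp_act:
  assumes "x \<in> gw \<nu>" shows "wcomp (act x v) (\<nu> + \<mu>) = act x (wcomp v \<mu>)"
proof -
  let ?S = "{\<mu>. wcomp v \<mu> \<noteq> 0}"
  have "wcomp (act x v) = (\<lambda>\<kappa>. act x (wcomp v (\<kappa> - \<nu>)))"
  proof (rule wcomp_eqI)
    show "act x (wcomp v (\<kappa> - \<nu>)) \<in> Vw \<kappa>" for \<kappa>
      using act_weight[OF assms wcomp(1), of v "\<kappa> - \<nu>"] by simp
    show "finite ((+) \<nu> ` ?S)" using wcomp(2) by simp
    show "act x (wcomp v (\<kappa> - \<nu>)) = 0" if "\<kappa> \<notin> (+) \<nu> ` ?S" for \<kappa>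
    proof -
      have "wcomp v (\<kappa> - \<nu>) = 0" using that by (force simp: image_iff)
      then show ?thesis by simp
    qed
    have "act x v = act x (\<Sum>\<mu>\<in>?S. wcomp v \<mu>)" by (simp only: wcomp(3))
    also have "\<dots> = (\<Sum>\<kappa>\<in>(+) \<nu> ` ?S. act x (wcomp v (\<kappa> - \<nu>)))"
      by (subst sum.reindex) (simp_all add: act_sum_right)
    finally show "act x v = \<dots>" .
  qed
  then show ?thesis by simp
qed

lemma wcomp_span:
  assumes S: "\<And>s. s \<in> S \<Longrightarrow> \<exists>\<nu>. s \<in> Vw \<nu>" and z: "z \<in> V.span S"
  shows "wcomp z \<mu> \<in> V.span (S \<inter> Vw \<mu>)"
  using z
proof (induction rule: V.span_induct_alt)
  case base
  then show ?case using wcomp_weight[of 0 0] V.subspace_0[OF Vw_subspace] V.span_zero by simp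
next
  case (step c x y)
  have "wcomp x \<mu> \<in> V.span (S \<inter> Vw \<mu>)"
  proof -
    obtain \<nu> where "x \<in> Vw \<nu>" using S step by blast
    then show ?thesis using step wcomp_weight[of x \<nu>] V.span_zero by (auto intro: V.span_base)
  qed
  then show ?case using step by (simp add: wcomp_add wcomp_scale V.span_add V.span_scale)
qed

lemma span_weight:
  assumes S: "\<And>s. s \<in> S \<Longrightarrow> \<exists>\<nu>. s \<in> Vw \<nu>" and z: "z \<in> V.span S" "z \<in> Vw \<mu>"
  shows "z \<in> V.span (S \<inter> Vw \<mu>)"
proof -
  have "wcomp z \<mu> \<in> V.span (S \<inter> Vw \<mu>)" using S z(1) by (rule wcomp_span)
  then show ?thesis by (simp add: wcomp_weight[OF z(2)])
qed

text \<open>\<open>word \<sigma> u\<close> applies the generators indexed by the list \<open>u\<close>, last letter first.\<close>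
definition word :: "bool \<Rightarrow> 'i list \<Rightarrow> 'v \<Rightarrow> 'v" where
  "word \<sigma> u v = foldr (\<lambda>i. act (chev \<sigma> i)) u v"

definition wsum :: "'i list \<Rightarrow> 'y" where
  "wsum u = (\<Sum>i\<leftarrow>u. coroot (simple i))"

lemma word_Nil [simp]: "word \<sigma> [] v = v" and word_Cons [simp]: "word \<sigma> (i # u) v = act (chev \<sigma> i) (word \<sigma> u v)"
  by (simp_all add: word_def)

lemma wsum_Nil [simp]: "wsum [] = 0" and wsum_Cons [simp]: "wsum (i # u) = coroot (simple i) + wsum u"
  by (simp_all add: wsum_def)

lemma word_scale: "word \<sigma> u (scaleV c v) = scaleV c (word \<sigma> u v)"
  by (induction u) (simp_all only: word_Nil word_Cons act_scale_right)

lemma word_zero [simp]: "word \<sigma> u 0 = 0"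
  by (induction u) simp_all

lemma word_sum: "word \<sigma> u (\<Sum>a\<in>A. f a) = (\<Sum>a\<in>A. word \<sigma> u (f a))"
  by (induction u) (simp_all only: word_Nil word_Cons act_sum_right)

lemma word_weight:
  "set u \<subseteq> I \<Longrightarrow> v \<in> Vw \<mu> \<Longrightarrow> word \<sigma> u v \<in> Vw (\<mu> + signed \<sigma> (wsum u))"
proof (induction u)
  case (Cons i u)
  then have "i \<in> I" "word \<sigma> u v \<in> Vw (\<mu> + signed \<sigma> (wsum u))" by simp_all
  from act_weight[OF chev_weight[OF this(1), of \<sigma>] this(2)]
  show ?case by (simp add: signed_add add.left_commute)
qed (simp add: signed_def)

lemma level_wsum: "set u \<subseteq> I \<Longrightarrow> level (wsum u) \<ge> int (length u)"
proof (induction u)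
  case (Cons i u)
  then show ?case using level_pos[OF simple_Rpos[of i]] by (simp add: level_add)
qed simp

text \<open>The orbit of \<open>v\<close> lies in a finite-dimensional space, in which only finitely
  many weights occur, while a word of length n shifts the level by at least n.\<close>

lemma word_nilpotent_weight:
  assumes v: "v \<in> Vw \<mu>"
  shows "\<exists>N. \<forall>u. set u \<subseteq> I \<longrightarrow> length u \<ge> N \<longrightarrow> word \<sigma> u v = 0"
proof -
  obtain S where S: "finite S" "V.span S = enveloping_orbit scaleV act v"
    using locally_finite unfolding locally_finite_def by blast
  define \<Omega> where "\<Omega> = (\<Union>s\<in>S. {\<nu>. wcomp s \<nu> \<noteq> 0})"
  have fin: "finite \<Omega>" using S(1) wcomp(2) by (simp add: \<Omega>_def)
  have \<Omega>: "\<nu> \<in> \<Omega>" if y: "y \<in> V.span S" "y \<in> Vw \<nu>" "y \<noteq> 0" for y \<nu>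
  proof (rule ccontr)
    assume "\<nu> \<notin> \<Omega>"
    then have zero: "wcomp s \<nu> = 0" if "s \<in> S" for s using that by (auto simp: \<Omega>_def)
    have "wcomp y \<nu> = 0" using y(1)
    proof (induction rule: V.span_induct_alt)
      case base
      then show ?case using wcomp_scale[of 0 0] by simp
    qed (simp add: wcomp_add wcomp_scale zero)
    then show False using wcomp_weight[OF y(2)] y(3) by simp
  qed
  have orbit: "word \<sigma> u v \<in> V.span S" for u
  proof -
    have "word \<sigma> u v = foldr act (map (chev \<sigma>) u) v" by (simp add: word_def foldr_map o_def)
    then show ?thesis unfolding S(2) enveloping_orbit_def by (auto intro: V.span_base)
  qed
  \<comment> \<open>The largest level shift that stays among the weights of the orbit;
    \<open>insert 0\<close> covers the case of no weights at all.\<close>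
  define M where "M = Max (insert 0 ((\<lambda>\<nu>. \<bar>level \<nu> - level \<mu>\<bar>) ` \<Omega>))"
  have "word \<sigma> u v = 0" if u: "set u \<subseteq> I" "length u \<ge> nat M + 1" for u
  proof (rule ccontr)
    assume "word \<sigma> u v \<noteq> 0"
    then have "\<mu> + signed \<sigma> (wsum u) \<in> \<Omega>" using \<Omega> orbit word_weight[OF u(1) v] by blast
    then have "\<bar>level (\<mu> + signed \<sigma> (wsum u)) - level \<mu>\<bar> \<le> M"
      unfolding M_def using fin by (intro Max_ge) auto
    then have "\<bar>level (wsum u)\<bar> \<le> M" by (auto simp: level_add level_minus level_diff signed_def split: if_splits)
    then show False using level_wsum[OF u(1)] u(2) by linarith
  qed
  then show ?thesis by blast
qed

lemma word_nilpotent: "\<exists>N. \<forall>u. set u \<subseteq> I \<longrightarrow> length u \<ge> N \<longrightarrow> word \<sigma> u v = 0"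
proof -
  let ?S = "{\<mu>. wcomp v \<mu> \<noteq> 0}"
  obtain N where N: "\<And>\<mu> u. set u \<subseteq> I \<Longrightarrow> length u \<ge> N \<mu> \<Longrightarrow> word \<sigma> u (wcomp v \<mu>) = 0"
    using word_nilpotent_weight[OF wcomp(1)[of v], where \<sigma> = \<sigma>] by metis
  have "word \<sigma> u v = 0" if u: "set u \<subseteq> I" "length u \<ge> (\<Sum>\<mu>\<in>?S. N \<mu>)" for u
  proof -
    have "word \<sigma> u v = word \<sigma> u (\<Sum>\<mu>\<in>?S. wcomp v \<mu>)" by (simp only: wcomp(3))
    also have "\<dots> = (\<Sum>\<mu>\<in>?S. word \<sigma> u (wcomp v \<mu>))" by (rule word_sum)
    also have "\<dots> = 0"
    proof (rule sum.neutral, rule ballI)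
      fix \<mu> assume "\<mu> \<in> ?S"
      then have "N \<mu> \<le> (\<Sum>\<mu>\<in>?S. N \<mu>)" using wcomp(2)[of v] by (intro member_le_sum) auto
      then show "word \<sigma> u (wcomp v \<mu>) = 0" using u by (intro N) auto
    qed
    finally show ?thesis .
  qed
  then show ?thesis by blast
qed

section \<open>Highest weight vectors and vectors extremal modulo a subspace\<close>

definition hw_space :: "'v set" where "hw_space = {v. \<forall>i\<in>I. act (chev True i) v = 0}"

definition hw :: "'y \<Rightarrow> 'v set" where "hw \<zeta> = hw_space \<inter> Vw \<zeta>"

lemma hw_subspace: "V.subspace (hw \<zeta>)" and hw_space_subspace: "V.subspace hw_space"
proof -
  show *: "V.subspace hw_space"
    by (rule V.subspaceI) (auto simp: hw_space_def act_add_right act_scale_right)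
  show "V.subspace (hw \<zeta>)" unfolding hw_def by (intro V.subspace_inter * Vw_subspace)
qed

lemma wcomp_hw: "v \<in> hw_space \<Longrightarrow> wcomp v \<mu> \<in> hw \<mu>"
proof -
  assume v: "v \<in> hw_space"
  have "act (chev True i) (wcomp v \<mu>) = 0" if "i \<in> I" for i
    using wcomp_act[OF chev_weight[OF that, of True], of v \<mu>] v that wcomp_scale[of 0 0]
    by (simp add: hw_space_def)
  then show ?thesis using wcomp(1) by (simp add: hw_def hw_space_def)
qed

text \<open>Take a longest word that keeps \<open>v\<close> outside \<open>W\<close>; nilpotency of
  long words bounds the length.\<close>

lemma exists_extremal:
  assumes W: "V.subspace W" and v: "v \<notin> W"
  shows "\<exists>u. set u \<subseteq> I \<and> word True u v \<notin> W \<and> (\<forall>i\<in>I. act (chev True i) (word True u v) \<in> W)"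
proof -
  obtain N where N: "\<And>u. set u \<subseteq> I \<Longrightarrow> length u \<ge> N \<Longrightarrow> word True u v = 0"
    using word_nilpotent[of True v] by blast
  define P where "P n = (\<exists>u. set u \<subseteq> I \<and> length u = n \<and> word True u v \<notin> W)" for n
  have P0: "P 0" using v by (auto simp: P_def)
  have bound: "n \<le> N" if "P n" for n
    using that N V.subspace_0[OF W] unfolding P_def by (metis linorder_le_cases)
  define n where "n = (GREATEST n. P n)"
  have "P n" unfolding n_def by (rule GreatestI_nat[where P = P and b = N, OF P0 bound])
  then obtain u where u: "set u \<subseteq> I" "length u = n" "word True u v \<notin> W" by (auto simp: P_def)
  have "act (chev True i) (word True u v) \<in> W" if "i \<in> I" for i
  proof (rule ccontr)
    assume "act (chev True i) (word True u v) \<notin> W"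
    then have "P (Suc n)" unfolding P_def using u that by (intro exI[of _ "i # u"]) auto
    then have "Suc n \<le> n" unfolding n_def by (rule Greatest_le_nat[where P = P and b = N, OF _ bound])
    then show False by simp
  qed
  then show ?thesis using u by blast
qed

lemma weight_dominant:
  assumes i: "i \<in> I" and v: "v \<in> Vw \<mu>" "v \<notin> W" "\<And>i. i \<in> I \<Longrightarrow> act (chev True i) v \<in> W"
    and W: "V.subspace W" "\<And>\<tau> i w. i \<in> I \<Longrightarrow> w \<in> W \<Longrightarrow> act (chev \<tau> i) w \<in> W"
  shows "pairing (simple i) \<mu> \<ge> 0"
proof -
  obtain N where N: "\<And>u. set u \<subseteq> I \<Longrightarrow> length u \<ge> N \<Longrightarrow> word False u v = 0"
    using word_nilpotent[of False v] by blast
  have "(act (chev False i) ^^ N) v = word False (replicate N i) v" by (simp add: word_def foldr_replicate)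
  also have "\<dots> = 0" using i by (intro N) auto
  finally have "signed True (pairing (simple i) \<mu>) \<ge> 0"
    using v W i by (intro weight_nonneg[where W = W and n = N]) (auto simp: V.subspace_0)
  then show ?thesis by (simp add: signed_def)
qed

lemma hw_dominant:
  assumes "v \<in> hw \<mu>" "v \<noteq> 0" "i \<in> I" shows "pairing (simple i) \<mu> \<ge> 0"
  using assms by (intro weight_dominant[where W = "{0}" and v = v]) (auto simp: hw_def hw_space_def V.subspace_single_0)

section \<open>Casimir eigenvalues along words\<close>

definition wform :: "'i list \<Rightarrow> 'y \<Rightarrow> real" where
  "wform u \<nu> = (\<Sum>i\<leftarrow>u. chev_const i * pairing (simple i) \<nu>)"

text \<open>Since \<open>chev_const i\<close> times the pairing with \<open>simple i\<close> is the
  inner product with the i-th simple coroot, \<open>wform u\<close> is the inner product with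
  \<beta> = \<open>wsum u\<close>. Twice \<open>chev_const i\<close> is the inner product of that
  coroot with 2\<rho>. So the value is (\<beta>, \<zeta>+\<mu>+2\<rho>)/2, which for \<mu> =
  \<zeta>-\<beta> is (|\<zeta>+\<rho>|^2 - |\<mu>+\<rho>|^2)/2.\<close>

definition casimir_eig :: "'i list \<Rightarrow> 'y \<Rightarrow> 'y \<Rightarrow> real" where
  "casimir_eig u \<zeta> \<mu> = (wform u \<zeta> + wform u \<mu> + (\<Sum>i\<leftarrow>u. 2 * chev_const i)) / 2"

lemma wform_add: "wform u (\<nu> + \<kappa>) = wform u \<nu> + wform u \<kappa>"
  by (induction u) (simp_all add: wform_def pairing_add_right algebra_simps)

lemma wform_diff: "wform u (\<nu> - \<kappa>) = wform u \<nu> - wform u \<kappa>"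
  using wform_add[of u "\<nu> - \<kappa>" \<kappa>] by simp

lemma wform_simple:
  "i \<in> I \<Longrightarrow> set u \<subseteq> I \<Longrightarrow> wform u (coroot (simple i)) = chev_const i * pairing (simple i) (wsum u)"
  using chev_const_symmetric[of i]
  by (induction u) (auto simp: wform_def pairing_add_right distrib_left)

lemma wform_Cons: "wform (i # u) \<nu> = chev_const i * pairing (simple i) \<nu> + wform u \<nu>"
  by (simp add: wform_def)

text \<open>Dominance makes the first two terms nonnegative; the term coming from 2\<rho> is
  strictly positive because the word is nonempty.\<close>

lemma casimir_eig_pos:
  assumes u: "set u \<subseteq> I" "u \<noteq> []" and "\<And>i. i \<in> I \<Longrightarrow> pairing (simple i) \<zeta> \<ge> 0" "\<And>i. i \<in> I \<Longrightarrow> pairing (simple i) \<mu> \<ge> 0"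
  shows "casimir_eig u \<zeta> \<mu> > 0"
proof -
  have nonneg: "wform u \<nu> \<ge> 0" if "\<And>i. i \<in> I \<Longrightarrow> pairing (simple i) \<nu> \<ge> 0" for \<nu>
    unfolding wform_def using u(1) that chev_const_pos by (intro sum_list_nonneg) (auto simp: less_imp_le)
  have "(\<Sum>i\<leftarrow>u. 2 * chev_const i) > 0"
  proof -
    obtain i u' where iu: "u = i # u'" using u(2) by (cases u) auto
    have "(\<Sum>i\<leftarrow>u'. 2 * chev_const i) \<ge> 0" using u(1) chev_const_pos iu by (intro sum_list_nonneg) (auto simp: less_imp_le)
    then show ?thesis using chev_const_pos[of i] u(1) iu by simp
  qed
  then show ?thesis using nonneg[OF assms(3)] nonneg[OF assms(4)] by (simp add: casimir_eig_def)
qed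

lemma casimir_add: "casimir (v + w) = casimir v + casimir w"
  and casimir_scale: "casimir (scaleV c v) = scaleV c (casimir v)"
  and casimir_diff: "casimir (v - w) = casimir v - casimir w"
  and casimir_zero [simp]: "casimir 0 = 0"
proof -
  interpret w: Vector_Spaces.linear scaleV scaleV casimir by (rule casimir_linear)
  show "casimir (v + w) = casimir v + casimir w" by (rule w.add)
  show "casimir (scaleV c v) = scaleV c (casimir v)" by (rule w.scale)
  show "casimir (v - w) = casimir v - casimir w" by (rule w.diff)
  show "casimir 0 = 0" by (rule w.zero)
qed

lemma casimir_lower_word:
  assumes "set u \<subseteq> I" "v \<in> Vw \<zeta>" "casimir v = 0"
  shows "casimir (word False u v) = scaleV (of_real (casimir_eig u \<zeta> (\<zeta> - wsum u))) (word False u v)"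
  using assms(1)
proof (induction u)
  case Nil
  then show ?case using assms(3) by (simp add: casimir_eig_def wform_def)
next
  case (Cons i u)
  then have i: "i \<in> I" and u: "set u \<subseteq> I" by auto
  have wt: "word False u v \<in> Vw (\<zeta> - wsum u)"
    using word_weight[OF u assms(2), of False] by (simp add: signed_def)
  \<comment> \<open>The new term \<open>2 * chev_const i\<close> cancels the pairing of the new
    coroot with itself, and by \<open>wform_simple\<close> the two cross terms with
    \<open>wsum u\<close> agree.\<close>
  have "casimir_eig (i # u) \<zeta> (\<zeta> - wsum (i # u)) = casimir_eig u \<zeta> (\<zeta> - wsum u) + chev_const i * pairing (simple i) (\<zeta> - wsum u)"
    using wform_simple[OF i u] pairing_simple[OF i]
    by (simp add: casimir_eig_def wform_Cons wform_diff wform_add pairing_diff_right pairing_add_right field_simps)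
  then show ?case
    using Cons.IH[OF u] act_h[OF wt, of "simple i"]
    by (simp add: casimir_lower[OF i] act_scale_right V.scale_left_distrib)
qed

text \<open>Nothing is assumed about \<open>casimir v\<close>. If a raising word kills
  \<open>casimir v\<close> and takes \<open>v\<close> to a highest weight vector, the equation
  leaves the eigenvalue times that vector equal to zero.\<close>

lemma casimir_raise_word:
  assumes "set u \<subseteq> I" "v \<in> Vw \<mu>"
  shows "casimir (word True u v) = word True u (casimir v) - scaleV (of_real (casimir_eig u \<mu> (\<mu> + wsum u))) (word True u v)"
  using assms(1)
proof (induction u)
  case Nil
  then show ?case by (simp add: casimir_eig_def wform_def)
next
  case (Cons i u)
  then have i: "i \<in> I" and u: "set u \<subseteq> I" by auto
  have wt: "word True (i # u) v \<in> Vw (\<mu> + wsum (i # u))"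
    using word_weight[OF Cons.prems assms(2), of True] by (simp add: signed_def)
  have "casimir_eig (i # u) \<mu> (\<mu> + wsum (i # u)) = casimir_eig u \<mu> (\<mu> + wsum u) + chev_const i * pairing (simple i) (\<mu> + wsum (i # u))"
    using wform_simple[OF i u] pairing_simple[OF i]
    by (simp add: casimir_eig_def wform_Cons wform_add pairing_add_right field_simps)
  then show ?case
    using act_h[OF wt, of "simple i"]
    by (simp add: casimir_raise[OF i] Cons.IH[OF u] act_scale_right act_diff_right V.scale_left_distrib algebra_simps)
qed

text \<open>The annihilator of \<open>v\<close> contains all e_i and is closed under bracketing with
  them, so it contains every positive root vector.\<close>

lemma casimir_hw: "v \<in> hw_space \<Longrightarrow> casimir v = 0"
proof -
  assume v: "v \<in> hw_space"
  have "rvec True \<gamma> \<in> {x. act x v = 0}" if "\<gamma> \<in> Rpos" for \<gamma>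
  proof (rule root_vectors_generated[OF _ _ _ that])
    show "subspace {x. act x v = 0}" by (rule subspaceI) (auto simp: act_add_left act_scale_left)
  qed (use v in \<open>auto simp: act_bracket hw_space_def\<close>)
  then show ?thesis by (simp add: casimir_def)
qed

text \<open>Nonempty words only: the span is meant as a complement of V^+. It meets V^+ in zero by
  \<open>lowered_hw_zero\<close>, and together with V^+ it spans what \<open>generated\<close>
  spans.\<close>

definition lowered :: "'v set" where
  "lowered = {word False u x | u x \<zeta>. set u \<subseteq> I \<and> u \<noteq> [] \<and> x \<in> hw \<zeta>}"

definition generated :: "'v set" where
  "generated = {word False u x | u x \<zeta>. set u \<subseteq> I \<and> x \<in> hw \<zeta>}"

lemma word_generated: "set u \<subseteq> I \<Longrightarrow> x \<in> hw \<zeta> \<Longrightarrow> word False u x \<in> generated"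
  by (auto simp: generated_def)

lemma generated_homogeneous: "s \<in> generated \<Longrightarrow> \<exists>\<nu>. s \<in> Vw \<nu>"
  unfolding generated_def using word_weight by (fastforce simp: hw_def)

lemma lowered_subset: "lowered \<subseteq> generated"
  by (auto simp: lowered_def generated_def)

lemma lowered_homogeneous: "s \<in> lowered \<Longrightarrow> \<exists>\<nu>. s \<in> Vw \<nu>"
  using generated_homogeneous lowered_subset by auto

text \<open>A raising generator is moved rightwards through a lowering word. Each exchange costs at
  most a multiple of a shorter word, because the bracket is zero or h_i acting on a weight vector;
  at the end the generator kills the highest weight vector.\<close>

lemma act_chev_generated:
  assumes i: "i \<in> I" and v: "v \<in> V.span generated" shows "act (chev \<sigma> i) v \<in> V.span generated"
  using v
proof (induction rule: V.span_induct_alt)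
  case base
  then show ?case by (simp add: V.span_zero)
next
  case (step c x y)
  obtain u z \<zeta> where x: "x = word False u z" "set u \<subseteq> I" "z \<in> hw \<zeta>" using step(1) by (auto simp: generated_def)
  have words: "word False u z \<in> V.span generated" if "set u \<subseteq> I" for u
    using that x(3) by (intro V.span_base word_generated)
  have "act (chev \<sigma> i) (word False u z) \<in> V.span generated"
  proof (cases \<sigma>)
    case False
    then show ?thesis using words[of "i # u"] x i by simp
  next
    case True
    have "act (chev True i) (word False u z) \<in> V.span generated" using x(2)
    proof (induction u)
      case Nil
      then show ?case using x i by (simp add: hw_def hw_space_def V.span_zero)
    next
      case (Cons j u)
      then have j: "j \<in> I" and u: "set u \<subseteq> I" by auto
      have f: "act (chev False j) y \<in> V.span generated" if "y \<in> V.span generated" for y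
        using that
      proof (induction rule: V.span_induct_alt)
        case base
        then show ?case by (simp add: V.span_zero)
      next
        case (step c s y)
        then obtain u' z' \<zeta>' where s: "s = word False u' z'" "set u' \<subseteq> I" "z' \<in> hw \<zeta>'" by (auto simp: generated_def)
        have "word False (j # u') z' \<in> V.span generated"
          using s j by (intro V.span_base word_generated[OF _ s(3)]) auto
        then show ?case using step s by (simp add: act_add_right act_scale_right V.span_add V.span_scale)
      qed
      have "act (bracket (chev True i) (chev False j)) (word False u z) \<in> V.span generated"
      proof (cases "i = j")
        case True
        have "word False u z \<in> Vw (\<zeta> - wsum u)" using word_weight[OF u, of z \<zeta> False] x(3) by (simp add: hw_def signed_def)
        then show ?thesis using True chev_bracket[OF i, of True] words[OF u] by (simp add: signed_def act_h V.span_scale)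
      next
        case False
        then show ?thesis using bracket_chev_distinct[OF i j] by (simp add: V.span_zero)
      qed
      then show ?case using f[OF Cons.IH[OF u]] act_act[of "chev True i"] by (simp add: V.span_add)
    qed
    then show ?thesis using True by simp
  qed
  then show ?case using step x by (simp add: act_add_right act_scale_right V.span_add V.span_scale)
qed

text \<open>Spanning vectors of a space on which the Casimir operator is bijective; the eigenvalue
  may differ from vector to vector.\<close>

definition pos_eigen :: "'y \<Rightarrow> 'v set" where
  "pos_eigen \<mu> = {y \<in> lowered \<inter> Vw \<mu>. \<exists>\<theta>>0. casimir y = scaleV (of_real \<theta>) y}"

text \<open>The source weight of a nonzero lowered word is automatically dominant, as the weight of
  a nonzero highest weight vector. Only dominance of the target has to be assumed.\<close>

lemma lowered_pos_eigen:
  assumes "\<And>i. i \<in> I \<Longrightarrow> pairing (simple i) \<mu> \<ge> 0"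
  shows "lowered \<inter> Vw \<mu> \<subseteq> pos_eigen \<mu>"
proof
  fix y assume y: "y \<in> lowered \<inter> Vw \<mu>"
  show "y \<in> pos_eigen \<mu>"
  proof (cases "y = 0")
    case True
    \<comment> \<open>The zero vector is an eigenvector for every eigenvalue; 1 serves as a positive
      one.\<close>
    then show ?thesis using y by (auto simp: pos_eigen_def intro!: exI[of _ 1])
  next
    case False
    obtain u x \<zeta> where x: "y = word False u x" "set u \<subseteq> I" "u \<noteq> []" "x \<in> hw \<zeta>" using y by (auto simp: lowered_def)
    have "x \<noteq> 0" using x False by auto
    have "y \<in> Vw (\<zeta> - wsum u)" using word_weight[OF x(2), of x \<zeta> False] x by (simp add: hw_def signed_def)
    then have \<mu>: "\<mu> = \<zeta> - wsum u" using Vw_unique y False by blast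
    have "casimir y = scaleV (of_real (casimir_eig u \<zeta> \<mu>)) y"
      unfolding x(1) \<mu> using x casimir_hw by (intro casimir_lower_word) (auto simp: hw_def)
    moreover have "casimir_eig u \<zeta> \<mu> > 0" using x hw_dominant[OF x(4) \<open>x \<noteq> 0\<close>] assms by (intro casimir_eig_pos) auto
    ultimately show ?thesis using y by (auto simp: pos_eigen_def)
  qed
qed

lemma span_pos_eigen_kernel:
  assumes "z \<in> V.span (pos_eigen \<mu>)" "casimir z = 0" shows "z = 0"
proof -
  obtain T a where T: "finite T" "T \<subseteq> pos_eigen \<mu>" "z = (\<Sum>y\<in>T. scaleV (a y) y)"
    using assms(1) unfolding V.span_explicit by auto
  have "\<forall>y\<in>T. \<exists>\<theta>::real. \<theta> > 0 \<and> casimir y = scaleV (of_real \<theta>) y"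
    using T(2) by (auto simp: pos_eigen_def)
  from bchoice[OF this] obtain \<theta> :: "'v \<Rightarrow> real"
    where \<theta>: "\<And>y. y \<in> T \<Longrightarrow> \<theta> y > 0 \<and> casimir y = scaleV (of_real (\<theta> y)) y" by blast
  have "(\<Sum>y\<in>T. scaleV (a y) y) = 0"
    by (rule sum_eigenvectors_in_kernel[OF casimir_linear T(1), where \<theta> = "\<lambda>y. of_real (\<theta> y)"])
      (use \<theta> assms(2) T(3) in \<open>force simp: casimir_scale mult.commute\<close>)+
  then show ?thesis using T(3) by simp
qed

lemma span_pos_eigen_invert:
  assumes "z \<in> V.span (pos_eigen \<mu>)"
  shows "\<exists>z'\<in>V.span (pos_eigen \<mu>). casimir z' = z"
  using assms
proof (induction rule: V.span_induct_alt)
  case base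
  then show ?case using V.span_zero casimir_zero by blast
next
  case (step c x y)
  then obtain \<theta> :: real where \<theta>: "\<theta> > 0" "casimir x = scaleV (of_real \<theta>) x" by (auto simp: pos_eigen_def)
  from step obtain z' where z': "z' \<in> V.span (pos_eigen \<mu>)" "casimir z' = y" by blast
  have "casimir (scaleV (c / of_real \<theta>) x + z') = scaleV c x + y"
    using \<theta> z' by (simp add: casimir_add casimir_scale)
  moreover have "scaleV (c / of_real \<theta>) x + z' \<in> V.span (pos_eigen \<mu>)"
    by (rule V.span_add[OF V.span_scale[OF V.span_base[OF step(1)]] z'(1)])
  ultimately show ?case by blast
qed

text \<open>Each nonzero weight component of \<open>v\<close> is again a highest weight vector, so
  its weight is dominant and it lies in the span of \<open>pos_eigen\<close>. There the Casimir
  operator is injective, yet it kills the component.\<close>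

lemma lowered_hw_zero:
  assumes "v \<in> V.span lowered" "v \<in> hw_space" shows "v = 0"
proof -
  have "wcomp v \<mu> = 0" for \<mu>
  proof (rule ccontr)
    assume ne: "wcomp v \<mu> \<noteq> 0"
    have hw: "wcomp v \<mu> \<in> hw \<mu>" using assms(2) by (rule wcomp_hw)
    have "wcomp v \<mu> \<in> V.span (lowered \<inter> Vw \<mu>)" using lowered_homogeneous assms(1) by (rule wcomp_span)
    then have "wcomp v \<mu> \<in> V.span (pos_eigen \<mu>)"
      using V.span_mono[OF lowered_pos_eigen] hw_dominant[OF hw ne] by blast
    then show False using span_pos_eigen_kernel ne casimir_hw hw by (auto simp: hw_def)
  qed
  then show ?thesis using wcomp(3)[of v] by simp
qed

text \<open>A vector \<open>z\<close> extremal modulo the submodule generated by the highest weight vectors can be corrected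
  inside that submodule so that its Casimir image becomes a highest weight vector.  The Casimir
  shift then rules out any highest weight vector above it, so the correction is itself extremal.\<close>
lemma generated_span: "V.span generated = UNIV"
proof (rule ccontr)
  let ?W = "V.span generated"
  assume "?W \<noteq> UNIV"
  then obtain v where v: "v \<notin> ?W" by auto
  obtain \<mu>0 where \<mu>0: "wcomp v \<mu>0 \<notin> ?W"
    using v wcomp(3)[of v] V.span_sum by metis
  from exists_extremal[OF V.subspace_span \<mu>0] obtain u where
    u: "set u \<subseteq> I" "word True u (wcomp v \<mu>0) \<notin> ?W" "\<forall>i\<in>I. act (chev True i) (word True u (wcomp v \<mu>0)) \<in> ?W"
    by blast
  define z where "z = word True u (wcomp v \<mu>0)"
  define \<mu> where "\<mu> = \<mu>0 + wsum u"
  have z: "z \<in> Vw \<mu>" "z \<notin> ?W" "\<And>i. i \<in> I \<Longrightarrow> act (chev True i) z \<in> ?W"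
    using u word_weight[OF u(1) wcomp(1)[of v \<mu>0], of True] by (auto simp: z_def \<mu>_def signed_def)
  have dom: "pairing (simple i) \<mu> \<ge> 0" if "i \<in> I" for i
    using weight_dominant[OF that z V.subspace_span act_chev_generated] .
  have hwW: "hw \<mu> \<subseteq> ?W" for \<mu>
    using V.span_base[of _ generated] by (force simp: generated_def intro!: exI[of _ "[]"])
  have x: "act (rvec True \<gamma>) z \<in> ?W" if "\<gamma> \<in> Rpos" for \<gamma>
  proof -
    \<comment> \<open>The second condition is what makes the set stable under brackets with e_i:
      expanding the bracket applies x to e_i z, of which only membership in \<open>?W\<close> is
      known.\<close>
    have "rvec True \<gamma> \<in> {x. act x z \<in> ?W \<and> (\<forall>w\<in>?W. act x w \<in> ?W)}"
    proof (rule root_vectors_generated[OF _ _ _ that])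
      show "subspace {x. act x z \<in> ?W \<and> (\<forall>w\<in>?W. act x w \<in> ?W)}"
        by (rule subspaceI) (auto simp: act_add_left act_scale_left V.span_zero V.span_add V.span_scale)
    qed (use z(3) act_chev_generated in \<open>auto simp: act_bracket V.span_diff\<close>)
    then show ?thesis by simp
  qed
  have y: "act (rvec False \<gamma>) w \<in> ?W" if "\<gamma> \<in> Rpos" "w \<in> ?W" for \<gamma> w
  proof -
    have "rvec False \<gamma> \<in> {x. \<forall>w\<in>?W. act x w \<in> ?W}"
    proof (rule root_vectors_generated[OF _ _ _ that(1)])
      show "subspace {x. \<forall>w\<in>?W. act x w \<in> ?W}"
        by (rule subspaceI) (auto simp: act_add_left act_scale_left V.span_zero V.span_add V.span_scale)
    qed (use act_chev_generated in \<open>auto simp: act_bracket V.span_diff\<close>)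
    then show ?thesis using that(2) by simp
  qed
  have "casimir z \<in> ?W" unfolding casimir_def using x y by (intro V.span_sum) auto
  then have "casimir z \<in> V.span (generated \<inter> Vw \<mu>)"
    using casimir_weight[OF z(1)] generated_homogeneous by (intro span_weight)
  moreover have "generated \<inter> Vw \<mu> \<subseteq> hw \<mu> \<union> pos_eigen \<mu>"
  proof
    fix s assume s: "s \<in> generated \<inter> Vw \<mu>"
    then obtain u x \<zeta> where x: "s = word False u x" "set u \<subseteq> I" "x \<in> hw \<zeta>" by (auto simp: generated_def)
    show "s \<in> hw \<mu> \<union> pos_eigen \<mu>"
    proof (cases "u = []")
      case True
      then show ?thesis using x s by (auto simp: hw_def)
    next
      case False
      then have "s \<in> lowered \<inter> Vw \<mu>" using x s by (auto simp: lowered_def)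
      then show ?thesis using lowered_pos_eigen dom by blast
    qed
  qed
  ultimately have "casimir z \<in> V.span (hw \<mu> \<union> pos_eigen \<mu>)" using V.span_mono by blast
  \<comment> \<open>The Casimir operator vanishes on the first summand and is invertible on the
    second, so only \<open>q\<close> can be removed by a correction.\<close>
  then obtain y0 q where y0: "y0 \<in> hw \<mu>" and q: "q \<in> V.span (pos_eigen \<mu>)" and zq: "casimir z = y0 + q"
    unfolding V.span_Un V.span_eq_iff[THEN iffD2, OF hw_subspace[of \<mu>]] by blast
  from span_pos_eigen_invert[OF q] obtain q' where q': "q' \<in> V.span (pos_eigen \<mu>)" "casimir q' = q" by blast
  have "q' \<in> ?W" using q'(1) V.span_mono[of "pos_eigen \<mu>" generated] lowered_subset by (auto simp: pos_eigen_def)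
  have "q' \<in> Vw \<mu>" using q'(1) V.span_minimal[OF _ Vw_subspace, of "pos_eigen \<mu>" \<mu>] by (auto simp: pos_eigen_def)
  define z' where "z' = z - q'"
  have z': "z' \<in> Vw \<mu>" "z' \<notin> ?W" "casimir z' = y0"
    using z \<open>q' \<in> ?W\<close> \<open>q' \<in> Vw \<mu>\<close> zq q'(2) V.subspace_diff[OF Vw_subspace] V.span_add[of z' generated q']
    by (auto simp: z'_def casimir_diff)
  have "z' \<in> hw \<mu>"
  proof (rule ccontr)
    assume "z' \<notin> hw \<mu>"
    then obtain i where i: "i \<in> I" "act (chev True i) z' \<notin> {0}" using z'(1) by (auto simp: hw_def hw_space_def)
    from exists_extremal[OF V.subspace_single_0 i(2)] obtain u where
      u: "set u \<subseteq> I" "word True u (act (chev True i) z') \<noteq> 0"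
        "\<forall>j\<in>I. act (chev True j) (word True u (act (chev True i) z')) = 0" by auto
    define w where "w = u @ [i]"
    have w: "set w \<subseteq> I" "w \<noteq> []" "word True w z' = word True u (act (chev True i) z')"
      using u i by (auto simp: w_def word_def)
    define \<kappa> where "\<kappa> = \<mu> + wsum w"
    have hw: "word True w z' \<in> hw \<kappa>"
      using word_weight[OF w(1) z'(1), of True] u(3) w(3) by (simp add: \<kappa>_def hw_def hw_space_def signed_def)
    \<comment> \<open>The letter \<open>i\<close> acts first and kills \<open>y0\<close>. Hence
      raising \<open>z'\<close> by \<open>w\<close> commutes with the Casimir operator up to the
      positive shift alone, although the result is a highest weight vector.\<close>
    have "word True w y0 = 0" using y0 i by (simp add: w_def word_def hw_def hw_space_def, simp flip: word_def)
    then have "scaleV (of_real (casimir_eig w \<mu> \<kappa>)) (word True w z') = 0"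
      using casimir_raise_word[OF w(1) z'(1)] casimir_hw[of "word True w z'"] hw z'(3) by (simp add: \<kappa>_def hw_def)
    moreover have "casimir_eig w \<mu> \<kappa> > 0"
      using hw_dominant[OF hw] u(2) w(3) dom w by (intro casimir_eig_pos) auto
    ultimately show False using u(2) w(3) by simp
  qed
  then show False using z'(2) hwW by auto
qed

end

section \<open>Automorphisms with prescribed highest weight vectors\<close>

context locally_finite_dual_module
begin

text \<open>Operators which on the highest weight space \<open>hw \<zeta>\<close> agree with a fixed linear combination of
  lowering words, the same one for every vector of that space.\<close>
inductive lowering :: "'y \<Rightarrow> ('v \<Rightarrow> 'v) \<Rightarrow> bool" for \<zeta> where
  lowering_id: "(\<And>x. x \<in> hw \<zeta> \<Longrightarrow> T x = x) \<Longrightarrow> lowering \<zeta> T"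
| lowering_act: "i \<in> I \<Longrightarrow> lowering \<zeta> S \<Longrightarrow> (\<And>x. x \<in> hw \<zeta> \<Longrightarrow> T x = act (chev False i) (S x)) \<Longrightarrow> lowering \<zeta> T"
| lowering_add: "lowering \<zeta> S \<Longrightarrow> lowering \<zeta> S' \<Longrightarrow> (\<And>x. x \<in> hw \<zeta> \<Longrightarrow> T x = S x + S' x) \<Longrightarrow> lowering \<zeta> T"
| lowering_scale: "lowering \<zeta> S \<Longrightarrow> (\<And>x. x \<in> hw \<zeta> \<Longrightarrow> T x = scaleV c (S x)) \<Longrightarrow> lowering \<zeta> T"

text \<open>Commuting h past a lowering letter produces scalars that depend only on the letters and
  on \<zeta>; this is why the predicate refers to one fixed weight.\<close>

lemma lowering_h: "lowering \<zeta> T \<Longrightarrow> lowering \<zeta> (\<lambda>x. act (h \<chi>) (T x))"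
proof (induction rule: lowering.induct)
  case (lowering_id T)
  show ?case
    by (rule lowering.lowering_scale[OF lowering.lowering_id[of _ "\<lambda>x. x"], where c = "of_int (pairing \<chi> \<zeta>)"])
      (use lowering_id in \<open>auto simp: hw_def act_h\<close>)
next
  case (lowering_act i S T)
  have "act (h \<chi>) (act (chev False i) v)
      = act (chev False i) (act (h \<chi>) v) + scaleV (- of_int (pairing \<chi> (coroot (simple i)))) (act (chev False i) v)" for v
    using ad.act_h[OF chev_weight[OF lowering_act(1), of False], of \<chi>] act_act[of "h \<chi>" "chev False i" v]
    by (simp add: signed_def act_scale_left act_minus_left)
  then show ?case using lowering_act
    by (intro lowering.lowering_add[OF lowering.lowering_act[OF lowering_act(1) lowering_act(4)]
          lowering.lowering_scale[OF lowering.lowering_act[OF lowering_act(1,2)]],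
          where c1 = "- of_int (pairing \<chi> (coroot (simple i)))"]) auto
next
  case (lowering_add S S' T)
  show ?case by (rule lowering.lowering_add[OF lowering_add(4,5)]) (simp add: lowering_add(3) act_add_right)
next
  case (lowering_scale S T c)
  show ?case by (rule lowering.lowering_scale[OF lowering_scale(3), where c = c]) (simp add: lowering_scale(2) act_scale_right)
qed

text \<open>Raising generators are pushed to the right until they meet the highest weight vector.
  For equal indices the exchange leaves an h-term, which \<open>lowering_h\<close> absorbs.\<close>

lemma lowering_raise: "lowering \<zeta> T \<Longrightarrow> i \<in> I \<Longrightarrow> lowering \<zeta> (\<lambda>x. act (chev True i) (T x))"
proof (induction rule: lowering.induct)
  \<comment> \<open>Here e_i x = 0, so the operator is recorded as the zero multiple of the
    identity.\<close>
  case (lowering_id T)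
  show ?case
    by (rule lowering.lowering_scale[OF lowering.lowering_id[of _ "\<lambda>x. x"], where c = 0])
      (use lowering_id in \<open>auto simp: hw_def hw_space_def\<close>)
next
  case (lowering_act j S T)
  have IH: "lowering \<zeta> (\<lambda>x. act (chev False j) (act (chev True i) (S x)))"
    by (rule lowering.lowering_act[OF lowering_act(1) lowering_act(4)[OF lowering_act(5)]]) (rule refl)
  show ?case
  proof (cases "i = j")
    case True
    have eq: "act (chev True i) (act (chev False j) v) = act (chev False j) (act (chev True i) v) + act (h (simple i)) v" for v
      using act_act[of "chev True i" "chev False j" v] chev_bracket[OF lowering_act(5), of True] True
      by (simp add: signed_def add.commute)
    show ?thesis
      by (rule lowering.lowering_add[OF IH lowering_h[OF lowering_act(2), of "simple i"]])
        (simp add: lowering_act(3) eq)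
  next
    case False
    have eq: "act (chev True i) (act (chev False j) v) = act (chev False j) (act (chev True i) v)" for v
      using act_act[of "chev True i" "chev False j" v] bracket_chev_distinct[OF lowering_act(5,1) False] by simp
    show ?thesis
      by (rule lowering.lowering_act[OF lowering_act(1) lowering_act(4)[OF lowering_act(5)]])
        (simp add: lowering_act(3) eq)
  qed
next
  case (lowering_add S S' T)
  show ?case
    by (rule lowering.lowering_add[OF lowering_add(4,5)[OF lowering_add(6)]]) (simp add: lowering_add(3) act_add_right)
next
  case (lowering_scale S T c)
  show ?case
    by (rule lowering.lowering_scale[OF lowering_scale(3)[OF lowering_scale(4)], where c = c])
      (simp add: lowering_scale(2) act_scale_right)
qed

lemma act_lower_span_lowered: "i \<in> I \<Longrightarrow> act (chev False i) v \<in> V.span lowered"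
proof -
  assume i: "i \<in> I"
  have "v \<in> V.span generated" by (simp add: generated_span)
  then show ?thesis
  proof (induction rule: V.span_induct_alt)
    case base
    then show ?case by (simp add: V.span_zero)
  next
    case (step c s y)
    then obtain u z \<zeta> where s: "s = word False u z" "set u \<subseteq> I" "z \<in> hw \<zeta>" by (auto simp: generated_def)
    have "\<exists>u' x \<zeta>. word False (i # u) z = word False u' x \<and> set u' \<subseteq> I \<and> u' \<noteq> [] \<and> x \<in> hw \<zeta>"
      using i s by (intro exI[of _ "i # u"] exI[of _ z] exI[of _ \<zeta>]) auto
    then have "act (chev False i) s \<in> lowered" by (auto simp: lowered_def s)
    then show ?case using step by (simp add: act_add_right act_scale_right V.span_add V.span_scale V.span_base)
  qed
qed

text \<open>Modulo the complement \<open>lowered\<close>, such an operator is a scalar common to the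
  whole space \<open>hw \<zeta>\<close>. Applied to a raising word after a lowering word, this
  scalar plays the role of a Shapovalov pairing; its independence of the vector lets it pass through
  any weight-preserving map of V^+.\<close>

lemma lowering_scalar: "lowering \<zeta> T \<Longrightarrow> \<exists>c. \<forall>x\<in>hw \<zeta>. T x - scaleV c x \<in> V.span lowered"
proof (induction rule: lowering.induct)
  case (lowering_id T)
  then show ?case by (intro exI[of _ 1]) (simp add: V.span_zero)
next
  case (lowering_act i S T)
  then show ?case by (intro exI[of _ 0]) (simp add: act_lower_span_lowered)
next
  case (lowering_add S S' T)
  then obtain c c' where "\<forall>x\<in>hw \<zeta>. S x - scaleV c x \<in> V.span lowered" "\<forall>x\<in>hw \<zeta>. S' x - scaleV c' x \<in> V.span lowered"
    by blast
  then have "\<forall>x\<in>hw \<zeta>. (S x - scaleV c x) + (S' x - scaleV c' x) \<in> V.span lowered" by (simp add: V.span_add)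
  then show ?case
    by (intro exI[of _ "c + c'"]) (simp add: lowering_add(3) V.scale_left_distrib algebra_simps)
next
  case (lowering_scale S T c)
  then obtain c' where "\<forall>x\<in>hw \<zeta>. S x - scaleV c' x \<in> V.span lowered" by blast
  then have "\<forall>x\<in>hw \<zeta>. scaleV c (S x - scaleV c' x) \<in> V.span lowered" by (simp add: V.span_scale)
  then show ?case
    by (intro exI[of _ "c * c'"]) (simp add: lowering_scale(2) V.scale_right_diff_distrib)
qed

lemma lowering_word: "set u \<subseteq> I \<Longrightarrow> lowering \<zeta> (word False u)"
proof (induction u)
  case Nil
  show ?case by (rule lowering_id) simp
next
  case (Cons i u)
  then have "i \<in> I" "lowering \<zeta> (word False u)" by simp_all
  then show ?case by (rule lowering_act) simp
qed

lemma lowering_word_word: "set w \<subseteq> I \<Longrightarrow> set u \<subseteq> I \<Longrightarrow> lowering \<zeta> (\<lambda>x. word True w (word False u x))"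
proof (induction w)
  case Nil
  then show ?case using lowering_word[of u] by simp
next
  case (Cons i w)
  then show ?case using lowering_raise[of \<zeta> "\<lambda>x. word True w (word False u x)" i] by simp
qed

lemma word_word_scalar:
  "set w \<subseteq> I \<Longrightarrow> set u \<subseteq> I \<Longrightarrow>
    \<exists>c. \<forall>x\<in>hw \<zeta>. word True w (word False u x) - scaleV c x \<in> V.span lowered"
  by (rule lowering_scalar[OF lowering_word_word])

text \<open>The extension must send a lowering word on x to the same word on \<open>A0 x\<close>;
  the point is that linear relations survive. If the image of a relation were nonzero, raise it to a
  nonzero highest weight vector. Modulo \<open>lowered\<close>, raising replaces each word by a
  scalar times its highest weight vector, with the same scalars before and after applying
  \<open>A0\<close>. The original relation makes the resulting combination zero, so the raised image
  lies in \<open>lowered\<close> and in V^+, a contradiction.\<close>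

theorem highest_weight_extension:
  assumes A0: "Vector_Spaces.linear scaleV scaleV A0" and A0_hw: "\<And>\<zeta> x. x \<in> hw \<zeta> \<Longrightarrow> A0 x \<in> hw \<zeta>"
  obtains A where "Vector_Spaces.linear scaleV scaleV A" "\<And>\<zeta> x. x \<in> hw \<zeta> \<Longrightarrow> A x = A0 x"
    "\<And>\<mu> v. v \<in> Vw \<mu> \<Longrightarrow> A v \<in> Vw \<mu>"
    "\<And>\<sigma> i v. i \<in> I \<Longrightarrow> A (act (chev \<sigma> i) v) = act (chev \<sigma> i) (A v)"
proof -
  interpret A0: Vector_Spaces.linear scaleV scaleV A0 by fact
  define K where "K = {(u, x) | u x. set u \<subseteq> I \<and> (\<exists>\<zeta>. x \<in> hw \<zeta>)}"
  define p where "p = (\<lambda>(u, x). word False u x)"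
  define q where "q = (\<lambda>(u, x). word False u (A0 x))"
  have pK: "p ` K = generated"
  proof (intro equalityI subsetI)
    fix s assume "s \<in> p ` K"
    then show "s \<in> generated" by (auto simp: p_def K_def intro: word_generated)
  next
    fix s assume "s \<in> generated"
    then obtain u x \<zeta> where s: "s = word False u x" "set u \<subseteq> I" "x \<in> hw \<zeta>" by (auto simp: generated_def)
    then have "(u, x) \<in> K" by (auto simp: K_def)
    moreover have "s = p (u, x)" by (simp add: s p_def)
    ultimately show "s \<in> p ` K" by (rule rev_image_eqI)
  qed
  have rel: "(\<Sum>k\<in>T. scaleV (a k) (q k)) = 0"
    if T: "finite T" "T \<subseteq> K" and p0: "(\<Sum>k\<in>T. scaleV (a k) (p k)) = 0" for T a
  proof (rule ccontr)
    define z where "z = (\<Sum>k\<in>T. scaleV (a k) (q k))"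
    assume "(\<Sum>k\<in>T. scaleV (a k) (q k)) \<noteq> 0"
    then have "z \<notin> {0}" by (simp add: z_def)
    from exists_extremal[OF V.subspace_single_0 this] obtain w where
      w: "set w \<subseteq> I" "word True w z \<noteq> 0" and "\<forall>i\<in>I. act (chev True i) (word True w z) = 0" by auto
    then have hwz: "word True w z \<in> hw_space" by (simp add: hw_space_def)
    \<comment> \<open>One scalar serves both families, because x and \<open>A0 x\<close> lie in the
      same space \<open>hw \<zeta>\<close>.\<close>
    have "\<forall>k\<in>T. \<exists>c. word True w (p k) - scaleV c (snd k) \<in> V.span lowered \<and>
        word True w (q k) - scaleV c (A0 (snd k)) \<in> V.span lowered"
    proof
      fix k assume "k \<in> T"
      then obtain u x \<zeta> where k: "k = (u, x)" "set u \<subseteq> I" "x \<in> hw \<zeta>" using T(2) by (auto simp: K_def)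
      from word_word_scalar[OF w(1) k(2), of \<zeta>] A0_hw[OF k(3)] k
      show "\<exists>c. word True w (p k) - scaleV c (snd k) \<in> V.span lowered \<and>
        word True w (q k) - scaleV c (A0 (snd k)) \<in> V.span lowered"
        by (auto simp: p_def q_def)
    qed
    from bchoice[OF this] obtain c where
      cp: "\<And>k. k \<in> T \<Longrightarrow> word True w (p k) - scaleV (c k) (snd k) \<in> V.span lowered" and
      cq: "\<And>k. k \<in> T \<Longrightarrow> word True w (q k) - scaleV (c k) (A0 (snd k)) \<in> V.span lowered" by blast
    define y where "y = (\<Sum>k\<in>T. scaleV (a k * c k) (snd k))"
    have snd_hw: "snd k \<in> hw_space" "A0 (snd k) \<in> hw_space" if "k \<in> T" for k
      using that T(2) A0_hw by (auto simp: K_def hw_def)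
    have y_hw: "y \<in> hw_space"
      unfolding y_def using snd_hw by (intro V.subspace_sum[OF hw_space_subspace] V.subspace_scale[OF hw_space_subspace])
    have A0y: "A0 y = (\<Sum>k\<in>T. scaleV (a k * c k) (A0 (snd k)))" by (simp add: y_def A0.sum A0.scale)
    have A0y_hw: "A0 y \<in> hw_space"
      unfolding A0y using snd_hw by (intro V.subspace_sum[OF hw_space_subspace] V.subspace_scale[OF hw_space_subspace])
    have "word True w (\<Sum>k\<in>T. scaleV (a k) (p k)) - y = (\<Sum>k\<in>T. scaleV (a k) (word True w (p k) - scaleV (c k) (snd k)))"
      by (simp add: y_def word_sum word_scale V.scale_right_diff_distrib sum_subtractf)
    also have "\<dots> \<in> V.span lowered" using cp by (intro V.span_sum V.span_scale)
    finally have "- y \<in> V.span lowered" by (simp add: p0)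
    then have "y = 0" using lowered_hw_zero[OF _ y_hw] V.span_neg by fastforce
    have "word True w z - A0 y = (\<Sum>k\<in>T. scaleV (a k) (word True w (q k) - scaleV (c k) (A0 (snd k))))"
      by (simp add: z_def A0y word_sum word_scale V.scale_right_diff_distrib sum_subtractf)
    also have "\<dots> \<in> V.span lowered" using cq by (intro V.span_sum V.span_scale)
    finally have "word True w z \<in> V.span lowered" by (simp add: \<open>y = 0\<close> A0.zero)
    then show False using lowered_hw_zero[OF _ hwz] w(2) by simp
  qed
  from linear_extension_of_spanning_family[OF V.vector_space_axioms, of p K q] pK generated_span rel
  obtain A where A: "Vector_Spaces.linear scaleV scaleV A" and Apq: "\<And>k. k \<in> K \<Longrightarrow> A (p k) = q k" by metis
  interpret A: Vector_Spaces.linear scaleV scaleV A by fact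
  have Aw: "A (word False u x) = word False u (A0 x)" if "set u \<subseteq> I" "x \<in> hw \<zeta>" for u x \<zeta>
    using Apq[of "(u, x)"] that by (auto simp: K_def p_def q_def)
  have A_hw: "A x = A0 x" if "x \<in> hw \<zeta>" for x \<zeta> using Aw[of "[]" x \<zeta>] that by simp
  have A_wt: "A v \<in> Vw \<mu>" if v: "v \<in> Vw \<mu>" for v \<mu>
  proof -
    have "v \<in> V.span (generated \<inter> Vw \<mu>)"
      using generated_homogeneous v by (intro span_weight) (auto simp: generated_span)
    then show ?thesis
    proof (induction rule: V.span_induct_alt)
      case base
      then show ?case by (simp add: A.zero V.subspace_0[OF Vw_subspace])
    next
      case (step c s y)
      have "A s \<in> Vw \<mu>"
      proof (cases "s = 0")
        case True
        then show ?thesis by (simp add: A.zero V.subspace_0[OF Vw_subspace])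
      next
        case False
        obtain u x \<zeta> where s: "s = word False u x" "set u \<subseteq> I" "x \<in> hw \<zeta>" using step by (auto simp: generated_def)
        have "s \<in> Vw (\<zeta> + signed False (wsum u))" using word_weight s by (simp add: hw_def)
        then have "\<mu> = \<zeta> + signed False (wsum u)" using Vw_unique False step by blast
        moreover have "A s \<in> Vw (\<zeta> + signed False (wsum u))"
          using Aw[OF s(2,3)] word_weight[OF s(2)] A0_hw[OF s(3)] by (simp add: s(1) hw_def)
        ultimately show ?thesis by simp
      qed
      then show ?case using step
        by (simp add: A.add A.scale V.subspace_add[OF Vw_subspace] V.subspace_scale[OF Vw_subspace])
    qed
  qed
  \<comment> \<open>Commutation with a generator need only be checked on words, which span
    everything by \<open>generated_span\<close>.\<close>
  have extend: "A (act (chev \<sigma> i) v) = act (chev \<sigma> i) (A v)"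
    if *: "\<And>u x \<zeta>. set u \<subseteq> I \<Longrightarrow> x \<in> hw \<zeta> \<Longrightarrow> A (act (chev \<sigma> i) (word False u x)) = act (chev \<sigma> i) (A (word False u x))"
    for \<sigma> i v
  proof -
    have "v \<in> V.span generated" by (simp add: generated_span)
    then show ?thesis
    proof (induction rule: V.span_induct_alt)
      case (step c s y)
      then have "A (act (chev \<sigma> i) s) = act (chev \<sigma> i) (A s)" using * by (auto simp: generated_def)
      then show ?case using step by (simp add: act_add_right act_scale_right A.add A.scale)
    qed (simp add: A.zero)
  qed
  have A_lower: "A (act (chev False i) v) = act (chev False i) (A v)" if i: "i \<in> I" for i v
  proof (rule extend)
    fix u x \<zeta> assume "set u \<subseteq> I" "x \<in> hw \<zeta>"
    then show "A (act (chev False i) (word False u x)) = act (chev False i) (A (word False u x))"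
      using Aw[of "i # u" x \<zeta>] Aw[of u x \<zeta>] i by simp
  qed
  have A_raise: "A (act (chev True i) v) = act (chev True i) (A v)" if i: "i \<in> I" for i v
  proof (rule extend)
    fix u x \<zeta> assume u: "set u \<subseteq> I" and x: "x \<in> hw \<zeta>"
    from u show "A (act (chev True i) (word False u x)) = act (chev True i) (A (word False u x))"
    proof (induction u)
      case Nil
      then show ?case using A_hw[OF x] A0_hw[OF x] x i by (simp add: hw_def hw_space_def A.zero)
    next
      case (Cons j u)
      then have j: "j \<in> I" and u: "set u \<subseteq> I" by auto
      define y where "y = word False u x"
      have IH: "A (act (chev True i) y) = act (chev True i) (A y)" using Cons.IH[OF u] by (simp add: y_def)
      have y: "y \<in> Vw (\<zeta> + signed False (wsum u))" using word_weight[OF u] x by (simp add: y_def hw_def)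
      have "A (act (bracket (chev True i) (chev False j)) y) = act (bracket (chev True i) (chev False j)) (A y)"
      proof (cases "i = j")
        case True
        then show ?thesis using chev_bracket[OF i, of True] act_h[OF y, of "simple i"] act_h[OF A_wt[OF y], of "simple i"]
          by (simp add: signed_def A.scale)
      next
        case False
        then show ?thesis using bracket_chev_distinct[OF i j] by (simp add: A.zero)
      qed
      then show ?case unfolding word_Cons y_def[symmetric]
        by (simp add: act_act[of "chev True i" "chev False j"] A.add A_lower[OF j] IH)
    qed
  qed
  have "A (act (chev \<sigma> i) v) = act (chev \<sigma> i) (A v)" if "i \<in> I" for \<sigma> i v
    using A_lower[OF that] A_raise[OF that] by (cases \<sigma>) simp_all
  then show thesis using that A A_hw A_wt by blast
qed

lemma module_map_identity:
  assumes A: "Vector_Spaces.linear scaleV scaleV A" and A_hw: "\<And>\<zeta> x. x \<in> hw \<zeta> \<Longrightarrow> A x = x"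
    and A_act: "\<And>i v. i \<in> I \<Longrightarrow> A (act (chev False i) v) = act (chev False i) (A v)"
  shows "A v = v"
proof -
  interpret A: Vector_Spaces.linear scaleV scaleV A by fact
  have w: "A (word False u x) = word False u x" if "set u \<subseteq> I" "x \<in> hw \<zeta>" for u x \<zeta>
    using that by (induction u) (auto simp: A_hw A_act)
  have "v \<in> V.span generated" by (simp add: generated_span)
  then show ?thesis
    by (induction rule: V.span_induct_alt) (auto simp: w A.zero A.add A.scale generated_def)
qed

end

section \<open>Pairs of perfect bases\<close>

locale perfect_operator_basis = vector_space scl
  for scl :: "complex \<Rightarrow> 'v::ab_group_add \<Rightarrow> 'v" +
  fixes E :: "'v \<Rightarrow> 'v" and B :: "'v set" and f :: "'v \<Rightarrow> 'v option"
  assumes linear_E: "Vector_Spaces.linear scl scl E"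
    and nilpotent: "\<exists>n. (E ^^ n) v = 0"
    and independent_B: "independent B" and span_B: "span B = UNIV"
    and perfect: "perfect_operator scl E B f"
begin

lemma E_add: "E (v + w) = E v + E w" and E_scale: "E (scl c v) = scl c (E v)" and E_zero [simp]: "E 0 = 0"
proof -
  interpret E: Vector_Spaces.linear scl scl E by (rule linear_E)
  show "E (v + w) = E v + E w" "E (scl c v) = scl c (E v)" "E 0 = 0" by (rule E.add E.scale E.zero)+
qed

lemma Epow_add: "(E ^^ n) (v + w) = (E ^^ n) v + (E ^^ n) w"
  and Epow_scale: "(E ^^ n) (scl c v) = scl c ((E ^^ n) v)"
  and Epow_zero [simp]: "(E ^^ n) 0 = 0"
  by (induction n) (simp_all add: E_add E_scale)

lemma Epow_sum: "(E ^^ n) (\<Sum>a\<in>A. g a) = (\<Sum>a\<in>A. (E ^^ n) (g a))"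
  by (induction A rule: infinite_finite_induct) (simp_all add: Epow_add)

lemma Epow_mono: "(E ^^ m) v = 0 \<Longrightarrow> m \<le> n \<Longrightarrow> (E ^^ n) v = 0"
  by (metis Epow_zero add.commute funpow_add le_Suc_ex o_apply)

lemma Epow_nonzero_iff:
  assumes "v \<noteq> 0" shows "(E ^^ n) v \<noteq> 0 \<longleftrightarrow> n \<le> ell E v"
proof -
  obtain N where N: "(E ^^ N) v = 0" using nilpotent by blast
  have bound: "n \<le> N" if "(E ^^ n) v \<noteq> 0" for n using Epow_mono[OF N] that by (metis linorder_le_cases)
  have "(E ^^ ell E v) v \<noteq> 0"
    unfolding ell_def using assms by (intro GreatestI_nat[where P = "\<lambda>l. (E ^^ l) v \<noteq> 0" and k = 0 and b = N] bound) auto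
  moreover have "n \<le> ell E v" if "(E ^^ n) v \<noteq> 0"
    unfolding ell_def using that by (intro Greatest_le_nat[where P = "\<lambda>l. (E ^^ l) v \<noteq> 0" and b = N] bound)
  ultimately show ?thesis using Epow_mono by blast
qed

lemma ell_eqI: "(E ^^ l) v \<noteq> 0 \<Longrightarrow> (E ^^ Suc l) v = 0 \<Longrightarrow> ell E v = l"
  using Epow_nonzero_iff[of v l] Epow_nonzero_iff[of v "Suc l"]
  by (cases "v = 0") (auto simp del: funpow.simps)

lemma basis_nonzero: "b \<in> B \<Longrightarrow> b \<noteq> 0"
  using independent_B dependent_zero by blast

lemma ell_zero_iff: "b \<in> B \<Longrightarrow> ell E b = 0 \<longleftrightarrow> E b = 0"
  using Epow_nonzero_iff[of b 1] basis_nonzero by fastforce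

text \<open>With l = ell(b) - 1, applying E^l to E b = c b' + w kills w and gives E^(l+1) b = c E^l
  b', which is nonzero; one further power kills everything. So ell drops by exactly one, and the top
  vectors of b and b' are proportional.\<close>

lemma f_SomeD: assumes "f b = Some b'"
  shows "b \<in> B" "b' \<in> B" "E b \<noteq> 0" "ell E b = Suc (ell E b')" "\<exists>c. c \<noteq> 0 \<and> (E ^^ ell E b) b = scl c ((E ^^ ell E b') b')"
proof -
  show bB: "b \<in> B" and "b' \<in> B"
    using perfect assms unfolding perfect_operator_def partial_bijection_def by (auto simp: dom_def ran_def)
  show Eb: "E b \<noteq> 0" using perfect assms bB unfolding perfect_operator_def by force
  define l where "l = ell E b - 1"
  have l: "ell E b = Suc l" using Eb ell_zero_iff[OF bB] by (simp add: l_def)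
  obtain c w where cw: "c \<noteq> 0" "(E ^^ l) w = 0" "E b = scl c b' + w"
    using perfect assms unfolding perfect_operator_def ker_pow_def l_def by blast
  have Suc_pow: "(E ^^ Suc n) b = scl c ((E ^^ n) b') + (E ^^ n) w" for n
    using cw(3) by (simp add: funpow_swap1 Epow_add Epow_scale)
  have top: "(E ^^ Suc l) b = scl c ((E ^^ l) b')" using Suc_pow[of l] cw(2) by simp
  have nz: "(E ^^ l) b' \<noteq> 0"
    using top Epow_nonzero_iff[OF basis_nonzero[OF bB], of "Suc l"] l by auto
  have "(E ^^ Suc (Suc l)) b = 0" using Epow_nonzero_iff[OF basis_nonzero[OF bB], of "Suc (Suc l)"] l by auto
  moreover have "(E ^^ Suc l) w = 0" using Epow_mono[OF cw(2), of "Suc l"] by simp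
  ultimately have "scl c ((E ^^ Suc l) b') = 0" using Suc_pow[of "Suc l"] by simp
  then have "ell E b' = l" using nz cw(1) by (intro ell_eqI) auto
  then show "ell E b = Suc (ell E b')" "\<exists>c. c \<noteq> 0 \<and> (E ^^ ell E b) b = scl c ((E ^^ ell E b') b')"
    using l top cw(1) by auto
qed

lemma f_None_iff: "b \<in> B \<Longrightarrow> f b = None \<longleftrightarrow> E b = 0"
  using perfect unfolding perfect_operator_def by blast

lemma f_inj: "f b1 = Some b' \<Longrightarrow> f b2 = Some b' \<Longrightarrow> b1 = b2"
  using perfect unfolding perfect_operator_def partial_bijection_def inj_on_def dom_def by fastforce

text \<open>The top of the string through a basis vector. For \<open>b\<close> in \<open>B\<close>,
  \<open>the\<close> never meets \<open>None\<close>, since ell counts the available steps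
  exactly.\<close>

definition ftop :: "'v \<Rightarrow> 'v" where "ftop b = ((\<lambda>b. the (f b)) ^^ ell E b) b"

lemma ftop_step: "f b = Some b' \<Longrightarrow> ftop b = ftop b'"
  using f_SomeD(4)[of b b'] by (simp add: ftop_def funpow_Suc_right del: funpow.simps)

lemma ftop_ell0: "ell E b = 0 \<Longrightarrow> ftop b = b"
  by (simp add: ftop_def)

lemma ell_SucD:
  assumes "b \<in> B" "ell E b = Suc n" obtains b' where "f b = Some b'" "ell E b' = n"
proof -
  have "E b \<noteq> 0" using ell_zero_iff[OF assms(1)] assms(2) by simp
  then obtain b' where "f b = Some b'" using f_None_iff[OF assms(1)] by blast
  with f_SomeD(4)[OF this] assms(2) that show thesis by simp
qed

lemma ftop: "b \<in> B \<Longrightarrow> ftop b \<in> B \<and> (\<exists>c. c \<noteq> 0 \<and> (E ^^ ell E b) b = scl c (ftop b))"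
proof (induction "ell E b" arbitrary: b)
  case 0
  then show ?case by (auto simp: ftop_ell0[OF 0(1)[symmetric]] simp flip: 0(1) intro!: exI[of _ 1])
next
  case (Suc n)
  from ell_SucD[OF Suc.prems Suc.hyps(2)[symmetric]] obtain b' where b': "f b = Some b'" "ell E b' = n" by blast
  from Suc.hyps(1)[OF b'(2)[symmetric] f_SomeD(2)[OF b'(1)]] obtain c where
    c: "ftop b' \<in> B" "c \<noteq> 0" "(E ^^ ell E b') b' = scl c (ftop b')" by blast
  from f_SomeD(5)[OF b'(1)] obtain c' where c': "c' \<noteq> 0" "(E ^^ ell E b) b = scl c' ((E ^^ ell E b') b')" by blast
  have "(E ^^ ell E b) b = scl (c' * c) (ftop b)" by (simp add: c' c(3) ftop_step[OF b'(1)])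
  then show ?case using c c' by (intro conjI exI[of _ "c' * c"]) (auto simp: ftop_step[OF b'(1)])
qed

lemma ftop_in: "b \<in> B \<Longrightarrow> ftop b \<in> B"
  using ftop by blast

text \<open>Equality of ell is essential: all members of one string share their top and are told
  apart only by their distance from it.\<close>

lemma ftop_inj: "b1 \<in> B \<Longrightarrow> b2 \<in> B \<Longrightarrow> ell E b1 = ell E b2 \<Longrightarrow> ftop b1 = ftop b2 \<Longrightarrow> b1 = b2"
proof (induction "ell E b1" arbitrary: b1 b2)
  case 0
  then show ?case using ftop_ell0 by metis
next
  case (Suc n)
  from ell_SucD[OF Suc.prems(1) Suc.hyps(2)[symmetric]] obtain b1' where 1: "f b1 = Some b1'" "ell E b1' = n" by blast
  have "ell E b2 = Suc n" using Suc by simp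
  from ell_SucD[OF Suc.prems(2) this] obtain b2' where 2: "f b2 = Some b2'" "ell E b2' = n" by blast
  have "b1' = b2'"
    by (rule Suc.hyps(1)) (use 1 2 f_SomeD(2) ftop_step Suc.prems(4) in auto)
  then show ?case using f_inj 1 2 by blast
qed

definition supp :: "'v \<Rightarrow> 'v set" where "supp v = {b. representation B v b \<noteq> 0}"

lemma supp: "finite (supp v)" "supp v \<subseteq> B" "(\<Sum>b\<in>supp v. scl (representation B v b) b) = v"
  unfolding supp_def using finite_representation representation_ne_zero
    sum_nonzero_representation_eq[OF independent_B, of v] span_B by auto

lemma supp_basis: "b \<in> B \<Longrightarrow> supp b = {b}"
  by (auto simp: supp_def representation_basis[OF independent_B] split: if_splits)

lemma supp_scale: "c \<noteq> 0 \<Longrightarrow> supp (scl c v) = supp v"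
  by (simp add: supp_def representation_scale[OF independent_B] span_B)

text \<open>E^l kills the basis vectors with smaller ell and sends the others to nonzero multiples
  of their tops. By \<open>ftop_inj\<close> these tops are distinct, so nothing cancels.\<close>

lemma supp_top:
  assumes bound: "\<And>b. b \<in> supp v \<Longrightarrow> ell E b \<le> l"
  shows "supp ((E ^^ l) v) = ftop ` {b \<in> supp v. ell E b = l}"
proof -
  let ?S = "{b \<in> supp v. ell E b = l}"
  have SB: "b \<in> B" if "b \<in> supp v" for b using that supp(2) by auto
  have "\<forall>b\<in>?S. \<exists>c. c \<noteq> 0 \<and> (E ^^ l) b = scl c (ftop b)" using ftop SB by blast
  from bchoice[OF this] obtain c where c: "\<And>b. b \<in> ?S \<Longrightarrow> c b \<noteq> 0 \<and> (E ^^ l) b = scl (c b) (ftop b)" by blast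
  define a where "a b = representation B v b * c b" for b
  have a: "a b \<noteq> 0" if "b \<in> ?S" for b using that c[OF that] by (simp add: a_def supp_def)
  have "(E ^^ l) v = (E ^^ l) (\<Sum>b\<in>supp v. scl (representation B v b) b)" by (simp only: supp(3))
  also have "\<dots> = (\<Sum>b\<in>supp v. scl (representation B v b) ((E ^^ l) b))" by (simp only: Epow_sum Epow_scale)
  also have "\<dots> = (\<Sum>b\<in>?S. scl (representation B v b) ((E ^^ l) b))"
  proof (rule sum.mono_neutral_right)
    show "\<forall>b\<in>supp v - ?S. scl (representation B v b) ((E ^^ l) b) = 0"
    proof
      fix b assume b: "b \<in> supp v - ?S"
      then have "\<not> l \<le> ell E b" using bound[of b] by auto
      then show "scl (representation B v b) ((E ^^ l) b) = 0"
        using Epow_nonzero_iff[OF basis_nonzero[OF SB], of b l] b by auto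
    qed
  qed (use supp(1) in auto)
  also have "\<dots> = (\<Sum>b\<in>?S. scl (a b) (ftop b))"
    by (intro sum.cong refl) (simp add: c a_def)
  finally have expand: "(E ^^ l) v = (\<Sum>b\<in>?S. scl (a b) (ftop b))" .
  have rep: "representation B ((E ^^ l) v) x = (\<Sum>b\<in>?S. a b * (if x = ftop b then 1 else 0))" for x
  proof -
    have "representation B ((E ^^ l) v) x = (\<Sum>b\<in>?S. a b * representation B (ftop b) x)"
      unfolding expand by (simp add: representation_sum[OF independent_B] representation_scale[OF independent_B] span_B)
    also have "\<dots> = (\<Sum>b\<in>?S. a b * (if x = ftop b then 1 else 0))"
      using ftop_in SB by (intro sum.cong) (auto simp: representation_basis[OF independent_B])
    finally show ?thesis .
  qed
  have inj: "b1 = b2" if "b1 \<in> ?S" "b2 \<in> ?S" "ftop b1 = ftop b2" for b1 b2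
    using that ftop_inj[of b1 b2] SB by auto
  have "representation B ((E ^^ l) v) (ftop b) = a b" if b: "b \<in> ?S" for b
  proof -
    have "representation B ((E ^^ l) v) (ftop b) = (\<Sum>b'\<in>?S. if b' = b then a b else 0)"
      unfolding rep using inj[OF b] by (intro sum.cong) auto
    then show ?thesis using b supp(1) by simp
  qed
  moreover have "representation B ((E ^^ l) v) x = 0" if "x \<notin> ftop ` ?S" for x
    unfolding rep using that by (intro sum.neutral) auto
  ultimately show ?thesis using a unfolding supp_def[of "(E ^^ l) v"] by auto
qed

text \<open>At the maximal ell over the support, \<open>supp_top\<close> gives a nonempty support,
  so that power of E does not kill \<open>v\<close>.\<close>

lemma supp_ell_le:
  assumes "b \<in> supp v" shows "ell E b \<le> ell E v"
proof -
  define m where "m = Max (ell E ` supp v)"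
  have m: "ell E b' \<le> m" if "b' \<in> supp v" for b' using that supp(1) by (simp add: m_def)
  have "m \<in> ell E ` supp v" unfolding m_def using assms supp(1) by (intro Max_in) auto
  then have "supp ((E ^^ m) v) \<noteq> {}" using supp_top[OF m] by auto
  then have "(E ^^ m) v \<noteq> 0" by (auto simp: supp_def representation_zero)
  moreover from this have "v \<noteq> 0" by auto
  ultimately have "m \<le> ell E v" using Epow_nonzero_iff by blast
  then show ?thesis using m[OF assms] by simp
qed

lemma supp_top_ell: "supp ((E ^^ ell E v) v) = ftop ` {b \<in> supp v. ell E b = ell E v}"
  by (rule supp_top[OF supp_ell_le])

end

section \<open>Two perfect bases for the same operator\<close>

locale perfect_operator_bases =
  L: perfect_operator_basis scl E B f + R: perfect_operator_basis scl E B' f'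
  for scl :: "complex \<Rightarrow> 'v::ab_group_add \<Rightarrow> 'v" and E B f B' f'
begin

definition mutual :: "'v \<Rightarrow> 'v \<Rightarrow> bool" where
  "mutual b b' \<longleftrightarrow> b \<in> B \<and> b' \<in> B' \<and> b' \<in> R.supp b \<and> b \<in> L.supp b'"

lemma mutual_ell: "mutual b b' \<Longrightarrow> ell E b = ell E b'"
  using L.supp_ell_le R.supp_ell_le unfolding mutual_def by (meson order_antisym)

text \<open>The top of \<open>b\<close> in the first basis is proportional to the last nonzero power
  of E on \<open>b\<close>, whose expansion in the second basis is known from
  \<open>supp_top_ell\<close>.\<close>

lemma supp_ftop: "b \<in> B \<Longrightarrow> R.supp (L.ftop b) = R.ftop ` {b' \<in> R.supp b. ell E b' = ell E b}"
  using L.ftop[of b] R.supp_top_ell[of b] R.supp_scale by metis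

lemma ftop_supp: "b \<in> B \<Longrightarrow> b' \<in> R.supp b \<Longrightarrow> ell E b' = ell E b \<Longrightarrow> R.ftop b' \<in> R.supp (L.ftop b)"
  using supp_ftop by blast

lemma supp_ftopD:
  assumes "b \<in> B" "b' \<in> B'" "ell E b' = ell E b" "R.ftop b' \<in> R.supp (L.ftop b)"
  shows "b' \<in> R.supp b"
proof -
  obtain x where x: "x \<in> R.supp b" "ell E x = ell E b" "R.ftop b' = R.ftop x"
    using assms supp_ftop[OF assms(1)] by auto
  then have "x = b'" using R.ftop_inj[of x b'] assms R.supp(2) by auto
  with x show ?thesis by simp
qed

end

sublocale perfect_operator_bases \<subseteq> flip: perfect_operator_bases scl E B' f' B f
  by unfold_locales

context perfect_operator_bases
begin

lemma mutual_ftop: "mutual b b' \<Longrightarrow> mutual (L.ftop b) (R.ftop b')"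
  using mutual_ell[of b b'] ftop_supp[of b b'] flip.ftop_supp[of b' b] L.ftop_in R.ftop_in
  by (simp add: mutual_def)

lemma mutual_lift:
  "b \<in> B \<Longrightarrow> b' \<in> B' \<Longrightarrow> ell E b = ell E b' \<Longrightarrow> mutual (L.ftop b) (R.ftop b') \<Longrightarrow> mutual b b'"
  using supp_ftopD[of b b'] flip.supp_ftopD[of b' b] by (simp add: mutual_def)

lemma mutual_from_ftop:
  assumes b: "b \<in> B" and m: "mutual (L.ftop b) c"
  obtains b' where "mutual b b'" "R.ftop b' = c"
proof -
  obtain b' where b': "b' \<in> R.supp b" "ell E b' = ell E b" "R.ftop b' = c"
    using m supp_ftop[OF b] unfolding mutual_def by auto
  moreover have "b' \<in> B'" using b'(1) R.supp(2) by auto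
  ultimately have "mutual b b'" using mutual_lift[OF b] m by simp
  then show thesis using that b'(3) by blast
qed

text \<open>The successors have the same tops as \<open>b\<close> and \<open>b'\<close> and equal
  ell, so the match at the tops lifts back to them.\<close>

lemma mutual_step:
  assumes m: "mutual b b'" and c: "f b = Some c"
  shows "\<exists>c'. f' b' = Some c' \<and> mutual c c'"
proof -
  have b: "b \<in> B" "b' \<in> B'" using m by (auto simp: mutual_def)
  have "ell E b' = Suc (ell E c)" using mutual_ell[OF m] L.f_SomeD(4)[OF c] by simp
  from R.ell_SucD[OF b(2) this] obtain c' where c': "f' b' = Some c'" "ell E c' = ell E c" by blast
  have "mutual c c'"
    by (rule mutual_lift)
      (use mutual_ftop[OF m] L.ftop_step[OF c] R.ftop_step[OF c'(1)] L.f_SomeD(2)[OF c] R.f_SomeD(2)[OF c'(1)] c' in auto)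
  with c' show ?thesis by blast
qed

lemma mutual_map_option:
  assumes \<Phi>: "\<And>b b'. mutual b b' \<longleftrightarrow> b \<in> B \<and> b' = \<Phi> b" and b: "b \<in> B"
  shows "f' (\<Phi> b) = map_option \<Phi> (f b)"
proof (cases "f b")
  case None
  have m: "mutual b (\<Phi> b)" using \<Phi> b by simp
  have "\<Phi> b \<in> B'" using m by (simp add: mutual_def)
  moreover have "ell E (\<Phi> b) = 0" using mutual_ell[OF m] L.ell_zero_iff[OF b] L.f_None_iff[OF b] None by simp
  ultimately show ?thesis using None R.ell_zero_iff R.f_None_iff by simp
next
  case (Some c)
  have m: "mutual b (\<Phi> b)" using \<Phi> b by simp
  from mutual_step[OF m Some] obtain c' where "f' (\<Phi> b) = Some c'" "mutual c c'" by blast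
  then show ?thesis using Some \<Phi> by simp
qed

end

text \<open>Compare \<open>B\<close> with itself: matching is then equality, and commutation of the
  matching with the two partial bijections says that they coincide.\<close>

lemma perfect_operator_unique:
  assumes "perfect_operator_basis scl E B f" "perfect_operator_basis scl E B f'"
  shows "f = f'"
proof
  interpret perfect_operator_bases scl E B f B f'
    using assms by (simp add: perfect_operator_bases_def)
  fix b
  have supp: "L.supp v = R.supp v" for v by (simp add: L.supp_def R.supp_def)
  have m: "mutual b b' \<longleftrightarrow> b \<in> B \<and> b' = id b" for b b'
    using L.supp_basis R.supp_basis by (auto simp: mutual_def)
  show "f b = f' b"
  proof (cases "b \<in> B")
    case True
    then show ?thesis using mutual_map_option[of id, OF m] by (simp add: option.map_id)
  next
    case False
    then show ?thesis using L.f_SomeD(1) R.f_SomeD(1) by (metis not_Some_eq)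
  qed
qed

text \<open>\<open>J\<close> indexes all operators to be compared, \<open>U\<close> those along
  which the induction climbs to the common top vectors; for crystals these are both signs and the
  raising generators.\<close>

locale perfect_bases = vector_space scl
  for scl :: "complex \<Rightarrow> 'v::ab_group_add \<Rightarrow> 'v" +
  fixes E :: "'k \<Rightarrow> 'v \<Rightarrow> 'v" and J U :: "'k set" and B B' :: "'v set" and f f' :: "'k \<Rightarrow> 'v \<Rightarrow> 'v option"
  assumes U: "U \<subseteq> J"
    and bases: "k \<in> J \<Longrightarrow> perfect_operator_bases scl (E k) B (f k) B' (f' k)"
    and words_nilpotent: "\<exists>N. \<forall>u. set u \<subseteq> U \<longrightarrow> length u \<ge> N \<longrightarrow> foldr E u v = 0"
    and B: "independent B" "span B = UNIV" and B': "independent B'" "span B' = UNIV"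
    and same_top: "{b \<in> B. \<forall>k\<in>U. E k b = 0} = {b \<in> B'. \<forall>k\<in>U. E k b = 0}"
begin

definition mutual :: "'v \<Rightarrow> 'v \<Rightarrow> bool" where
  "mutual b b' \<longleftrightarrow> b \<in> B \<and> b' \<in> B' \<and> representation B' b b' \<noteq> 0 \<and> representation B b' b \<noteq> 0"

text \<open>Matching is the same relation for every operator. This lets one induction climb by
  varying operators and makes the final bijection compatible with all of them at once.\<close>

lemma mutual_eq: "k \<in> J \<Longrightarrow> perfect_operator_bases.mutual scl B B' = mutual"
proof (intro ext)
  fix b b' assume "k \<in> J"
  then interpret P: perfect_operator_bases scl "E k" B "f k" B' "f' k" by (rule bases)
  show "P.mutual b b' = mutual b b'" by (simp add: P.mutual_def mutual_def P.L.supp_def P.R.supp_def)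
qed

definition depth :: "'v \<Rightarrow> nat" where
  "depth v = (LEAST N. \<forall>u. set u \<subseteq> U \<longrightarrow> length u \<ge> N \<longrightarrow> foldr E u v = 0)"

lemma depth: "set u \<subseteq> U \<Longrightarrow> length u \<ge> depth v \<Longrightarrow> foldr E u v = 0"
  using LeastI_ex[OF words_nilpotent[of v]] unfolding depth_def by blast

text \<open>Up to a nonzero scalar the top arises from \<open>b\<close> by ell successive
  applications, so any word on the top extends to a word on \<open>b\<close> that is longer by
  ell.\<close>

lemma depth_ftop:
  assumes b: "b \<in> B" and k: "k \<in> U" and ne: "E k b \<noteq> 0"
  shows "depth (perfect_operator_basis.ftop (E k) (f k) b) < depth b"
proof -
  interpret P: perfect_operator_bases scl "E k" B "f k" B' "f' k" using bases k U by auto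
  let ?l = "ell (E k) b"
  have l: "?l > 0" using P.L.ell_zero_iff[OF b] ne by auto
  obtain c where c: "c \<noteq> 0" "(E k ^^ ?l) b = scl c (P.L.ftop b)" using P.L.ftop[OF b] by blast
  have lin: "foldr E u (scl c v) = scl c (foldr E u v)" if "set u \<subseteq> U" for u v
    using that
  proof (induction u)
    case (Cons j u)
    then interpret Q: perfect_operator_bases scl "E j" B "f j" B' "f' j" using bases U by auto
    show ?case using Cons by (simp add: Q.L.E_scale)
  qed simp
  have "foldr E u (P.L.ftop b) = 0" if u: "set u \<subseteq> U" "length u \<ge> depth b - ?l" for u
  proof -
    have "scl c (foldr E u (P.L.ftop b)) = foldr E (u @ replicate ?l k) b"
      using c(2) lin[OF u(1)] by (simp add: foldr_replicate)
    also have "\<dots> = 0" using u k by (intro depth) auto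
    finally show ?thesis using c(1) by simp
  qed
  then have "depth (P.L.ftop b) \<le> depth b - ?l" unfolding depth_def[of "P.L.ftop b"] by (intro Least_le) blast
  moreover have "depth b > 0"
    using depth[of "[]" b] P.L.basis_nonzero[OF b] by (cases "depth b") auto
  ultimately show ?thesis using l by linarith
qed

lemma mutual_top:
  assumes "b \<in> B" "\<forall>k\<in>U. E k b = 0" shows "mutual b b' \<longleftrightarrow> b' = b"
proof -
  have "b \<in> B'" using assms same_top by blast
  then show ?thesis using assms
    by (auto simp: mutual_def representation_basis[OF B'(1)] representation_basis[OF B(1)] split: if_splits)
qed

text \<open>A vector killed by all operators in \<open>U\<close> is its own partner. Otherwise the
  partner of the top of a nontrivial string lifts to a partner of \<open>b\<close>; two partners
  would have the same top and the same ell, hence agree.\<close>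

lemma ex1_mutual: "b \<in> B \<Longrightarrow> \<exists>!b'. mutual b b'"
proof (induction "depth b" arbitrary: b rule: less_induct)
  case less
  show ?case
  proof (cases "\<forall>k\<in>U. E k b = 0")
    case True
    then show ?thesis using mutual_top[OF less.prems] by auto
  next
    case False
    then obtain k where k: "k \<in> U" "E k b \<noteq> 0" by auto
    then have kJ: "k \<in> J" using U by auto
    interpret P: perfect_operator_bases scl "E k" B "f k" B' "f' k" by (rule bases[OF kJ])
    note eq = mutual_eq[OF kJ]
    have ex1: "\<exists>!c. mutual (P.L.ftop b) c"
      using depth_ftop[OF less.prems k] P.L.ftop_in[OF less.prems] by (rule less.hyps)
    then obtain c where c: "mutual (P.L.ftop b) c" by blast
    then obtain b' where b': "mutual b b'" using P.mutual_from_ftop[OF less.prems] unfolding eq by blast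
    have "x = b'" if x: "mutual b x" for x
    proof -
      have "P.R.ftop x = P.R.ftop b'"
        using P.mutual_ftop[of b x] P.mutual_ftop[of b b'] x b' ex1 unfolding eq by blast
      moreover have "ell (E k) x = ell (E k) b'"
        using P.mutual_ell[of b x] P.mutual_ell[of b b'] x b' unfolding eq by simp
      ultimately show ?thesis using P.R.ftop_inj[of x b'] x b' by (simp add: mutual_def)
    qed
    with b' show ?thesis by blast
  qed
qed

end

sublocale perfect_bases \<subseteq> flip: perfect_bases scl E J U B' B f' f
proof (intro perfect_bases.intro perfect_bases_axioms.intro vector_space_axioms)
  fix k assume "k \<in> J"
  then interpret P: perfect_operator_bases scl "E k" B "f k" B' "f' k" by (rule bases)
  show "perfect_operator_bases scl (E k) B' (f' k) B (f k)" by (rule P.flip.perfect_operator_bases_axioms)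
qed (use U words_nilpotent B B' same_top in auto)

context perfect_bases
begin

text \<open>Injectivity and surjectivity are existence and uniqueness with the two bases exchanged.
  The nonvanishing coefficient is recorded because it is what later forces equal weights.\<close>

theorem perfect_bases_bijection:
  obtains \<Phi> where "bij_betw \<Phi> B B'"
    "\<And>b. b \<in> B \<Longrightarrow> representation B' b (\<Phi> b) \<noteq> 0"
    "\<And>b k. b \<in> B \<Longrightarrow> k \<in> J \<Longrightarrow> ell (E k) (\<Phi> b) = ell (E k) b"
    "\<And>b k. b \<in> B \<Longrightarrow> k \<in> J \<Longrightarrow> f' k (\<Phi> b) = map_option \<Phi> (f k b)"
proof -
  define \<Phi> where "\<Phi> b = (THE b'. mutual b b')" for b
  have mutual_\<Phi>: "mutual b (\<Phi> b)" if "b \<in> B" for b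
    unfolding \<Phi>_def by (rule theI'[OF ex1_mutual[OF that]])
  have \<Phi>: "mutual b b' \<longleftrightarrow> b \<in> B \<and> b' = \<Phi> b" for b b'
  proof
    show "b \<in> B \<and> b' = \<Phi> b" if "mutual b b'"
      using that ex1_mutual mutual_\<Phi> by (metis mutual_def)
  qed (use mutual_\<Phi> in auto)
  have flip: "flip.mutual b' b \<longleftrightarrow> mutual b b'" for b b'
    by (auto simp: mutual_def flip.mutual_def)
  have "bij_betw \<Phi> B B'"
  proof (rule bij_betw_imageI)
    show "inj_on \<Phi> B"
    proof (rule inj_onI)
      fix x y assume "x \<in> B" "y \<in> B" "\<Phi> x = \<Phi> y"
      then have "mutual x (\<Phi> x)" "mutual y (\<Phi> x)" using mutual_\<Phi> by metis+
      then show "x = y" using flip.ex1_mutual[of "\<Phi> x"] unfolding flip by (auto simp: mutual_def)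
    qed
    show "\<Phi> ` B = B'"
    proof (intro equalityI subsetI)
      fix x assume "x \<in> B'"
      then obtain b where "mutual b x" using flip.ex1_mutual[of x] unfolding flip by blast
      then show "x \<in> \<Phi> ` B" using \<Phi> by auto
    qed (use mutual_\<Phi> in \<open>auto simp: mutual_def\<close>)
  qed
  moreover have "representation B' b (\<Phi> b) \<noteq> 0" if "b \<in> B" for b
    using mutual_\<Phi>[OF that] by (simp add: mutual_def)
  moreover have "ell (E k) (\<Phi> b) = ell (E k) b" "f' k (\<Phi> b) = map_option \<Phi> (f k b)" if "b \<in> B" "k \<in> J" for b k
  proof -
    interpret P: perfect_operator_bases scl "E k" B "f k" B' "f' k" using that by (intro bases)
    show "ell (E k) (\<Phi> b) = ell (E k) b"
      using P.mutual_ell[of b "\<Phi> b"] mutual_\<Phi>[OF that(1)] mutual_eq[OF that(2)] by simp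
    show "f' k (\<Phi> b) = map_option \<Phi> (f k b)"
      by (rule P.mutual_map_option) (use \<Phi> mutual_eq[OF that(2)] that in auto)
  qed
  ultimately show thesis using that by blast
qed

end

section \<open>Isomorphism of the crystals\<close>

context locally_finite_dual_module
begin

definition perfect_family :: "'v set \<Rightarrow> ('i + 'i \<Rightarrow> 'v \<Rightarrow> 'v option) \<Rightarrow> bool" where
  "perfect_family B f \<longleftrightarrow> V.independent B \<and> V.span B = UNIV \<and> (\<forall>b\<in>B. \<exists>\<mu>. b \<in> Vw \<mu>) \<and>
     (\<forall>k\<in>I <+> I. perfect_operator scaleV (act (e k)) B (f k))"

lemma perfect_basis_family:
  assumes "perfect_basis pairing I h e scaleV act B" obtains f where "perfect_family B f"
proof -
  have "\<forall>k\<in>I <+> I. \<exists>f. perfect_operator scaleV (act (e k)) B f"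
    using assms by (simp add: perfect_basis_def)
  from bchoice[OF this] obtain f where "\<forall>k\<in>I <+> I. perfect_operator scaleV (act (e k)) B (f k)" by blast
  then show thesis using assms that by (simp add: perfect_basis_def perfect_family_def)
qed

lemma e_chev: "k \<in> I <+> I \<Longrightarrow> \<exists>\<sigma> i. i \<in> I \<and> e k = chev \<sigma> i"
  by (auto simp: chev_def)

lemma perfect_family_operator:
  assumes "perfect_family B f" "k \<in> I <+> I"
  shows "perfect_operator_basis scaleV (act (e k)) B (f k)"
proof (intro perfect_operator_basis.intro perfect_operator_basis_axioms.intro V.vector_space_axioms act_linear)
  fix v
  obtain \<sigma> i where i: "i \<in> I" "e k = chev \<sigma> i" using e_chev[OF assms(2)] by blast
  obtain N where N: "\<And>u. set u \<subseteq> I \<Longrightarrow> length u \<ge> N \<Longrightarrow> word \<sigma> u v = 0" using word_nilpotent[of \<sigma> v] by blast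
  have "word \<sigma> (replicate N i) v = 0" using i(1) by (intro N) auto
  then show "\<exists>n. (act (e k) ^^ n) v = 0" by (auto simp: word_def foldr_replicate i(2))
qed (use assms in \<open>auto simp: perfect_family_def\<close>)

lemma perfect_family_operators:
  "perfect_family B f \<Longrightarrow> perfect_family B' f' \<Longrightarrow> k \<in> I <+> I \<Longrightarrow>
    perfect_operator_bases scaleV (act (e k)) B (f k) B' (f' k)"
  by (intro perfect_operator_bases.intro perfect_family_operator)

lemma representation_weight:
  assumes B: "perfect_family B f" and v: "v \<in> Vw \<mu>" and b: "V.representation B v b \<noteq> 0"
  shows "b \<in> B \<inter> Vw \<mu>"
proof -
  have "v \<in> V.span (B \<inter> Vw \<mu>)" using B v by (intro span_weight) (auto simp: perfect_family_def)
  then have "V.representation B v = V.representation (B \<inter> Vw \<mu>) v"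
    using B by (intro V.representation_extend) (auto simp: perfect_family_def)
  then show ?thesis using b V.representation_ne_zero by metis
qed

text \<open>A highest weight vector has ell zero for each e_i, so by \<open>supp_ell_le\<close>
  every basis vector in its expansion is killed by each e_i as well.\<close>

lemma hw_span_basis:
  assumes B: "perfect_family B f" shows "V.span (B \<inter> hw \<zeta>) = hw \<zeta>"
proof
  show "V.span (B \<inter> hw \<zeta>) \<subseteq> hw \<zeta>" by (intro V.span_minimal hw_subspace) auto
  show "hw \<zeta> \<subseteq> V.span (B \<inter> hw \<zeta>)"
  proof
    fix v assume v: "v \<in> hw \<zeta>"
    have ind: "V.independent B" and span: "V.span B = UNIV" using B by (auto simp: perfect_family_def)
    have *: "b \<in> B \<inter> hw \<zeta>" if b: "V.representation B v b \<noteq> 0" for b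
    proof -
      have bB: "b \<in> B" "b \<in> Vw \<zeta>" using representation_weight[OF B _ b, of \<zeta>] v by (auto simp: hw_def)
      have "act (chev True i) b = 0" if i: "i \<in> I" for i
      proof -
        interpret P: perfect_operator_basis scaleV "act (e (Inl i))" B "f (Inl i)"
          using i by (intro perfect_family_operator[OF B]) auto
        have e: "e (Inl i) = chev True i" by (simp add: chev_def)
        have "v \<noteq> 0" using b by (auto simp: V.representation_zero)
        then have "ell (act (e (Inl i))) v = 0"
          using P.Epow_nonzero_iff[of v 1] v i by (auto simp: e hw_def hw_space_def)
        then have "ell (act (e (Inl i))) b = 0" using P.supp_ell_le[of b v] b by (simp add: P.supp_def)
        then show ?thesis using P.ell_zero_iff[OF bB(1)] by (simp add: e)
      qed
      then show ?thesis using bB by (simp add: hw_def hw_space_def)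
    qed
    have sum: "(\<Sum>b | V.representation B v b \<noteq> 0. scaleV (V.representation B v b) b) = v"
      by (rule V.sum_nonzero_representation_eq[OF ind]) (simp add: span)
    have "(\<Sum>b | V.representation B v b \<noteq> 0. scaleV (V.representation B v b) b) \<in> V.span (B \<inter> hw \<zeta>)"
      using * by (intro V.span_sum V.span_scale V.span_base) auto
    then show "v \<in> V.span (B \<inter> hw \<zeta>)" by (simp only: sum)
  qed
qed

lemma weight_THE: "b \<in> Vw \<mu> \<Longrightarrow> b \<noteq> 0 \<Longrightarrow> (THE \<mu>. b \<in> Vw \<mu>) = \<mu>"
  using Vw_unique by blast

lemma perfect_family_nonzero: "perfect_family B f \<Longrightarrow> b \<in> B \<Longrightarrow> b \<noteq> 0"
  using V.dependent_zero unfolding perfect_family_def by blast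

text \<open>In each weight both bases restrict to bases of the same, possibly infinite-dimensional,
  space and are therefore equinumerous; the bijections are glued along the weight, which a nonzero
  vector determines.\<close>

lemma hw_bijection:
  assumes B: "perfect_family B f" and B': "perfect_family B' f'"
  obtains g where "bij_betw g (B \<inter> hw_space) (B' \<inter> hw_space)" "\<And>b \<zeta>. b \<in> B \<inter> hw \<zeta> \<Longrightarrow> g b \<in> hw \<zeta>"
    "\<And>b \<zeta>. b \<in> B' \<inter> hw \<zeta> \<Longrightarrow> inv_into (B \<inter> hw_space) g b \<in> hw \<zeta>"
proof -
  have "\<exists>g. bij_betw g (B \<inter> hw \<zeta>) (B' \<inter> hw \<zeta>)" for \<zeta>
  proof (rule V.bij_if_span_eq_span_bases)
    show "V.independent (B \<inter> hw \<zeta>)" "V.independent (B' \<inter> hw \<zeta>)"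
      using B B' V.independent_mono[of B "B \<inter> hw \<zeta>"] V.independent_mono[of B' "B' \<inter> hw \<zeta>"]
      by (auto simp: perfect_family_def)
    show "V.span (B \<inter> hw \<zeta>) = V.span (B' \<inter> hw \<zeta>)" by (simp add: hw_span_basis[OF B] hw_span_basis[OF B'])
  qed
  then obtain g0 where g0: "\<And>\<zeta>. bij_betw (g0 \<zeta>) (B \<inter> hw \<zeta>) (B' \<inter> hw \<zeta>)" by metis
  define g where "g b = g0 (THE \<mu>. b \<in> Vw \<mu>) b" for b
  have g: "g b = g0 \<zeta> b" if "b \<in> B \<inter> hw \<zeta>" for b \<zeta>
    using that weight_THE[of b \<zeta>] perfect_family_nonzero[OF B] by (auto simp: g_def hw_def)
  have g_in: "g b \<in> B' \<inter> hw \<zeta>" if "b \<in> B \<inter> hw \<zeta>" for b \<zeta>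
    unfolding g[OF that] using g0[of \<zeta>] that by (rule bij_betw_apply)
  have wt: "\<exists>\<zeta>. b \<in> C \<inter> hw \<zeta>" if "b \<in> C \<inter> hw_space" "perfect_family C fc" for b C fc
    using that by (auto simp: perfect_family_def hw_def)
  have "inj_on g (B \<inter> hw_space)"
  proof (rule inj_onI)
    fix x y assume xy: "x \<in> B \<inter> hw_space" "y \<in> B \<inter> hw_space" "g x = g y"
    from wt[OF xy(1) B] wt[OF xy(2) B] obtain \<zeta> \<zeta>' where z: "x \<in> B \<inter> hw \<zeta>" "y \<in> B \<inter> hw \<zeta>'" by blast
    have "g x \<in> hw \<zeta>" "g x \<in> hw \<zeta>'" "g x \<noteq> 0"
      using g_in[OF z(1)] g_in[OF z(2)] xy(3) perfect_family_nonzero[OF B'] by auto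
    then have "\<zeta> = \<zeta>'" using Vw_unique by (auto simp: hw_def)
    then show "x = y" using xy(3) g[OF z(1)] g[of y \<zeta>] z g0[of \<zeta>] by (auto simp: bij_betw_def inj_on_def)
  qed
  moreover have img: "\<exists>b\<in>B \<inter> hw \<zeta>. g b = b'" if "b' \<in> B' \<inter> hw \<zeta>" for b' \<zeta>
  proof -
    have "b' \<in> g0 \<zeta> ` (B \<inter> hw \<zeta>)" using g0[of \<zeta>] that by (simp add: bij_betw_def)
    then show ?thesis using g by force
  qed
  moreover have "g ` (B \<inter> hw_space) = B' \<inter> hw_space"
  proof (intro equalityI subsetI)
    fix y assume "y \<in> g ` (B \<inter> hw_space)"
    then obtain x where x: "x \<in> B \<inter> hw_space" "y = g x" by blast
    from wt[OF x(1) B] obtain \<zeta> where "x \<in> B \<inter> hw \<zeta>" by blast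
    then show "y \<in> B' \<inter> hw_space" using g_in x(2) by (auto simp: hw_def)
  next
    fix y assume "y \<in> B' \<inter> hw_space"
    from wt[OF this B'] obtain \<zeta> where "y \<in> B' \<inter> hw \<zeta>" by blast
    from img[OF this] obtain x where "x \<in> B \<inter> hw \<zeta>" "g x = y" by blast
    then show "y \<in> g ` (B \<inter> hw_space)" by (auto simp: hw_def)
  qed
  ultimately have bij: "bij_betw g (B \<inter> hw_space) (B' \<inter> hw_space)" by (simp add: bij_betw_def)
  moreover have "inv_into (B \<inter> hw_space) g b \<in> hw \<zeta>" if b: "b \<in> B' \<inter> hw \<zeta>" for b \<zeta>
  proof -
    from img[OF b] obtain x where x: "x \<in> B \<inter> hw \<zeta>" "g x = b" by blast
    then have "inv_into (B \<inter> hw_space) g b = x"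
      using bij by (intro inv_into_f_eq) (auto simp: bij_betw_def hw_def)
    then show ?thesis using x by simp
  qed
  ultimately show thesis using that g_in by blast
qed

lemma hw_basis_extension:
  assumes B: "perfect_family B f" and g: "\<And>b \<zeta>. b \<in> B \<inter> hw \<zeta> \<Longrightarrow> g b \<in> hw \<zeta>"
  obtains A where "Vector_Spaces.linear scaleV scaleV A" "\<And>b. b \<in> B \<inter> hw_space \<Longrightarrow> A b = g b"
    "\<And>\<zeta> v. v \<in> hw \<zeta> \<Longrightarrow> A v \<in> hw \<zeta>"
    "\<And>\<mu> v. v \<in> Vw \<mu> \<Longrightarrow> A v \<in> Vw \<mu>" "\<And>\<sigma> i v. i \<in> I \<Longrightarrow> A (act (chev \<sigma> i) v) = act (chev \<sigma> i) (A v)"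
proof -
  interpret P: vector_space_pair scaleV scaleV by unfold_locales
  have ind: "V.independent (B \<inter> hw_space)" using B V.independent_mono[of B "B \<inter> hw_space"] by (auto simp: perfect_family_def)
  define A0 where "A0 = P.construct (B \<inter> hw_space) g"
  have A0: "Vector_Spaces.linear scaleV scaleV A0" unfolding A0_def by (rule P.linear_construct[OF ind])
  interpret A0: Vector_Spaces.linear scaleV scaleV A0 by fact
  have A0g: "A0 b = g b" if "b \<in> B \<inter> hw_space" for b unfolding A0_def by (rule P.construct_basis[OF ind that])
  have A0_hw: "A0 v \<in> hw \<zeta>" if "v \<in> hw \<zeta>" for v \<zeta>
  proof -
    have "v \<in> V.span (B \<inter> hw \<zeta>)" using that hw_span_basis[OF B] by simp
    then show ?thesis
    proof (induction rule: V.span_induct_alt)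
      case (step c x y)
      have "A0 x \<in> hw \<zeta>" using A0g[of x] g step(1) by (auto simp: hw_def)
      then show ?case using step
        by (simp add: A0.add A0.scale V.subspace_add[OF hw_subspace] V.subspace_scale[OF hw_subspace])
    qed (simp add: A0.zero V.subspace_0[OF hw_subspace])
  qed
  from highest_weight_extension[OF A0 A0_hw] obtain A where A: "Vector_Spaces.linear scaleV scaleV A"
    "\<And>\<zeta> x. x \<in> hw \<zeta> \<Longrightarrow> A x = A0 x" "\<And>\<mu> v. v \<in> Vw \<mu> \<Longrightarrow> A v \<in> Vw \<mu>"
    "\<And>\<sigma> i v. i \<in> I \<Longrightarrow> A (act (chev \<sigma> i) v) = act (chev \<sigma> i) (A v)" by blast
  have "A b = g b" if b: "b \<in> B \<inter> hw_space" for b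
  proof -
    obtain \<zeta> where "b \<in> Vw \<zeta>" using b B by (auto simp: perfect_family_def)
    then have "b \<in> hw \<zeta>" using b by (simp add: hw_def)
    then show ?thesis using A(2) A0g[OF b] by simp
  qed
  moreover have "A v \<in> hw \<zeta>" if "v \<in> hw \<zeta>" for \<zeta> v using A(2) A0_hw that by simp
  ultimately show thesis by (rule that[OF A(1) _ _ A(3,4)])
qed

text \<open>The bijection of highest weight bases and its inverse both extend to module maps. Their
  composites fix V^+, and a module map fixing V^+ is the identity because V^+ generates
  \<open>V\<close>.\<close>

lemma hw_automorphism:
  assumes B: "perfect_family B f" and B': "perfect_family B' f'"
  obtains A A' where "Vector_Spaces.linear scaleV scaleV A" "\<And>v. A' (A v) = v" "\<And>v. A (A' v) = v"
    "A ` (B \<inter> hw_space) = B' \<inter> hw_space"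
    "\<And>\<mu> v. v \<in> Vw \<mu> \<Longrightarrow> A v \<in> Vw \<mu>" "\<And>\<sigma> i v. i \<in> I \<Longrightarrow> A (act (chev \<sigma> i) v) = act (chev \<sigma> i) (A v)"
proof -
  from hw_bijection[OF B B'] obtain g where
    g: "bij_betw g (B \<inter> hw_space) (B' \<inter> hw_space)" "\<And>b \<zeta>. b \<in> B \<inter> hw \<zeta> \<Longrightarrow> g b \<in> hw \<zeta>"
    "\<And>b \<zeta>. b \<in> B' \<inter> hw \<zeta> \<Longrightarrow> inv_into (B \<inter> hw_space) g b \<in> hw \<zeta>" by blast
  let ?g' = "inv_into (B \<inter> hw_space) g"
  from hw_basis_extension[of B f g, OF B g(2)] obtain A where A: "Vector_Spaces.linear scaleV scaleV A"
    "\<And>b. b \<in> B \<inter> hw_space \<Longrightarrow> A b = g b" "\<And>\<zeta> v. v \<in> hw \<zeta> \<Longrightarrow> A v \<in> hw \<zeta>"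
    "\<And>\<mu> v. v \<in> Vw \<mu> \<Longrightarrow> A v \<in> Vw \<mu>" "\<And>\<sigma> i v. i \<in> I \<Longrightarrow> A (act (chev \<sigma> i) v) = act (chev \<sigma> i) (A v)"
    by blast
  from hw_basis_extension[of B' f' ?g', OF B' g(3)] obtain A' where A': "Vector_Spaces.linear scaleV scaleV A'"
    "\<And>b. b \<in> B' \<inter> hw_space \<Longrightarrow> A' b = ?g' b" "\<And>\<zeta> v. v \<in> hw \<zeta> \<Longrightarrow> A' v \<in> hw \<zeta>"
    "\<And>\<mu> v. v \<in> Vw \<mu> \<Longrightarrow> A' v \<in> Vw \<mu>" "\<And>\<sigma> i v. i \<in> I \<Longrightarrow> A' (act (chev \<sigma> i) v) = act (chev \<sigma> i) (A' v)"
    by blast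
  have inverse: "T' (T v) = v"
    if C: "perfect_family C fc" and T: "Vector_Spaces.linear scaleV scaleV T" and T': "Vector_Spaces.linear scaleV scaleV T'"
      and CT: "\<And>b. b \<in> C \<inter> hw_space \<Longrightarrow> T' (T b) = b"
      and act: "\<And>\<sigma> i v. i \<in> I \<Longrightarrow> T (act (chev \<sigma> i) v) = act (chev \<sigma> i) (T v)"
        "\<And>\<sigma> i v. i \<in> I \<Longrightarrow> T' (act (chev \<sigma> i) v) = act (chev \<sigma> i) (T' v)" for C fc T T' v
  proof -
    interpret T: Vector_Spaces.linear scaleV scaleV T by fact
    interpret T': Vector_Spaces.linear scaleV scaleV T' by fact
    show ?thesis
    proof (rule module_map_identity[where A = "\<lambda>v. T' (T v)"])
      show "Vector_Spaces.linear scaleV scaleV (\<lambda>v. T' (T v))"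
        using Vector_Spaces.linear_compose[OF T T'] by (simp add: o_def)
      show "T' (T x) = x" if "x \<in> hw \<zeta>" for \<zeta> x
      proof -
        have "x \<in> V.span (C \<inter> hw \<zeta>)" using that hw_span_basis[OF C] by simp
        then show ?thesis
        proof (induction rule: V.span_induct_alt)
          case (step c x y)
          then show ?case using CT[of x] by (simp add: T.add T.scale T'.add T'.scale hw_def)
        qed (simp add: T.zero T'.zero)
      qed
    qed (simp add: act)
  qed
  have "A' (A v) = v" for v
    by (rule inverse[OF B A(1) A'(1) _ A(5) A'(5)])
      (use g(1) A(2) A'(2) bij_betw_apply[OF g(1)] bij_betw_inv_into_left[OF g(1)] in auto)
  moreover have "A (A' v) = v" for v
    by (rule inverse[OF B' A'(1) A(1) _ A'(5) A(5)])
      (use g(1) A(2) A'(2) bij_betw_apply[OF bij_betw_inv_into[OF g(1)]] bij_betw_inv_into_right[OF g(1)] in auto)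
  moreover have "A ` (B \<inter> hw_space) = B' \<inter> hw_space"
    using g(1) A(2) by (simp add: bij_betw_def)
  ultimately show thesis by (rule that[OF A(1) _ _ _ A(4,5)])
qed

lemma perfect_family_same_top:
  assumes B: "perfect_family B f" and B': "perfect_family B' f'" and top: "B \<inter> hw_space = B' \<inter> hw_space"
  shows "perfect_bases scaleV (\<lambda>k. act (e k)) (I <+> I) (Inl ` I) B B' f f'"
proof (intro perfect_bases.intro perfect_bases_axioms.intro V.vector_space_axioms)
  have hw: "hw_space = {v. \<forall>k\<in>Inl ` I. act (e k) v = 0}" by (auto simp: hw_space_def chev_def)
  show "{b \<in> B. \<forall>k\<in>Inl ` I. act (e k) b = 0} = {b \<in> B'. \<forall>k\<in>Inl ` I. act (e k) b = 0}"
    using top unfolding hw by blast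
  fix v
  obtain N where N: "\<And>u. set u \<subseteq> I \<Longrightarrow> length u \<ge> N \<Longrightarrow> word True u v = 0" using word_nilpotent[of True v] by blast
  have "foldr (\<lambda>k. act (e k)) u v = 0" if u: "set u \<subseteq> Inl ` I" "length u \<ge> N" for u
  proof -
    obtain u' where u': "u = map Inl u'" "set u' \<subseteq> I"
    proof -
      have "\<exists>u'. u = map Inl u' \<and> set u' \<subseteq> I" using u(1)
      proof (induction u)
        case (Cons k u)
        then obtain u' i where "u = map Inl u'" "set u' \<subseteq> I" "k = Inl i" "i \<in> I" by auto
        then show ?case by (intro exI[of _ "i # u'"]) auto
      qed simp
      then show thesis using that by blast
    qed
    have "foldr (\<lambda>k. act (e k)) u v = word True u' v"
      unfolding u'(1) word_def foldr_map by (simp add: chev_def o_def)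
    then show ?thesis using N[of u'] u u' by simp
  qed
  then show "\<exists>N. \<forall>u. set u \<subseteq> Inl ` I \<longrightarrow> N \<le> length u \<longrightarrow> foldr (\<lambda>k. act (e k)) u v = 0" by blast
qed (use B B' perfect_family_operators[OF B B'] in \<open>auto simp: perfect_family_def\<close>)

text \<open>Conjugation by a module automorphism preserves kernels of powers and hence ell, so it
  carries the partial bijections along with the basis.\<close>

lemma perfect_family_transport:
  assumes B: "perfect_family B f" and A: "Vector_Spaces.linear scaleV scaleV A"
    and inv: "\<And>v. A' (A v) = v" "\<And>v. A (A' v) = v"
    and A_wt: "\<And>\<mu> v. v \<in> Vw \<mu> \<Longrightarrow> A v \<in> Vw \<mu>"
    and A_act: "\<And>\<sigma> i v. i \<in> I \<Longrightarrow> A (act (chev \<sigma> i) v) = act (chev \<sigma> i) (A v)"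
  shows "perfect_family (A ` B) (\<lambda>k v. map_option A (f k (A' v)))"
    and "k \<in> I <+> I \<Longrightarrow> ell (act (e k)) (A v) = ell (act (e k)) v"
proof -
  interpret A: Vector_Spaces.linear scaleV scaleV A by fact
  have inj: "inj A" by (rule injI) (metis inv(1))
  have surj: "range A = UNIV" by (metis inv(2) surj_def)
  have comm: "A (act (e k) v) = act (e k) (A v)" if "k \<in> I <+> I" for k v
    using e_chev[OF that] A_act by metis
  have pow: "A ((act (e k) ^^ n) v) = (act (e k) ^^ n) (A v)" if "k \<in> I <+> I" for k n v
    by (induction n) (simp_all add: comm[OF that])
  have zero: "A v = 0 \<longleftrightarrow> v = 0" for v by (metis A.zero inv(1))
  have pow0: "(act (e k) ^^ n) (A v) = 0 \<longleftrightarrow> (act (e k) ^^ n) v = 0" if "k \<in> I <+> I" for k n v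
    using pow[OF that] zero by metis
  have ell: "ell (act (e k)) (A v) = ell (act (e k)) v" if "k \<in> I <+> I" for k v
    by (simp add: ell_def pow0[OF that])
  then show "k \<in> I <+> I \<Longrightarrow> ell (act (e k)) (A v) = ell (act (e k)) v" .
  show "perfect_family (A ` B) (\<lambda>k v. map_option A (f k (A' v)))"
    unfolding perfect_family_def
  proof (intro conjI ballI)
    show "V.independent (A ` B)"
      using B inj by (intro A.independent_injective_image) (auto simp: perfect_family_def inj_on_def)
    show "V.span (A ` B) = UNIV"
      using B surj A.span_image[of B] by (simp add: perfect_family_def)
    show "\<exists>\<mu>. b \<in> Vw \<mu>" if "b \<in> A ` B" for b
      using that B A_wt unfolding perfect_family_def by blast
    fix k assume k: "k \<in> I <+> I"
    have po: "perfect_operator scaleV (act (e k)) B (f k)" using B k by (simp add: perfect_family_def)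
    let ?f = "\<lambda>v. map_option A (f k (A' v))"
    show "perfect_operator scaleV (act (e k)) (A ` B) ?f"
      unfolding perfect_operator_def
    proof (intro conjI ballI allI impI)
      have dom: "dom (f k) \<subseteq> B" and ran: "ran (f k) \<subseteq> B" and injf: "inj_on (f k) (dom (f k))"
        using po by (auto simp: perfect_operator_def partial_bijection_def)
      show "partial_bijection (A ` B) ?f"
        unfolding partial_bijection_def
      proof (intro conjI)
        show "dom ?f \<subseteq> A ` B"
        proof
          fix v assume "v \<in> dom ?f"
          then have "A' v \<in> B" using dom by (auto simp: dom_def)
          then show "v \<in> A ` B" using inv(2)[of v] by (metis image_eqI)
        qed
        show "ran ?f \<subseteq> A ` B" using ran by (auto simp: ran_def)
        show "inj_on ?f (dom ?f)"
        proof (rule inj_onI)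
          fix x y assume xy: "x \<in> dom ?f" "y \<in> dom ?f" "?f x = ?f y"
          then have "f k (A' x) = f k (A' y)" using option.inj_map[OF inj] by (auto simp: inj_on_def)
          then have "A' x = A' y" using injf xy by (auto simp: inj_on_def dom_def)
          then show "x = y" by (metis inv(2))
        qed
      qed
      show "?f b \<noteq> None \<longleftrightarrow> act (e k) b \<noteq> 0" if "b \<in> A ` B" for b
        using that po inv(1) zero by (auto simp: perfect_operator_def simp flip: comm[OF k])
      fix b b' assume "?f b = Some b'"
      then obtain c' where c': "f k (A' b) = Some c'" "b' = A c'" by auto
      with po obtain c w where cw: "c \<noteq> 0" "w \<in> ker_pow (act (e k)) (ell (act (e k)) (A' b) - 1)"
        "act (e k) (A' b) = scaleV c c' + w" unfolding perfect_operator_def by blast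
      have "act (e k) b = scaleV c b' + A w"
        using arg_cong[OF cw(3), of A] by (simp add: comm[OF k] inv(2) A.add A.scale c'(2))
      moreover have "A w \<in> ker_pow (act (e k)) (ell (act (e k)) b - 1)"
        using cw(2) ell[OF k, of "A' b"] by (simp add: ker_pow_def pow0[OF k] inv(2))
      ultimately show "\<exists>c w. c \<noteq> 0 \<and> w \<in> ker_pow (act (e k)) (ell (act (e k)) b - 1) \<and> act (e k) b = scaleV c b' + w"
        using cw(1) by blast
    qed
  qed
qed

lemma etilde_crystal_of:
  assumes "perfect_family B f" "i \<in> I"
  shows "etilde (crystal_of pairing h e scaleV act B) i = f (Inl i)"
proof -
  have i: "Inl i \<in> I <+> I" using assms(2) by auto
  have "(THE f. perfect_operator scaleV (act (e (Inl i))) B f) = f (Inl i)"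
  proof (rule the_equality)
    show "perfect_operator scaleV (act (e (Inl i))) B (f (Inl i))" using assms(1) i by (auto simp: perfect_family_def)
    fix f' assume "perfect_operator scaleV (act (e (Inl i))) B f'"
    \<comment> \<open>Replacing a single member of the family puts the competing bijection under the
      same hypotheses, so that uniqueness applies.\<close>
    then have "perfect_family B (f(Inl i := f'))" using assms(1) by (simp add: perfect_family_def)
    from perfect_family_operator[OF this i] perfect_family_operator[OF assms(1) i]
    show "f' = f (Inl i)" by (intro perfect_operator_unique) auto
  qed
  then show ?thesis by (simp add: crystal_of_def)
qed

theorem perfect_family_crystals_isomorphic:
  assumes B: "perfect_family B f" and B': "perfect_family B' f'"
  shows "crystal_isomorphic I (crystal_of pairing h e scaleV act B) (crystal_of pairing h e scaleV act B')"
proof -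
  from hw_automorphism[OF B B'] obtain A A' where A: "Vector_Spaces.linear scaleV scaleV A"
    and inv: "\<And>v. A' (A v) = v" "\<And>v. A (A' v) = v" and top: "A ` (B \<inter> hw_space) = B' \<inter> hw_space"
    and A_wt: "\<And>\<mu> v. v \<in> Vw \<mu> \<Longrightarrow> A v \<in> Vw \<mu>"
    and A_act: "\<And>\<sigma> i v. i \<in> I \<Longrightarrow> A (act (chev \<sigma> i) v) = act (chev \<sigma> i) (A v)" by blast
  interpret A: Vector_Spaces.linear scaleV scaleV A by fact
  define f1 where "f1 = (\<lambda>k v. map_option A (f k (A' v)))"
  have B1: "perfect_family (A ` B) f1" and A_ell: "\<And>k v. k \<in> I <+> I \<Longrightarrow> ell (act (e k)) (A v) = ell (act (e k)) v"
    unfolding f1_def by (rule perfect_family_transport[OF B A inv A_wt A_act]; assumption)+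
  have zero: "A v = 0 \<longleftrightarrow> v = 0" for v by (metis A.zero inv(1))
  have "A v \<in> hw_space \<longleftrightarrow> v \<in> hw_space" for v
    by (auto simp: hw_space_def zero simp flip: A_act)
  then have "A ` B \<inter> hw_space = B' \<inter> hw_space" using top by auto
  then interpret P: perfect_bases scaleV "\<lambda>k. act (e k)" "I <+> I" "Inl ` I" "A ` B" B' f1 f'
    by (rule perfect_family_same_top[OF B1 B'])
  obtain \<Psi> where \<Psi>: "bij_betw \<Psi> (A ` B) B'" "\<And>b. b \<in> A ` B \<Longrightarrow> V.representation B' b (\<Psi> b) \<noteq> 0"
    "\<And>b k. b \<in> A ` B \<Longrightarrow> k \<in> I <+> I \<Longrightarrow> ell (act (e k)) (\<Psi> b) = ell (act (e k)) b"
    "\<And>b k. b \<in> A ` B \<Longrightarrow> k \<in> I <+> I \<Longrightarrow> f' k (\<Psi> b) = map_option \<Psi> (f1 k b)"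
    by (rule P.perfect_bases_bijection) blast
  define \<Phi> where "\<Phi> b = \<Psi> (A b)" for b
  have "bij_betw A B (A ` B)" by (rule inj_on_imp_bij_betw) (metis inj_onI inv(1))
  from bij_betw_trans[OF this \<Psi>(1)] have bij: "bij_betw \<Phi> B B'" by (simp add: \<Phi>_def[abs_def] o_def)
  have wt: "(THE \<mu>. \<Phi> b \<in> Vw \<mu>) = (THE \<mu>. b \<in> Vw \<mu>)" if b: "b \<in> B" for b
  proof -
    obtain \<mu> where \<mu>: "b \<in> Vw \<mu>" using b B by (auto simp: perfect_family_def)
    \<comment> \<open>\<open>\<Phi> b\<close> occurs in the expansion of the weight vector
      \<open>A b\<close> in the basis \<open>B'\<close>, so it has the weight of \<open>A b\<close>,
      which is that of \<open>b\<close>.\<close>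
    have "\<Phi> b \<in> B' \<inter> Vw \<mu>"
      using representation_weight[OF B' A_wt[OF \<mu>]] \<Psi>(2)[of "A b"] b by (simp add: \<Phi>_def)
    then show ?thesis
      using weight_THE[OF \<mu>] weight_THE[of "\<Phi> b" \<mu>] perfect_family_nonzero[OF B b] perfect_family_nonzero[OF B'] by simp
  qed
  have ell: "ell (act (e k)) (\<Phi> b) = ell (act (e k)) b" if "b \<in> B" "k \<in> I <+> I" for b k
    using \<Psi>(3)[of "A b" k] A_ell[of k b] that by (simp add: \<Phi>_def)
  have step: "f' k (\<Phi> b) = map_option \<Phi> (f k b)" if "b \<in> B" "k \<in> I <+> I" for b k
    using \<Psi>(4)[of "A b" k] that by (simp add: \<Phi>_def[abs_def] f1_def inv(1) option.map_comp o_def)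
  have "crystal_isomorphism I (crystal_of pairing h e scaleV act B) (crystal_of pairing h e scaleV act B') \<Phi>"
    unfolding crystal_isomorphism_def
  proof (intro conjI ballI)
    show "bij_betw \<Phi> (elems (crystal_of pairing h e scaleV act B)) (elems (crystal_of pairing h e scaleV act B'))"
      using bij by (simp add: crystal_of_def)
    fix b assume "b \<in> elems (crystal_of pairing h e scaleV act B)"
    then have b: "b \<in> B" by (simp add: crystal_of_def)
    show "wt (crystal_of pairing h e scaleV act B') (\<Phi> b) = wt (crystal_of pairing h e scaleV act B) b"
      using wt[OF b] by (simp add: crystal_of_def)
    fix i assume i: "i \<in> I"
    then have k: "Inl i \<in> I <+> I" "Inr i \<in> I <+> I" by auto
    show "eps (crystal_of pairing h e scaleV act B') i (\<Phi> b) = eps (crystal_of pairing h e scaleV act B) i b"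
      using ell[OF b k(1)] by (simp add: crystal_of_def)
    show "phi (crystal_of pairing h e scaleV act B') i (\<Phi> b) = phi (crystal_of pairing h e scaleV act B) i b"
      using ell[OF b k(2)] by (simp add: crystal_of_def)
    show "etilde (crystal_of pairing h e scaleV act B') i (\<Phi> b)
        = map_option \<Phi> (etilde (crystal_of pairing h e scaleV act B) i b)"
      using step[OF b k(1)] by (simp add: etilde_crystal_of[OF B i] etilde_crystal_of[OF B' i])
  qed
  then show ?thesis by (auto simp: crystal_isomorphic_def)
qed

end

theorem theorem5p55:
  fixes pairing :: "'x::ab_group_add \<Rightarrow> 'y::ab_group_add \<Rightarrow> int"
    and R :: "'x set"
    and coroot :: "'x \<Rightarrow> 'y"
    and I :: "'i set"
    and simple :: "'i \<Rightarrow> 'x"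
    and scale :: "complex \<Rightarrow> 'g::ab_group_add \<Rightarrow> 'g"
    and bracket :: "'g \<Rightarrow> 'g \<Rightarrow> 'g"
    and h :: "'x \<Rightarrow> 'g"
    and e :: "'i + 'i \<Rightarrow> 'g"
    and scaleV :: "complex \<Rightarrow> 'v::ab_group_add \<Rightarrow> 'v"
    and act :: "'g \<Rightarrow> 'v \<Rightarrow> 'v"
    and B B' :: "'v set"
  assumes "langlands_dual_lie_algebra pairing R coroot I simple scale bracket h e"
    and "lie_module scale bracket scaleV act"
    and "locally_finite pairing h scaleV act"
    and "perfect_basis pairing I h e scaleV act B"
    and "perfect_basis pairing I h e scaleV act B'"
  shows "crystal_isomorphic I (crystal_of pairing h e scaleV act B)
           (crystal_of pairing h e scaleV act B')"
proof -
  interpret locally_finite_dual_module pairing R coroot I simple scale bracket h e scaleV act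
    using assms by (intro locally_finite_dual_module.intro langlands_dual_module.intro
        locally_finite_dual_module_axioms.intro)
  obtain f f' where "perfect_family B f" "perfect_family B' f'"
    using perfect_basis_family assms(4,5) by metis
  then show ?thesis by (rule perfect_family_crystals_isomorphic)
qed

end
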